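(* Let $c\in[-\infty,+\infty)$, $I=(c,+\infty)$, $d\in I$, $y\in I$, $\gamma>0$, $T>0$ and $\kappa\in\mathbb{R}$. Let $f:I\to\mathbb{R}$ be a $\mathcal{C}^2$ function such that $$f(z')-f(z)\le\kappa(z'-z)\quad\text{for all } z,z'\in I \text{ with } z\le z',$$ and such that $$v(x)=\int_d^x\int_d^{\zeta}\exp\left(-\frac{2}{\gamma^2}\int_z^{\zeta} f(\xi)\,d\xi\right)dz\,d\zeta\quad\text{satisfies}\quad\lim_{x\to c+}v(x)=+\infty.$$ Let $W$ be a standard Brownian motion and let $Y$ be the unique strong solution, with values in $I$, of $dY_t=f(Y_t)\,dt+\gamma\,dW_t$, $Y_0=y$. Let $p\ge1$ and assume that $$\mathbb{E}\left[\left(\int_0^T\left|f'(Y_u)f(Y_u)+\frac{\gamma^2}{2}f''(Y_u)\right|du\right)^p\right]<\infty\quad\text{and}\quad\mathbb{E}\left[\left(\int_0^T(f'(Y_u))^2du\right)^{p/2}\right]<\infty.$$ Then there is a constant $K_p>0$ (not depending on $n$) such that for every integer $n\ge1$ with $n>2\kappa T$, $$\left(\mathbb{E}\left[\max_{t\in[0,T]}|\hat Y_t-Y_t|^p\right]\right)^{1/p}\le K_p\,\frac{T}{n},$$ where $\hat Y$ is the drift implicit Euler scheme with $n$ time steps defined in the context.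
   Context: Under the stated assumptions on $f$, the SDE $dY_t=f(Y_t)\,dt+\gamma\,dW_t$, $Y_0=y\in I$, admits a unique strong solution on $I$, which never reaches $c$ nor $+\infty$ (Feller's test). Drift implicit Euler scheme: let $t_k=kT/n$, $0\le k\le n$. For $h>0$ with $\kappa h<1$ the map $z\mapsto z-hf(z)$ is a bijection from $I$ to $\mathbb{R}$, so for $\kappa T/n<1$ the following scheme, driven by the same Brownian motion $W$, is well defined with values in $I$: $\hat Y_0=y$ and, for $0\le k\le n-1$ and $t\in(t_k,t_{k+1}]$, $\hat Y_t$ is the unique element of $I$ satisfying $$\hat Y_t=\hat Y_{t_k}+f(\hat Y_t)(t-t_k)+\gamma(W_t-W_{t_k}).$$ The dependence of $\hat Y$ on $n$ is suppressed in the notation. *)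

theory Defs
  imports "HOL-Probability.Probability"
begin

definition C2_on :: "real set \<Rightarrow> (real \<Rightarrow> real) \<Rightarrow> bool" where
  "C2_on I f \<longleftrightarrow>
     f C1_differentiable_on I \<and> deriv f C1_differentiable_on I"

(* The interval integrals are oriented, so x < d (the range that matters as x tends to the
   left end point) is covered by the same formula. *)
definition feller_v :: "(real \<Rightarrow> real) \<Rightarrow> real \<Rightarrow> real \<Rightarrow> real \<Rightarrow> real" where
  "feller_v f \<gamma> d x =
     (LBINT \<zeta>=ereal d..ereal x. (LBINT z=ereal d..ereal \<zeta>.
        exp (- (2 / \<gamma>\<^sup>2) * (LBINT \<xi>=ereal z..ereal \<zeta>. f \<xi>))))"

(* Time is the half-line {0..}; values of a process at negative times play no role.
   "Continuous process" means that every path is continuous. *)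
definition standard_brownian_motion ::
  "'a measure \<Rightarrow> (real \<Rightarrow> 'a \<Rightarrow> real) \<Rightarrow> bool" where
  "standard_brownian_motion M W \<longleftrightarrow>
     (\<forall>t\<ge>0. W t \<in> borel_measurable M) \<and>
     (\<forall>\<omega>\<in>space M. continuous_on {0..} (\<lambda>t. W t \<omega>)) \<and>
     (AE \<omega> in M. W 0 \<omega> = 0) \<and>
     (\<forall>s t. 0 \<le> s \<longrightarrow> s < t \<longrightarrow>
        distributed M lborel (\<lambda>\<omega>. W t \<omega> - W s \<omega>)
          (\<lambda>x. ennreal (normal_density 0 (sqrt (t - s)) x))) \<and>
     (\<forall>(\<tau> :: nat \<Rightarrow> real) m. 0 \<le> \<tau> 0 \<longrightarrow> mono \<tau> \<longrightarrow>
        prob_space.indep_vars M (\<lambda>_. borel)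
          (\<lambda>i \<omega>. W (\<tau> (Suc i)) \<omega> - W (\<tau> i) \<omega>) {..<m})"

definition augmented_filtration ::
  "'a measure \<Rightarrow> (real \<Rightarrow> 'a \<Rightarrow> real) \<Rightarrow> real \<Rightarrow> 'a measure" where
  "augmented_filtration M W t =
     sigma (space M)
       ({W s -` B \<inter> space M | s B. 0 \<le> s \<and> s \<le> t \<and> B \<in> sets borel} \<union> null_sets M)"

(* Strong solution, with values in I, of dY = f(Y) dt + \<gamma> dW, Y_0 = y.  The diffusion
   coefficient is constant, so its stochastic integral over [0,t] is \<gamma> (W_t - W_0). *)
definition strong_solution ::
  "'a measure \<Rightarrow> (real \<Rightarrow> 'a \<Rightarrow> real) \<Rightarrow> real set \<Rightarrow> (real \<Rightarrow> real) \<Rightarrow> real \<Rightarrow> real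
     \<Rightarrow> (real \<Rightarrow> 'a \<Rightarrow> real) \<Rightarrow> bool" where
  "strong_solution M W I f \<gamma> y Y \<longleftrightarrow>
     (\<forall>t\<ge>0. Y t \<in> borel_measurable (augmented_filtration M W t)) \<and>
     (\<forall>\<omega>\<in>space M. continuous_on {0..} (\<lambda>t. Y t \<omega>)) \<and>
     (\<forall>\<omega>\<in>space M. \<forall>t\<ge>0. Y t \<omega> \<in> I) \<and>
     (AE \<omega> in M. \<forall>t\<ge>0.
        Y t \<omega> = y + (LBINT u=ereal 0..ereal t. f (Y u \<omega>)) + \<gamma> * (W t \<omega> - W 0 \<omega>))"

(* The scheme is defined pathwise; w is a path of the Brownian motion. *)
definition implicit_step ::
  "real set \<Rightarrow> (real \<Rightarrow> real) \<Rightarrow> real \<Rightarrow> (real \<Rightarrow> real) \<Rightarrow> real \<Rightarrow> real \<Rightarrow> real \<Rightarrow> real" where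
  "implicit_step I f \<gamma> w s t x =
     (THE z. z \<in> I \<and> z = x + f z * (t - s) + \<gamma> * (w t - w s))"

definition grid_time :: "real \<Rightarrow> nat \<Rightarrow> nat \<Rightarrow> real" where
  "grid_time T n k = real k * T / real n"

primrec implicit_euler_grid ::
  "real set \<Rightarrow> (real \<Rightarrow> real) \<Rightarrow> real \<Rightarrow> real \<Rightarrow> real \<Rightarrow> nat \<Rightarrow> (real \<Rightarrow> real) \<Rightarrow> nat \<Rightarrow> real" where
  "implicit_euler_grid I f \<gamma> y T n w 0 = y"
| "implicit_euler_grid I f \<gamma> y T n w (Suc k) =
     implicit_step I f \<gamma> w (grid_time T n k) (grid_time T n (Suc k))
       (implicit_euler_grid I f \<gamma> y T n w k)"

(* For t in (t_k, t_{k+1}] the index k is \<lceil>t n / T\<rceil> - 1. *)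
definition implicit_euler ::
  "real set \<Rightarrow> (real \<Rightarrow> real) \<Rightarrow> real \<Rightarrow> real \<Rightarrow> real \<Rightarrow> nat \<Rightarrow> (real \<Rightarrow> real) \<Rightarrow> real \<Rightarrow> real" where
  "implicit_euler I f \<gamma> y T n w t =
     (if t \<le> 0 then y
      else let k = nat (\<lceil>t * real n / T\<rceil> - 1)
           in implicit_step I f \<gamma> w (grid_time T n k) t (implicit_euler_grid I f \<gamma> y T n w k))"

lemma implicit_euler_0: "implicit_euler I f \<gamma> y T n w 0 = y"
  by (simp add: implicit_euler_def)

lemma implicit_euler_between:
  assumes "T > 0" "n \<ge> 1" "grid_time T n k < t" "t \<le> grid_time T n (Suc k)"
  shows "implicit_euler I f \<gamma> y T n w t =
           implicit_step I f \<gamma> w (grid_time T n k) t (implicit_euler_grid I f \<gamma> y T n w k)"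
proof -
  have "\<lceil>t * real n / T\<rceil> = int k + 1"
    using assms by (intro ceiling_unique) (auto simp: grid_time_def field_simps)
  moreover have "0 \<le> grid_time T n k"
    using assms by (simp add: grid_time_def)
  ultimately show ?thesis
    using assms by (simp add: implicit_euler_def)
qed

lemma implicit_euler_grid_time:
  assumes "T > 0" "n \<ge> 1"
  shows "implicit_euler I f \<gamma> y T n w (grid_time T n k) = implicit_euler_grid I f \<gamma> y T n w k"
proof (cases k)
  case 0
  then show ?thesis by (simp add: grid_time_def implicit_euler_def)
next
  case (Suc j)
  have "grid_time T n j < grid_time T n (Suc j)"
    using assms by (simp add: grid_time_def field_simps)
  then show ?thesis
    using assms Suc by (simp add: implicit_euler_between[where k = j])
qed

lemma implicit_euler_step:
  assumes "T > 0" "n \<ge> 1" "grid_time T n k < t" "t \<le> grid_time T n (Suc k)"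
  shows "implicit_euler I f \<gamma> y T n w t =
           (THE z. z \<in> I \<and>
              z = implicit_euler I f \<gamma> y T n w (grid_time T n k)
                  + f z * (t - grid_time T n k) + \<gamma> * (w t - w (grid_time T n k)))"
  using assms by (simp add: implicit_euler_between implicit_euler_grid_time implicit_step_def)

end

theory Submission
  imports Defs
begin

text \<open>
  Write h = T / n and let t_0, ..., t_n be the grid.  Over a time interval [s, t] the solution fails to
  satisfy the implicit equation by the local defect (t - s) f(Y_t) - \<integral>_s^t f(Y_u) du, the error of the
  right-endpoint rule.  The proof bounds the error of the scheme by accumulated defects, path by path,
  and then bounds the p-th moment of the largest accumulated defect.

  The one-sided Lipschitz condition turns the implicit equations into a linear recursion for the error:
  a e_t = e_s + defect, with a multiplier a \<ge> 1 - \<kappa>+ h, where \<kappa>+ = max \<kappa> 0.  The multiplier is random, may be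
  arbitrarily large and looks into the future, so the recursion cannot be solved and then estimated
  as a martingale.  Subtracting the accumulated defect from the error removes the difficulty
  (damped_recursion_step): what is left is a contraction up to the factor 1 / (1 - \<kappa>+ h) in every
  step, hence the error is at most 2 exp(2 \<kappa>+ T) times the largest accumulated defect
  (scheme_error_le_accumulated_defect).  Feller's condition makes the implicit equation solvable:
  if c is finite and f is bounded above near c, then v is bounded there (drift_unbounded_at_left_end).

  Formally the accumulated defect is \<integral> (u - t_k(u)) df(Y_u), where t_k(u) is the last grid point before u.
  The integrand is at most h, which is where the rate comes from: by Ito's formula the finite variation part is
  at most h times the first integral in the hypotheses, and the martingale part is, by the
  Burkholder-Davis-Gundy inequality, of order h times the square root of the second one.
  No stochastic integral is constructed for this.  On dyadic refinements of the grid a second-order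
  Taylor expansion along the path gives increments of f(Y) in terms of the drift, of
  f'(Y) \<Delta>W and of f''(Y) ((\<Delta>W)^2 - \<Delta>); the remainders vanish for every path with bounded quadratic
  variation sums (Ito_remainder_vanishes), and the sums of the third kind vanish almost surely
  (weighted_squared_increments_vanish).

  What remains is a maximal inequality for the sums of f'(Y) \<Delta>W, which are discrete martingale transforms.
  It is proved by the good-\<lambda> method (good_lambda): the transform is stopped so that only second moments
  of bounded weights occur, and integrating the tails gives Burkholder's inequality with an additional
  term for the largest jump (burkholder_truncated).  All moments there are truncated, since nothing
  is known about the moments of f'(Y) at a fixed time.  As the grids are refined the jumps disappear, the
  discrete brackets converge to the second integral in the hypotheses, and the truncation
  is removed last (moment_bound_in_the_limit).
\<close>

section \<open>Continuous functions on compact intervals\<close>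

lemma continuous_Icc_bounded:
  fixes g :: "real \<Rightarrow> real"
  assumes "continuous_on {a..b} g"
  shows "\<exists>F>0. \<forall>u\<in>{a..b}. \<bar>g u\<bar> \<le> F"
proof -
  have "bounded (g ` {a..b})" by (intro compact_imp_bounded compact_continuous_image assms compact_Icc)
  then show ?thesis by (auto simp: bounded_pos)
qed

lemma continuous_Icc_modulus:
  fixes g :: "real \<Rightarrow> real"
  assumes "continuous_on {a..b} g" "0 < e"
  shows "\<exists>d>0. \<forall>u\<in>{a..b}. \<forall>v\<in>{a..b}. \<bar>u - v\<bar> < d \<longrightarrow> \<bar>g u - g v\<bar> < e"
proof -
  have "uniformly_continuous_on {a..b} g" by (rule compact_uniformly_continuous[OF assms(1) compact_Icc])
  then show ?thesis using assms(2) unfolding uniformly_continuous_on_def dist_real_def by (metis abs_minus_commute)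
qed

lemma continuous_compose_path:
  fixes g Y :: "real \<Rightarrow> real"
  assumes "continuous_on I g" "continuous_on S Y" "\<And>u. u \<in> S \<Longrightarrow> Y u \<in> I"
  shows "continuous_on S (\<lambda>u. g (Y u))"
  by (rule continuous_on_compose2[OF assms(1,2)]) (use assms(3) in auto)

lemma integral_split_continuous:
  fixes g :: "real \<Rightarrow> real"
  assumes "a \<le> s" "s \<le> t" "continuous_on {a..t} g"
  shows "integral {a..t} g = integral {a..s} g + integral {s..t} g"
  by (rule Henstock_Kurzweil_Integration.integral_combine[symmetric])
     (use assms in \<open>auto intro: integrable_continuous_interval\<close>)

text \<open>
  With x the value of g at either end point this is the error of the left or right rectangle rule.
\<close>

lemma rectangle_rule_error:
  fixes g :: "real \<Rightarrow> real"
  assumes st: "s \<le> t" and g: "continuous_on {s..t} g" and \<eta>: "\<And>u. u \<in> {s..t} \<Longrightarrow> \<bar>x - g u\<bar> \<le> \<eta>"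
  shows "\<bar>(t - s) * x - integral {s..t} g\<bar> \<le> (t - s) * \<eta>"
proof -
  have "((\<lambda>u. x - g u) has_integral ((t - s) * x - integral {s..t} g)) {s..t}"
    using has_integral_const_real[of x s t] st
    by (intro has_integral_diff integrable_integral integrable_continuous_interval g) simp
  then have "(t - s) * x - integral {s..t} g = integral {s..t} (\<lambda>u. x - g u)"
    by (simp add: integral_unique)
  moreover have "norm (integral {s..t} (\<lambda>u. x - g u)) \<le> \<eta> * (t - s)"
    by (rule integral_bound[OF st]) (use \<eta> in \<open>auto intro!: continuous_intros g\<close>)
  ultimately show ?thesis by (simp add: mult.commute)
qed

lemma SUP_continuous_eq_SUP_rational:
  fixes g :: "real \<Rightarrow> real"
  assumes g: "continuous_on {a..b} g" and ab: "a < b"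
  shows "(SUP t\<in>{a..b}. g t) = (SUP t\<in>{a<..<b} \<inter> \<rat>. g t)"
    and "bdd_above (g ` {a..b})"
proof -
  show bdd: "bdd_above (g ` {a..b})"
    by (intro bounded_imp_bdd_above compact_imp_bounded compact_continuous_image g compact_Icc)
  have cl: "closure ({a<..<b} \<inter> \<rat>) = {a..b}"
    using closure_open_Int_superset[of "{a<..<b}" "\<rat> :: real set"] ab by (simp add: Rats_closure_real)
  then have ne: "{a<..<b} \<inter> (\<rat> :: real set) \<noteq> {}" using ab by (metis atLeastatMost_empty_iff closure_empty less_le_not_le)
  have bdd': "bdd_above (g ` ({a<..<b} \<inter> \<rat>))" using bdd by (rule bdd_above_mono) auto
  show "(SUP t\<in>{a..b}. g t) = (SUP t\<in>{a<..<b} \<inter> \<rat>. g t)"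
  proof (rule antisym)
    show "(SUP t\<in>{a..b}. g t) \<le> (SUP t\<in>{a<..<b} \<inter> \<rat>. g t)"
    proof (rule cSUP_least)
      fix t assume t: "t \<in> {a..b}"
      show "g t \<le> (SUP t\<in>{a<..<b} \<inter> \<rat>. g t)"
      proof (rule continuous_le_on_closure[where f = g and x = t])
        show "continuous_on (closure ({a<..<b} \<inter> \<rat>)) g" using g by (simp only: cl)
        show "t \<in> closure ({a<..<b} \<inter> \<rat>)" using t by (simp only: cl)
        show "g x \<le> (SUP t\<in>{a<..<b} \<inter> \<rat>. g t)" if "x \<in> {a<..<b} \<inter> \<rat>" for x
          using that bdd' by (rule cSUP_upper)
      qed
    qed (use ab in auto)
    show "(SUP t\<in>{a<..<b} \<inter> \<rat>. g t) \<le> (SUP t\<in>{a..b}. g t)"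
      by (rule cSUP_subset_mono[OF ne bdd]) auto
  qed
qed

lemma borel_measurable_SUP_continuous:
  fixes X :: "real \<Rightarrow> 'a \<Rightarrow> real"
  assumes "a < b" and X: "\<And>t. t \<in> {a..b} \<Longrightarrow> X t \<in> borel_measurable M"
    and c: "\<And>\<omega>. \<omega> \<in> space M \<Longrightarrow> continuous_on {a..b} (\<lambda>t. X t \<omega>)"
  shows "(\<lambda>\<omega>. SUP t\<in>{a..b}. X t \<omega>) \<in> borel_measurable M"
proof -
  have "(\<lambda>\<omega>. SUP t\<in>{a<..<b} \<inter> \<rat>. X t \<omega>) \<in> borel_measurable M"
  proof (rule borel_measurable_cSUP)
    show "countable ({a<..<b} \<inter> \<rat>)" by (intro countable_Int2 countable_rat)
    show "bdd_above ((\<lambda>t. X t \<omega>) ` ({a<..<b} \<inter> \<rat>))" if "\<omega> \<in> space M" for \<omega>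
      using SUP_continuous_eq_SUP_rational(2)[OF c[OF that] \<open>a < b\<close>] by (rule bdd_above_mono) auto
  qed (use X in auto)
  then show ?thesis
    by (rule measurable_cong[THEN iffD1, rotated])
       (use SUP_continuous_eq_SUP_rational(1)[OF c \<open>a < b\<close>] in simp)
qed

section \<open>A Burkholder inequality for weighted sums of independent innovations\<close>

text \<open>
  The weights are switched off once the running sum exceeds c, so the surviving terms form an initial segment whose sum is at most c.
\<close>

lemma sum_while_partial_sums_small_le:
  fixes a :: "nat \<Rightarrow> real"
  assumes "\<And>i. 0 \<le> a i" "0 \<le> c"
  shows "(\<Sum>i<N. if (\<Sum>l\<le>i. a l) \<le> c then a i else 0) \<le> min c (\<Sum>i<N. a i)"
proof (induction N)
  case 0
  then show ?case using assms by simp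
next
  case (Suc N)
  have "(\<Sum>l\<le>N. a l) = (\<Sum>l<N. a l) + a N"
    by (metis lessThan_Suc_atMost sum.lessThan_Suc)
  then show ?case using Suc assms(1)[of N] by auto
qed

lemma first_passage:
  fixes S :: "nat \<Rightarrow> real"
  assumes "k \<le> N" "\<bar>S k\<bar> > c"
  obtains \<tau> where "\<tau> \<le> N" "\<bar>S \<tau>\<bar> > c" "\<And>i. (\<forall>j\<in>{..i}. \<bar>S j\<bar> \<le> c) \<longleftrightarrow> i < \<tau>"
proof
  let ?\<tau> = "LEAST k. \<bar>S k\<bar> > c"
  show "?\<tau> \<le> N" using Least_le[of "\<lambda>k. \<bar>S k\<bar> > c" k] assms by simp
  show *: "\<bar>S ?\<tau>\<bar> > c" by (rule LeastI[of _ k]) (fact assms)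
  show "(\<forall>j\<in>{..i}. \<bar>S j\<bar> \<le> c) \<longleftrightarrow> i < ?\<tau>" for i
    using * not_less_Least[of _ "\<lambda>k. \<bar>S k\<bar> > c"] by (metis atMost_iff le_less_trans leI linorder_not_le)
qed

text \<open>
  With \<sigma> and \<tau> the first times at which the sums exceed l and 3 l, the modified sum equals S \<tau> - S \<sigma>.
  The jump bound keeps |S \<sigma>| at most 2 l, which leaves a gap of at least l.
\<close>

lemma stopped_sum_large:
  fixes a \<xi> :: "nat \<Rightarrow> real" and l c v :: real
  defines "S \<equiv> \<lambda>k. \<Sum>i<k. a i * \<xi> i"
  assumes l: "0 < l" and big: "k \<le> N" "\<bar>S k\<bar> > 3 * l"
    and jump: "\<And>i. i < N \<Longrightarrow> \<bar>a i * \<xi> i\<bar> \<le> l"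
    and var: "(\<Sum>i<N. (a i)\<^sup>2 * v) \<le> c" and v: "0 \<le> v"
  shows "l \<le> \<bar>\<Sum>i<N. (if (\<exists>j\<in>{..i}. \<bar>S j\<bar> > l) \<and> (\<forall>j\<in>{..i}. \<bar>S j\<bar> \<le> 3 * l)
                      \<and> (\<Sum>j\<le>i. (a j)\<^sup>2 * v) \<le> c then a i else 0) * \<xi> i\<bar>"
proof -
  have ex: "\<bar>S k\<bar> > l" using big l by linarith
  obtain \<sigma> where s1: "\<bar>S \<sigma>\<bar> > l" and before: "\<And>i. (\<forall>j\<in>{..i}. \<bar>S j\<bar> \<le> l) \<longleftrightarrow> i < \<sigma>"
    using first_passage[where S = S, OF big(1) ex] by metis
  obtain \<tau> where tN: "\<tau> \<le> N" and t1: "\<bar>S \<tau>\<bar> > 3 * l"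
    and c2: "\<And>i. (\<forall>j\<in>{..i}. \<bar>S j\<bar> \<le> 3 * l) \<longleftrightarrow> i < \<tau>"
    using first_passage[where S = S, OF big] by metis
  have c1: "(\<exists>j\<in>{..i}. \<bar>S j\<bar> > l) \<longleftrightarrow> \<sigma> \<le> i" for i
    using before[of i] by (metis linorder_not_le)
  have st: "\<sigma> \<le> \<tau>" using c1[of \<tau>] t1 l by force
  have c3: "(\<Sum>j\<le>i. (a j)\<^sup>2 * v) \<le> c" if "i < N" for i
  proof -
    have "(\<Sum>j\<le>i. (a j)\<^sup>2 * v) \<le> (\<Sum>i<N. (a i)\<^sup>2 * v)"
      using that v by (intro sum_mono2) auto
    then show ?thesis using var by linarith
  qed
  have "(\<Sum>i<N. (if (\<exists>j\<in>{..i}. \<bar>S j\<bar> > l) \<and> (\<forall>j\<in>{..i}. \<bar>S j\<bar> \<le> 3 * l)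
                      \<and> (\<Sum>j\<le>i. (a j)\<^sup>2 * v) \<le> c then a i else 0) * \<xi> i)
      = (\<Sum>i<N. if i \<in> {\<sigma>..<\<tau>} then a i * \<xi> i else 0)"
    by (rule sum.cong) (auto simp: c1 c2 c3)
  also have "\<dots> = (\<Sum>i\<in>{\<sigma>..<\<tau>}. a i * \<xi> i)"
    using tN by (subst sum.inter_restrict[symmetric]) (auto intro!: sum.cong)
  also have "\<dots> = S \<tau> - S \<sigma>"
    unfolding S_def using sum_diff_nat_ivl[of 0 \<sigma> \<tau> "\<lambda>i. a i * \<xi> i"] st
    by (simp add: atLeast0LessThan)
  finally have eq: "(\<Sum>i<N. (if (\<exists>j\<in>{..i}. \<bar>S j\<bar> > l) \<and> (\<forall>j\<in>{..i}. \<bar>S j\<bar> \<le> 3 * l)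
                      \<and> (\<Sum>j\<le>i. (a j)\<^sup>2 * v) \<le> c then a i else 0) * \<xi> i) = S \<tau> - S \<sigma>" .
  have "\<sigma> \<noteq> 0"
  proof
    assume "\<sigma> = 0"
    then show False using s1 l by (simp add: S_def)
  qed
  then obtain s where s: "\<sigma> = Suc s" by (cases \<sigma>) auto
  have "\<bar>S s\<bar> \<le> l" using before[of s] s by auto
  moreover have "\<bar>a s * \<xi> s\<bar> \<le> l" using jump[of s] s st tN by simp
  moreover have "S \<sigma> = S s + a s * \<xi> s" by (simp add: s S_def)
  ultimately have "\<bar>S \<sigma>\<bar> \<le> 2 * l" by linarith
  then show ?thesis using t1 eq by linarith
qed

text \<open>
  The innovation number i is independent of F i and revealed by F (Suc i).  The information is only ever used
  through real random variables, which is why monotonicity and independence are stated for these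
  and not for the sets of F i.
\<close>

locale predictable_innovations = prob_space M for M :: "'a measure" +
  fixes F :: "nat \<Rightarrow> 'a measure" and \<xi> :: "nat \<Rightarrow> 'a \<Rightarrow> real" and v :: real
  assumes F_le: "\<And>i X. X \<in> borel_measurable (F i) \<Longrightarrow> (X :: 'a \<Rightarrow> real) \<in> borel_measurable M"
    and F_mono: "\<And>i j X. i \<le> j \<Longrightarrow> X \<in> borel_measurable (F i) \<Longrightarrow> (X :: 'a \<Rightarrow> real) \<in> borel_measurable (F j)"
    and innov_adapted: "\<And>i. \<xi> i \<in> borel_measurable (F (Suc i))"
    and innov_indep: "\<And>i X. X \<in> borel_measurable (F i) \<Longrightarrow> indep_var borel X borel (\<xi> i)"
    and innov_integrable: "\<And>i. integrable M (\<xi> i)"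
    and innov_sq_integrable: "\<And>i. integrable M (\<lambda>\<omega>. (\<xi> i \<omega>)\<^sup>2)"
    and innov_mean: "\<And>i. expectation (\<xi> i) = 0"
    and innov_variance: "\<And>i. expectation (\<lambda>\<omega>. (\<xi> i \<omega>)\<^sup>2) = v"
    and variance_pos: "0 < v"
begin

lemma weighted_sum_adapted:
  assumes "\<And>i. b i \<in> borel_measurable (F i)" "k \<le> l"
  shows "(\<lambda>\<omega>. \<Sum>i<k. b i \<omega> * \<xi> i \<omega>) \<in> borel_measurable (F l)"
proof (intro borel_measurable_sum borel_measurable_times)
  fix i assume "i \<in> {..<k}"
  then show "b i \<in> borel_measurable (F l)" "\<xi> i \<in> borel_measurable (F l)"
    using F_mono[OF _ assms(1), of i l] F_mono[OF _ innov_adapted, of i l] assms by auto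
qed

text \<open>
  Orthogonality of martingale differences: in the square of the sum the cross terms factorise by independence,
  and one factor is the mean of an innovation.
\<close>

lemma second_moment_weighted_sum:
  assumes b: "\<And>i. b i \<in> borel_measurable (F i)" and C: "\<And>i \<omega>. \<bar>b i \<omega>\<bar> \<le> C"
  shows "integrable M (\<lambda>\<omega>. (\<Sum>i<k. b i \<omega> * \<xi> i \<omega>)\<^sup>2) \<and>
    expectation (\<lambda>\<omega>. (\<Sum>i<k. b i \<omega> * \<xi> i \<omega>)\<^sup>2) = (\<Sum>i<k. expectation (\<lambda>\<omega>. (b i \<omega>)\<^sup>2) * v)"
proof (induction k)
  case 0
  then show ?case by simp
next
  case (Suc k)
  define U where "U = (\<lambda>\<omega>. \<Sum>i<k. b i \<omega> * \<xi> i \<omega>)"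
  have U: "U \<in> borel_measurable (F k)"
    unfolding U_def by (rule weighted_sum_adapted[OF b]) simp
  have UM: "U \<in> borel_measurable M" and bM: "b k \<in> borel_measurable M"
    using F_le[OF U] F_le[OF b] by auto
  have intU2: "integrable M (\<lambda>\<omega>. (U \<omega>)\<^sup>2)" using Suc by (simp add: U_def)
  have intU: "integrable M U"
    by (rule square_integrable_imp_integrable[OF UM intU2])
  have Ub: "(\<lambda>\<omega>. U \<omega> * b k \<omega>) \<in> borel_measurable (F k)" using U b by simp
  have intUb: "integrable M (\<lambda>\<omega>. U \<omega> * b k \<omega>)"
  proof (rule Bochner_Integration.integrable_bound)
    show "integrable M (\<lambda>\<omega>. C * U \<omega>)" using intU by simp
    have "\<bar>U \<omega> * b k \<omega>\<bar> \<le> \<bar>C * U \<omega>\<bar>" for \<omega>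
      using mult_right_mono[OF C[of k \<omega>], of "\<bar>U \<omega>\<bar>"] order_trans[OF abs_ge_zero C[of k \<omega>]]
      by (simp add: abs_mult mult.commute)
    then show "AE \<omega> in M. norm (U \<omega> * b k \<omega>) \<le> norm (C * U \<omega>)" by simp
  qed (use UM bM in measurable)
  have b2: "(\<lambda>\<omega>. (b k \<omega>)\<^sup>2) \<in> borel_measurable (F k)" using b by simp
  have intb2: "integrable M (\<lambda>\<omega>. (b k \<omega>)\<^sup>2)"
  proof (rule integrable_const_bound)
    have "(b k \<omega>)\<^sup>2 \<le> C\<^sup>2" for \<omega> using C[of k \<omega>] by (metis abs_ge_zero order_trans abs_le_square_iff abs_of_nonneg)
    then show "AE \<omega> in M. norm ((b k \<omega>)\<^sup>2) \<le> C\<^sup>2" by simp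
  qed (use bM in measurable)
  note ind1 = innov_indep[OF Ub]
  have ind2: "indep_var borel (\<lambda>\<omega>. (b k \<omega>)\<^sup>2) borel (\<lambda>\<omega>. (\<xi> k \<omega>)\<^sup>2)"
    using indep_var_compose[OF innov_indep[OF b2], of "\<lambda>x. x" borel "\<lambda>x. x\<^sup>2" borel]
    by (simp add: comp_def)
  have cross: "integrable M (\<lambda>\<omega>. U \<omega> * b k \<omega> * \<xi> k \<omega>)"
       "expectation (\<lambda>\<omega>. U \<omega> * b k \<omega> * \<xi> k \<omega>) = 0"
    using indep_var_integrable[OF ind1 intUb innov_integrable]
          indep_var_lebesgue_integral[OF ind1 intUb innov_integrable] innov_mean by auto
  have sq: "integrable M (\<lambda>\<omega>. (b k \<omega>)\<^sup>2 * (\<xi> k \<omega>)\<^sup>2)"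
       "expectation (\<lambda>\<omega>. (b k \<omega>)\<^sup>2 * (\<xi> k \<omega>)\<^sup>2) = expectation (\<lambda>\<omega>. (b k \<omega>)\<^sup>2) * v"
    using indep_var_integrable[OF ind2 intb2 innov_sq_integrable]
          indep_var_lebesgue_integral[OF ind2 intb2 innov_sq_integrable] innov_variance by auto
  have expand: "(\<Sum>i<Suc k. b i \<omega> * \<xi> i \<omega>)\<^sup>2
      = (U \<omega>)\<^sup>2 + 2 * (U \<omega> * b k \<omega> * \<xi> k \<omega>) + (b k \<omega>)\<^sup>2 * (\<xi> k \<omega>)\<^sup>2" for \<omega>
    by (simp add: U_def power2_eq_square algebra_simps)
  have "expectation (\<lambda>\<omega>. (U \<omega>)\<^sup>2) = (\<Sum>i<k. expectation (\<lambda>\<omega>. (b i \<omega>)\<^sup>2) * v)"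
    using Suc unfolding U_def by simp
  then show ?case
    unfolding expand using intU2 cross sq by simp
qed

lemma second_moment_Markov:
  assumes "random_variable borel U" "integrable M (\<lambda>\<omega>. (U \<omega>)\<^sup>2)" "0 < l"
    and A: "A \<in> events" "\<And>\<omega>. \<omega> \<in> A \<Longrightarrow> l \<le> \<bar>U \<omega>\<bar>"
  shows "l\<^sup>2 * prob A \<le> expectation (\<lambda>\<omega>. (U \<omega>)\<^sup>2)"
proof -
  have "l\<^sup>2 * prob A = expectation (\<lambda>\<omega>. l\<^sup>2 * indicator A \<omega>)"
    using A by simp
  also have "\<dots> \<le> expectation (\<lambda>\<omega>. (U \<omega>)\<^sup>2)"
  proof (rule integral_mono)
    fix \<omega>
    have "l\<^sup>2 \<le> (U \<omega>)\<^sup>2" if "\<omega> \<in> A"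
      using A(2)[OF that] \<open>0 < l\<close> by (metis abs_le_square_iff abs_of_pos)
    then show "l\<^sup>2 * indicator A \<omega> \<le> (U \<omega>)\<^sup>2" by (auto simp: indicator_def)
  qed (use assms in \<open>auto intro!: integrable_mult_right simp: emeasure_eq_measure\<close>)
  finally show ?thesis .
qed

text \<open>
  Kolmogorov's maximal inequality.  Stopping the weights when the level \<epsilon> is first exceeded turns the maximum
  into the last sum, to which Chebyshev's inequality applies.
\<close>

lemma maximal_inequality:
  assumes b: "\<And>i. b i \<in> borel_measurable (F i)" and C: "\<And>i \<omega>. \<bar>b i \<omega>\<bar> \<le> C" and e: "0 < \<epsilon>"
  shows "prob {\<omega> \<in> space M. \<exists>k\<in>{..N}. \<bar>\<Sum>i<k. b i \<omega> * \<xi> i \<omega>\<bar> > \<epsilon>} \<le> C\<^sup>2 * v * N / \<epsilon>\<^sup>2"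
proof -
  define S where "S = (\<lambda>k \<omega>. \<Sum>i<k. b i \<omega> * \<xi> i \<omega>)"
  define a where "a = (\<lambda>i \<omega>. if \<forall>j\<in>{..i}. \<bar>S j \<omega>\<bar> \<le> \<epsilon> then b i \<omega> else 0)"
  have SF: "S k \<in> borel_measurable (F l)" if "k \<le> l" for k l
    unfolding S_def by (rule weighted_sum_adapted[OF b that])
  have aF: "a i \<in> borel_measurable (F i)" for i
  proof -
    have [measurable]: "\<And>j. j \<in> {..i} \<Longrightarrow> S j \<in> borel_measurable (F i)" using SF by simp
    note [measurable] = b
    show ?thesis unfolding a_def by measurable
  qed
  have C0: "0 \<le> C" using C[of 0 undefined] by linarith
  have aC: "\<bar>a i \<omega>\<bar> \<le> C" for i \<omega> using C[of i \<omega>] C0 by (auto simp: a_def)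
  have SM[measurable]: "\<And>k. S k \<in> borel_measurable M" using F_le[OF SF[OF order_refl]] .
  note U = second_moment_weighted_sum[OF aF aC, of N]
  have UM: "(\<lambda>\<omega>. \<Sum>i<N. a i \<omega> * \<xi> i \<omega>) \<in> borel_measurable M"
    using F_le[OF weighted_sum_adapted[OF aF order_refl]] .
  let ?A = "{\<omega> \<in> space M. \<exists>k\<in>{..N}. \<bar>S k \<omega>\<bar> > \<epsilon>}"
  have "\<epsilon>\<^sup>2 * prob ?A \<le> expectation (\<lambda>\<omega>. (\<Sum>i<N. a i \<omega> * \<xi> i \<omega>)\<^sup>2)"
  proof (rule second_moment_Markov[OF UM _ e])
    fix \<omega> assume "\<omega> \<in> ?A"
    then obtain k where k: "k \<le> N" "\<bar>S k \<omega>\<bar> > \<epsilon>" by auto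
    obtain \<tau> where tN: "\<tau> \<le> N" and t1: "\<bar>S \<tau> \<omega>\<bar> > \<epsilon>"
      and c2: "\<And>i. (\<forall>j\<in>{..i}. \<bar>S j \<omega>\<bar> \<le> \<epsilon>) \<longleftrightarrow> i < \<tau>"
      using first_passage[where S = "\<lambda>k. S k \<omega>", OF k] by metis
    have "(\<Sum>i<N. a i \<omega> * \<xi> i \<omega>) = (\<Sum>i<N. if i \<in> {..<\<tau>} then b i \<omega> * \<xi> i \<omega> else 0)"
      by (rule sum.cong) (auto simp: a_def c2)
    also have "\<dots> = S \<tau> \<omega>"
      using tN by (simp add: sum.If_cases Int_absorb1 subset_iff S_def lessThan_def)
    finally show "\<epsilon> \<le> \<bar>\<Sum>i<N. a i \<omega> * \<xi> i \<omega>\<bar>" using t1 by simp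
  qed (use U in auto)
  also have "\<dots> = (\<Sum>i<N. expectation (\<lambda>\<omega>. (a i \<omega>)\<^sup>2) * v)" using U by simp
  also have "\<dots> \<le> (\<Sum>i<N. C\<^sup>2 * v)"
  proof (intro sum_mono mult_right_mono less_imp_le[OF variance_pos])
    fix i
    have le: "(a i \<omega>)\<^sup>2 \<le> C\<^sup>2" for \<omega> using aC[of i \<omega>] C0 by (metis abs_le_square_iff abs_of_nonneg)
    have "a i \<in> borel_measurable M" using F_le[OF aF] .
    then have "integrable M (\<lambda>\<omega>. (a i \<omega>)\<^sup>2)"
      by (intro integrable_const_bound[where B = "C\<^sup>2"]) (auto simp: le)
    then have "expectation (\<lambda>\<omega>. (a i \<omega>)\<^sup>2) \<le> expectation (\<lambda>\<omega>. C\<^sup>2)"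
      by (rule integral_mono) (auto simp: le)
    then show "expectation (\<lambda>\<omega>. (a i \<omega>)\<^sup>2) \<le> C\<^sup>2" by (simp add: prob_space)
  qed
  finally show ?thesis using e by (simp add: S_def field_simps)
qed

end

context predictable_innovations
begin

text \<open>
  The tail at 3 l is compared with the tail at l.  Outside the exceptional events for V and D, reaching 3 l
  forces the sum between the passage times of l and 3 l to be at least l; its second moment is at
  most (\<delta> l)^2 times the probability of ever passing l, because the weights vanish before that passage.
  The weights are also cut off by their running sum of squares, which makes them bounded although A is not.
\<close>

lemma good_lambda:
  assumes A: "\<And>i. A i \<in> borel_measurable (F i)" and l: "0 < l" and \<delta>: "0 < \<delta>" "\<delta> \<le> 1"
    and [measurable]: "V \<in> borel_measurable M" "D \<in> borel_measurable M"
    and V: "\<And>\<omega>. \<omega> \<in> space M \<Longrightarrow> 0 \<le> V \<omega> \<and> (\<Sum>i<N. (A i \<omega>)\<^sup>2 * v) \<le> (V \<omega>)\<^sup>2"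
    and D: "\<And>\<omega> i. \<omega> \<in> space M \<Longrightarrow> i < N \<Longrightarrow> \<bar>A i \<omega> * \<xi> i \<omega>\<bar> \<le> D \<omega>"
  shows "prob {\<omega> \<in> space M. \<exists>k\<in>{..N}. \<bar>\<Sum>i<k. A i \<omega> * \<xi> i \<omega>\<bar> > 3 * l}
    \<le> \<delta>\<^sup>2 * prob {\<omega> \<in> space M. \<exists>k\<in>{..N}. \<bar>\<Sum>i<k. A i \<omega> * \<xi> i \<omega>\<bar> > l}
      + prob {\<omega> \<in> space M. V \<omega> > \<delta> * l} + prob {\<omega> \<in> space M. D \<omega> > \<delta> * l}"
proof -
  have v: "0 < v" by (rule variance_pos)
  define S where "S = (\<lambda>k \<omega>. \<Sum>i<k. A i \<omega> * \<xi> i \<omega>)"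
  define c where "c = (\<delta> * l)\<^sup>2"
  have c0: "0 \<le> c" by (simp add: c_def)
  define b where "b = (\<lambda>i \<omega>. if (\<exists>j\<in>{..i}. \<bar>S j \<omega>\<bar> > l) \<and> (\<forall>j\<in>{..i}. \<bar>S j \<omega>\<bar> \<le> 3 * l)
                      \<and> (\<Sum>j\<le>i. (A j \<omega>)\<^sup>2 * v) \<le> c then A i \<omega> else 0)"
  have SF: "S k \<in> borel_measurable (F l)" if "k \<le> l" for k l
    unfolding S_def by (rule weighted_sum_adapted[OF A that])
  have AF: "A j \<in> borel_measurable (F i)" if "j \<le> i" for i j
    by (rule F_mono[OF that A])
  have bF: "b i \<in> borel_measurable (F i)" for i
  proof -
    have [measurable]: "\<And>j. j \<in> {..i} \<Longrightarrow> S j \<in> borel_measurable (F i)" using SF by simp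
    have [measurable]: "(\<lambda>\<omega>. \<Sum>j\<le>i. (A j \<omega>)\<^sup>2 * v) \<in> borel_measurable (F i)"
      by (intro borel_measurable_sum borel_measurable_times borel_measurable_power AF) auto
    note [measurable] = A
    show ?thesis unfolding b_def by measurable
  qed
  have bC: "\<bar>b i \<omega>\<bar> \<le> sqrt (c / v)" for i \<omega>
  proof (cases "(\<Sum>j\<le>i. (A j \<omega>)\<^sup>2 * v) \<le> c")
    case True
    have "(A i \<omega>)\<^sup>2 * v \<le> (\<Sum>j\<le>i. (A j \<omega>)\<^sup>2 * v)"
      using member_le_sum[of i "{..i}" "\<lambda>j. (A j \<omega>)\<^sup>2 * v"] v by auto
    then have "(A i \<omega>)\<^sup>2 \<le> c / v" using v True by (simp add: field_simps)
    then have "\<bar>A i \<omega>\<bar> \<le> sqrt (c / v)" by (simp add: real_le_rsqrt)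
    moreover have "0 \<le> sqrt (c / v)" using v c0 by simp
    moreover have "b i \<omega> = A i \<omega> \<or> b i \<omega> = 0" by (simp add: b_def)
    ultimately show ?thesis by auto
  next
    case False
    then show ?thesis using c0 v by (simp add: b_def)
  qed
  have SM[measurable]: "\<And>k. S k \<in> borel_measurable M" using F_le[OF SF[OF order_refl]] .
  let ?U = "\<lambda>\<omega>. \<Sum>i<N. b i \<omega> * \<xi> i \<omega>"
  note U = second_moment_weighted_sum[OF bF bC, of N]
  have UM: "?U \<in> borel_measurable M"
    using F_le[OF weighted_sum_adapted[OF bF order_refl]] .
  let ?X = "{\<omega> \<in> space M. \<exists>k\<in>{..N}. \<bar>S k \<omega>\<bar> > 3 * l}"
  let ?Y = "{\<omega> \<in> space M. \<exists>k\<in>{..N}. \<bar>S k \<omega>\<bar> > l}"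
  let ?V = "{\<omega> \<in> space M. V \<omega> > \<delta> * l}"
  let ?D = "{\<omega> \<in> space M. D \<omega> > \<delta> * l}"
  let ?G = "?X - ?V - ?D"
  have "l\<^sup>2 * prob ?G \<le> expectation (\<lambda>\<omega>. (?U \<omega>)\<^sup>2)"
  proof (rule second_moment_Markov[OF UM _ l])
    fix \<omega> assume w: "\<omega> \<in> ?G"
    then obtain k where k: "k \<le> N" "\<bar>\<Sum>i<k. A i \<omega> * \<xi> i \<omega>\<bar> > 3 * l" by (auto simp: S_def)
    have \<omega>: "\<omega> \<in> space M" and vd: "V \<omega> \<le> \<delta> * l" "D \<omega> \<le> \<delta> * l" using w by auto
    have dl: "\<delta> * l \<le> l" using \<delta> l by simp
    show "l \<le> \<bar>?U \<omega>\<bar>"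
      unfolding b_def S_def
    proof (rule stopped_sum_large[OF l k])
      show "\<bar>A i \<omega> * \<xi> i \<omega>\<bar> \<le> l" if "i < N" for i using D[OF \<omega> that] vd dl by linarith
      have "(V \<omega>)\<^sup>2 \<le> c" unfolding c_def using V[OF \<omega>] vd by (intro power_mono) auto
      then show "(\<Sum>i<N. (A i \<omega>)\<^sup>2 * v) \<le> c" using V[OF \<omega>] by linarith
    qed (use v in simp)
  qed (use U in auto)
  also have "\<dots> = (\<Sum>i<N. expectation (\<lambda>\<omega>. (b i \<omega>)\<^sup>2) * v)" using U by simp
  also have "\<dots> = expectation (\<lambda>\<omega>. \<Sum>i<N. (b i \<omega>)\<^sup>2 * v)"
  proof -
    have "integrable M (\<lambda>\<omega>. (b i \<omega>)\<^sup>2 * v)" for i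
    proof (rule integrable_const_bound)
      have "(b i \<omega>)\<^sup>2 * v \<le> c" for \<omega>
      proof -
        have "(b i \<omega>)\<^sup>2 \<le> (sqrt (c / v))\<^sup>2"
          using power_mono[OF bC[of i \<omega>], of 2] by simp
        then show ?thesis using c0 v by (simp add: field_simps)
      qed
      then show "AE \<omega> in M. norm ((b i \<omega>)\<^sup>2 * v) \<le> c" using v by simp
      have "b i \<in> borel_measurable M" using F_le[OF bF] .
      then show "(\<lambda>\<omega>. (b i \<omega>)\<^sup>2 * v) \<in> borel_measurable M" by simp
    qed
    then show ?thesis by (subst Bochner_Integration.integral_sum) auto
  qed
  also have "\<dots> \<le> expectation (\<lambda>\<omega>. c * indicator ?Y \<omega>)"
  proof (rule integral_mono_AE')
    show "AE \<omega> in M. (\<Sum>i<N. (b i \<omega>)\<^sup>2 * v) \<le> c * indicator ?Y \<omega>"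
    proof (rule AE_I2)
      fix \<omega> assume \<omega>: "\<omega> \<in> space M"
      show "(\<Sum>i<N. (b i \<omega>)\<^sup>2 * v) \<le> c * indicator ?Y \<omega>"
      proof (cases "\<omega> \<in> ?Y")
        case True
        have "(\<Sum>i<N. (b i \<omega>)\<^sup>2 * v)
            \<le> (\<Sum>i<N. if (\<Sum>l\<le>i. (A l \<omega>)\<^sup>2 * v) \<le> c then (A i \<omega>)\<^sup>2 * v else 0)"
          by (intro sum_mono) (use v in \<open>auto simp: b_def\<close>)
        also have "\<dots> \<le> c"
          using sum_while_partial_sums_small_le[of "\<lambda>i. (A i \<omega>)\<^sup>2 * v" c N] v c0 by auto
        finally show ?thesis using True by simp
      next
        case False
        then have "\<And>i. i < N \<Longrightarrow> b i \<omega> = 0" using \<omega> by (auto simp: b_def)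
        then show ?thesis using c0 by simp
      qed
    qed
    show "AE \<omega> in M. 0 \<le> c * indicator ?Y \<omega>" using c0 by simp
  qed (auto simp: emeasure_eq_measure)
  also have "\<dots> = (\<delta> * l)\<^sup>2 * prob ?Y" by (simp add: c_def)
  finally have "l\<^sup>2 * prob ?G \<le> l\<^sup>2 * (\<delta>\<^sup>2 * prob ?Y)" by (simp add: power_mult_distrib mult_ac)
  then have G: "prob ?G \<le> \<delta>\<^sup>2 * prob ?Y" using l by simp
  have "prob ?X \<le> prob (?G \<union> ?V \<union> ?D)" by (rule finite_measure_mono) auto
  also have "\<dots> \<le> prob (?G \<union> ?V) + prob ?D" by (rule measure_Un_le) auto
  also have "\<dots> \<le> prob ?G + prob ?V + prob ?D"
    using measure_Un_le[of ?G M ?V] by auto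
  finally show ?thesis using G by (simp add: S_def)
qed

end

text \<open>
  The truncated value min (X \<omega>) L is the length of the set of u in (0, L) below X \<omega>; Fubini exchanges this
  length with the expectation.
\<close>

lemma (in prob_space) truncated_expectation_layer_cake:
  fixes X :: "'a \<Rightarrow> real"
  assumes [measurable]: "X \<in> borel_measurable M" and X: "\<And>\<omega>. \<omega> \<in> space M \<Longrightarrow> 0 \<le> X \<omega>" and L: "0 < L"
  shows "ennreal (expectation (\<lambda>\<omega>. min (X \<omega>) L))
    = (\<integral>\<^sup>+u. indicator {0<..<L} u * ennreal (prob {\<omega> \<in> space M. X \<omega> > u}) \<partial>lborel)"
proof -
  have "ennreal (expectation (\<lambda>\<omega>. min (X \<omega>) L)) = (\<integral>\<^sup>+\<omega>. ennreal (min (X \<omega>) L) \<partial>M)"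
    by (rule nn_integral_eq_integral[symmetric])
       (use X L in \<open>auto intro!: integrable_const_bound[where B = L]\<close>)
  also have "\<dots> = (\<integral>\<^sup>+\<omega>. \<integral>\<^sup>+u. indicator {0<..<L} u * indicator {x. x < X \<omega>} u \<partial>lborel \<partial>M)"
  proof (rule nn_integral_cong)
    fix \<omega> assume \<omega>: "\<omega> \<in> space M"
    have "(\<integral>\<^sup>+u. indicator {0<..<L} u * indicator {x. x < X \<omega>} u \<partial>lborel)
        = (\<integral>\<^sup>+u. indicator {0<..<min (X \<omega>) L} u \<partial>lborel)"
      by (rule nn_integral_cong) (auto simp: indicator_def)
    also have "\<dots> = ennreal (min (X \<omega>) L)"
      using X[OF \<omega>] L by simp
    finally show "ennreal (min (X \<omega>) L)
        = (\<integral>\<^sup>+u. indicator {0<..<L} u * indicator {x. x < X \<omega>} u \<partial>lborel)" ..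
  qed
  also have "\<dots> = (\<integral>\<^sup>+u. \<integral>\<^sup>+\<omega>. indicator {0<..<L} u * indicator {x. x < X \<omega>} u \<partial>M \<partial>lborel)"
  proof -
    interpret pair_sigma_finite M lborel ..
    have "(\<lambda>(\<omega>, u). indicator {0<..<L} u * indicator {x. x < X \<omega>} u :: ennreal)
        \<in> borel_measurable (M \<Otimes>\<^sub>M lborel)"
      unfolding indicator_def mem_Collect_eq by measurable
    from Fubini'[OF this] show ?thesis by simp
  qed
  also have "\<dots> = (\<integral>\<^sup>+u. indicator {0<..<L} u * ennreal (prob {\<omega> \<in> space M. X \<omega> > u}) \<partial>lborel)"
  proof (rule nn_integral_cong)
    fix u :: real
    have "(\<integral>\<^sup>+\<omega>. indicator {0<..<L} u * indicator {x. x < X \<omega>} u \<partial>M)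
        = indicator {0<..<L} u * (\<integral>\<^sup>+\<omega>. indicator {x. x < X \<omega>} u \<partial>M)"
      by (rule nn_integral_cmult) (unfold indicator_def mem_Collect_eq, measurable)
    also have "(\<integral>\<^sup>+\<omega>. indicator {x. x < X \<omega>} u \<partial>M) = (\<integral>\<^sup>+\<omega>. indicator {\<omega> \<in> space M. X \<omega> > u} \<omega> \<partial>M)"
      by (rule nn_integral_cong) (auto simp: indicator_def)
    also have "\<dots> = ennreal (prob {\<omega> \<in> space M. X \<omega> > u})"
      by (simp add: emeasure_eq_measure)
    finally show "(\<integral>\<^sup>+\<omega>. indicator {0<..<L} u * indicator {x. x < X \<omega>} u \<partial>M)
      = indicator {0<..<L} u * ennreal (prob {\<omega> \<in> space M. X \<omega> > u})" .
  qed
  finally show ?thesis .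
qed

lemma (in prob_space) measurable_tail:
  fixes X :: "'a \<Rightarrow> real"
  assumes [measurable]: "X \<in> borel_measurable M"
  shows "(\<lambda>u. ennreal (prob {\<omega> \<in> space M. X \<omega> > u})) \<in> borel_measurable lborel"
proof -
  have "mono (\<lambda>u. - prob {\<omega> \<in> space M. X \<omega> > u})"
    by (auto intro!: monoI finite_measure_mono)
  from borel_measurable_mono[OF this] have "(\<lambda>u. - (- prob {\<omega> \<in> space M. X \<omega> > u})) \<in> borel_measurable lborel"
    by (intro borel_measurable_uminus) simp
  then show ?thesis by simp
qed

text \<open>
  The form in which tail estimates are integrated: the truncation level L is the same on both sides, so a term
  with \<epsilon> < 1 can afterwards be absorbed even if no moment of X is known to be finite.
\<close>

lemma (in prob_space) truncated_expectation_from_tails: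
  fixes X A B C :: "'a \<Rightarrow> real"
  assumes meas[measurable]: "X \<in> borel_measurable M" "A \<in> borel_measurable M"
      "B \<in> borel_measurable M" "C \<in> borel_measurable M"
    and nonneg: "\<And>\<omega>. \<omega> \<in> space M \<Longrightarrow> 0 \<le> X \<omega>" "\<And>\<omega>. \<omega> \<in> space M \<Longrightarrow> 0 \<le> A \<omega>"
      "\<And>\<omega>. \<omega> \<in> space M \<Longrightarrow> 0 \<le> B \<omega>" "\<And>\<omega>. \<omega> \<in> space M \<Longrightarrow> 0 \<le> C \<omega>"
    and L: "0 < L" and e: "0 \<le> \<epsilon>"
    and tails: "\<And>u. 0 < u \<Longrightarrow> prob {\<omega> \<in> space M. X \<omega> > u} \<le> \<epsilon> * prob {\<omega> \<in> space M. A \<omega> > u}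
        + prob {\<omega> \<in> space M. B \<omega> > u} + prob {\<omega> \<in> space M. C \<omega> > u}"
  shows "expectation (\<lambda>\<omega>. min (X \<omega>) L) \<le> \<epsilon> * expectation (\<lambda>\<omega>. min (A \<omega>) L)
     + expectation (\<lambda>\<omega>. min (B \<omega>) L) + expectation (\<lambda>\<omega>. min (C \<omega>) L)"
proof -
  let ?p = "\<lambda>X u. ennreal (prob {\<omega> \<in> space M. X \<omega> > u})"
  let ?I = "\<lambda>u. indicator {0<..<L} u :: ennreal"
  note [measurable] = measurable_tail[OF meas(1)] measurable_tail[OF meas(2)]
    measurable_tail[OF meas(3)] measurable_tail[OF meas(4)]
  have pos: "0 \<le> expectation (\<lambda>\<omega>. min (Z \<omega>) L)" if "\<And>\<omega>. \<omega> \<in> space M \<Longrightarrow> 0 \<le> Z \<omega>" for Z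
    by (rule Bochner_Integration.integral_nonneg) (use that L in auto)
  have "ennreal (expectation (\<lambda>\<omega>. min (X \<omega>) L)) = (\<integral>\<^sup>+u. ?I u * ?p X u \<partial>lborel)"
    by (rule truncated_expectation_layer_cake) (use nonneg L in auto)
  also have "\<dots> \<le> (\<integral>\<^sup>+u. ennreal \<epsilon> * (?I u * ?p A u) + ?I u * ?p B u + ?I u * ?p C u \<partial>lborel)"
  proof (rule nn_integral_mono)
    fix u :: real
    show "?I u * ?p X u \<le> ennreal \<epsilon> * (?I u * ?p A u) + ?I u * ?p B u + ?I u * ?p C u"
    proof (cases "u \<in> {0<..<L}")
      case True
      then have "?p X u \<le> ennreal (\<epsilon> * prob {\<omega> \<in> space M. A \<omega> > u}
        + prob {\<omega> \<in> space M. B \<omega> > u} + prob {\<omega> \<in> space M. C \<omega> > u})"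
        using tails[of u] by (intro ennreal_leI) auto
      then show ?thesis using True e by (simp add: ennreal_mult)
    qed simp
  qed
  also have "\<dots> = ennreal \<epsilon> * (\<integral>\<^sup>+u. ?I u * ?p A u \<partial>lborel) + (\<integral>\<^sup>+u. ?I u * ?p B u \<partial>lborel)
      + (\<integral>\<^sup>+u. ?I u * ?p C u \<partial>lborel)"
    by (simp add: nn_integral_add nn_integral_cmult)
  also have "\<dots> = ennreal \<epsilon> * ennreal (expectation (\<lambda>\<omega>. min (A \<omega>) L))
     + ennreal (expectation (\<lambda>\<omega>. min (B \<omega>) L)) + ennreal (expectation (\<lambda>\<omega>. min (C \<omega>) L))"
    using nonneg L by (simp add: truncated_expectation_layer_cake)
  also have "\<dots> = ennreal (\<epsilon> * expectation (\<lambda>\<omega>. min (A \<omega>) L)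
     + expectation (\<lambda>\<omega>. min (B \<omega>) L) + expectation (\<lambda>\<omega>. min (C \<omega>) L))"
    using pos nonneg e by (simp add: ennreal_mult ennreal_plus)
  finally show ?thesis
    by (subst (asm) ennreal_le_iff) (use pos nonneg e in auto)
qed

lemma less_powr_iff_root_less:
  fixes x u p :: real
  assumes "0 \<le> x" "0 < u" "0 < p"
  shows "u < x powr p \<longleftrightarrow> u powr (1 / p) < x"
proof
  assume "u < x powr p"
  then have "u powr (1 / p) < (x powr p) powr (1 / p)"
    using assms by (intro powr_less_mono2) auto
  then show "u powr (1 / p) < x" using assms by (simp add: powr_powr)
next
  assume "u powr (1 / p) < x"
  then have "(u powr (1 / p)) powr p < x powr p"
    using assms by (intro powr_less_mono2) auto
  then show "u < x powr p" using assms by (simp add: powr_powr)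
qed

text \<open>
  The value obtained from \<delta>^2 = 3^(-p) / 2, the choice for which half of the left-hand side can be absorbed.
\<close>

definition burkholder_const :: "real \<Rightarrow> real" where
  "burkholder_const p = 2 * 3 powr p * sqrt (3 powr (- p) / 2) powr (- p)"

lemma burkholder_const_pos: "0 < burkholder_const p"
  by (simp add: burkholder_const_def)

context predictable_innovations
begin

text \<open>
  Tails at 3 l against tails at l become p-th moments of S / 3 against \<delta>^2 times those of S.  Since
  \<delta>^2 is half of 3^(-p), the moment of S on the right is absorbed; it is finite because of the truncation.
\<close>

lemma burkholder_truncated:
  assumes A: "\<And>i. A i \<in> borel_measurable (F i)" and p: "0 < p" and L: "0 < L"
    and [measurable]: "V \<in> borel_measurable M" "D \<in> borel_measurable M"
    and V: "\<And>\<omega>. \<omega> \<in> space M \<Longrightarrow> 0 \<le> V \<omega> \<and> (\<Sum>i<N. (A i \<omega>)\<^sup>2 * v) \<le> (V \<omega>)\<^sup>2"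
    and D: "\<And>\<omega> i. \<omega> \<in> space M \<Longrightarrow> i < N \<Longrightarrow> \<bar>A i \<omega> * \<xi> i \<omega>\<bar> \<le> D \<omega>"
    and D0: "\<And>\<omega>. \<omega> \<in> space M \<Longrightarrow> 0 \<le> D \<omega>"
  defines "S \<equiv> \<lambda>\<omega>. Max ((\<lambda>k. \<bar>\<Sum>i<k. A i \<omega> * \<xi> i \<omega>\<bar>) ` {..N})"
  shows "expectation (\<lambda>\<omega>. min (S \<omega> powr p) L)
    \<le> burkholder_const p *
      (expectation (\<lambda>\<omega>. min (V \<omega> powr p) L) + expectation (\<lambda>\<omega>. min (D \<omega> powr p) L))"
proof -
  define \<delta> where "\<delta> = sqrt (3 powr (- p) / 2)"
  have d2: "\<delta>\<^sup>2 = 3 powr (- p) / 2" by (simp add: \<delta>_def)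
  have d0: "0 < \<delta>" by (simp add: \<delta>_def)
  have "(3::real) powr (- p) \<le> 3 powr 0" using p by (intro powr_mono) auto
  then have d1: "\<delta> \<le> 1" unfolding \<delta>_def by simp
  have [measurable]: "(\<lambda>\<omega>. \<Sum>i<k. A i \<omega> * \<xi> i \<omega>) \<in> borel_measurable M" for k
    using F_le[OF weighted_sum_adapted[OF A order_refl]] .
  have SM[measurable]: "S \<in> borel_measurable M"
    unfolding S_def by (rule borel_measurable_Max) auto
  have S0: "0 \<le> S \<omega>" for \<omega>
    unfolding S_def by (rule Max_ge[THEN order_trans[rotated]]) (auto intro: image_eqI[of _ _ 0])
  have S_gt: "x < S \<omega> \<longleftrightarrow> (\<exists>k\<in>{..N}. \<bar>\<Sum>i<k. A i \<omega> * \<xi> i \<omega>\<bar> > x)" for x \<omega>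
    unfolding S_def by (subst Max_gr_iff) auto
  let ?E = "\<lambda>Z :: 'a \<Rightarrow> real. expectation (\<lambda>\<omega>. min (Z \<omega> powr p) L)"
  have int: "integrable M (\<lambda>\<omega>. min (Z \<omega> powr p) L)" if [measurable]: "Z \<in> borel_measurable M" for Z
    by (rule integrable_const_bound[where B = L]) (use L in auto)
  have main: "?E (\<lambda>\<omega>. S \<omega> / 3) \<le> \<delta>\<^sup>2 * ?E S + ?E (\<lambda>\<omega>. V \<omega> / \<delta>) + ?E (\<lambda>\<omega>. D \<omega> / \<delta>)"
  proof (rule truncated_expectation_from_tails)
    fix u :: real assume u: "0 < u"
    define l where "l = u powr (1 / p)"
    have l: "0 < l" using u by (simp add: l_def)
    have eq: "{\<omega> \<in> space M. u < (Z \<omega> / d) powr p} = {\<omega> \<in> space M. Z \<omega> > d * l}"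
      if "0 < d" "\<And>\<omega>. \<omega> \<in> space M \<Longrightarrow> 0 \<le> Z \<omega>" for Z d
    proof -
      have "u < (Z \<omega> / d) powr p \<longleftrightarrow> Z \<omega> > d * l" if "\<omega> \<in> space M" for \<omega>
        using less_powr_iff_root_less[of "Z \<omega> / d" u p] that \<open>0 < d\<close> \<open>\<And>\<omega>. \<omega> \<in> space M \<Longrightarrow> 0 \<le> Z \<omega>\<close> u p
        by (simp add: l_def field_simps)
      then show ?thesis by auto
    qed
    show "prob {\<omega> \<in> space M. u < (S \<omega> / 3) powr p} \<le> \<delta>\<^sup>2 * prob {\<omega> \<in> space M. u < S \<omega> powr p}
      + prob {\<omega> \<in> space M. u < (V \<omega> / \<delta>) powr p} + prob {\<omega> \<in> space M. u < (D \<omega> / \<delta>) powr p}"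
      using good_lambda[OF A l d0 d1 \<open>V \<in> borel_measurable M\<close> \<open>D \<in> borel_measurable M\<close> V D]
        eq[of 3 S] eq[of 1 S] eq[of \<delta> V] eq[of \<delta> D] S0 V D0 d0
      by (simp add: S_gt)
  qed (use L in auto)
  have 1: "3 powr (- p) * ?E S \<le> ?E (\<lambda>\<omega>. S \<omega> / 3)"
  proof -
    have "3 powr (- p) * min (S \<omega> powr p) L \<le> min ((S \<omega> / 3) powr p) L" for \<omega>
    proof -
      have "3 powr (- p) * S \<omega> powr p = (S \<omega> / 3) powr p"
        using S0[of \<omega>] by (simp add: powr_divide powr_minus field_simps)
      moreover have "3 powr (- p) * L \<le> 1 * L"
        using \<open>(3::real) powr (- p) \<le> 3 powr 0\<close> L by (intro mult_right_mono) auto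
      moreover have "3 powr (- p) * min (S \<omega> powr p) L \<le> 3 powr (- p) * S \<omega> powr p"
        "3 powr (- p) * min (S \<omega> powr p) L \<le> 3 powr (- p) * L"
        by (simp_all add: mult_left_mono)
      ultimately show ?thesis by linarith
    qed
    then have "expectation (\<lambda>\<omega>. 3 powr (- p) * min (S \<omega> powr p) L) \<le> ?E (\<lambda>\<omega>. S \<omega> / 3)"
      by (intro integral_mono integrable_mult_right int) auto
    then show ?thesis by simp
  qed
  have 2: "?E (\<lambda>\<omega>. Z \<omega> / \<delta>) \<le> \<delta> powr (- p) * ?E Z"
    if [measurable]: "Z \<in> borel_measurable M" and Z: "\<And>\<omega>. \<omega> \<in> space M \<Longrightarrow> 0 \<le> Z \<omega>" for Z
  proof -
    have d: "1 \<le> \<delta> powr (- p)"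
      using d0 d1 p powr_mono2[of p \<delta> 1] by (simp add: powr_minus field_simps)
    have "min ((Z \<omega> / \<delta>) powr p) L \<le> \<delta> powr (- p) * min (Z \<omega> powr p) L" if "\<omega> \<in> space M" for \<omega>
    proof -
      have "(Z \<omega> / \<delta>) powr p = \<delta> powr (- p) * Z \<omega> powr p"
        using Z[OF that] d0 by (simp add: powr_divide powr_minus field_simps)
      moreover have "1 * L \<le> \<delta> powr (- p) * L" using d L by (intro mult_right_mono) auto
      ultimately show ?thesis by (auto simp: min_def)
    qed
    then have "?E (\<lambda>\<omega>. Z \<omega> / \<delta>) \<le> expectation (\<lambda>\<omega>. \<delta> powr (- p) * min (Z \<omega> powr p) L)"
      by (intro integral_mono integrable_mult_right int) auto
    then show ?thesis by simp
  qed
  have "3 powr (- p) * ?E S \<le> 3 powr (- p) / 2 * ?E S + \<delta> powr (- p) * (?E V + ?E D)"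
    using 1 main 2[of V] 2[of D] V D0 by (simp add: d2 algebra_simps)
  then have "?E S \<le> 3 powr p * (2 * \<delta> powr (- p) * (?E V + ?E D))"
    by (simp add: powr_minus field_simps)
  then show ?thesis by (simp add: burkholder_const_def \<delta>_def mult_ac)
qed

end

section \<open>Brownian increments and the augmented filtration\<close>

lemma (in prob_space) space_augmented: "space (augmented_filtration M W t) = space M"
  by (simp add: augmented_filtration_def space_measure_of_conv)

lemma (in prob_space) augmented_generators_sub:
  fixes W :: "real \<Rightarrow> 'a \<Rightarrow> real"
  assumes "\<forall>t\<ge>0. W t \<in> borel_measurable M"
  shows "{W s -` B \<inter> space M | s B. 0 \<le> s \<and> s \<le> t \<and> B \<in> sets borel} \<union> null_sets M \<subseteq> events"
  using assms by (auto intro: measurable_sets)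

lemma (in prob_space) sets_augmented:
  fixes W :: "real \<Rightarrow> 'a \<Rightarrow> real"
  assumes "\<forall>t\<ge>0. W t \<in> borel_measurable M"
  shows "sets (augmented_filtration M W t) = sigma_sets (space M)
       ({W s -` B \<inter> space M | s B. 0 \<le> s \<and> s \<le> t \<and> B \<in> sets borel} \<union> null_sets M)"
  unfolding augmented_filtration_def
  by (rule sets_measure_of) (use augmented_generators_sub[OF assms, of t] sets.sets_into_space in blast)

lemma (in prob_space) augmented_filtration_le:
  fixes W :: "real \<Rightarrow> 'a \<Rightarrow> real"
  assumes "\<forall>t\<ge>0. W t \<in> borel_measurable M"
    and "X \<in> measurable (augmented_filtration M W t) N"
  shows "X \<in> measurable M N"
proof (rule measurableI)
  have sub: "sets (augmented_filtration M W t) \<subseteq> events"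
    unfolding sets_augmented[OF assms(1)]
    using sets.sigma_sets_subset[OF augmented_generators_sub[OF assms(1)]] .
  show "X x \<in> space N" if "x \<in> space M" for x
    using measurable_space[OF assms(2)] that by (simp add: space_augmented)
  show "X -` A \<inter> space M \<in> events" if "A \<in> sets N" for A
    using measurable_sets[OF assms(2) that] sub by (auto simp: space_augmented)
qed

lemma (in prob_space) augmented_filtration_mono:
  fixes W :: "real \<Rightarrow> 'a \<Rightarrow> real"
  assumes W: "\<forall>t\<ge>0. W t \<in> borel_measurable M" and "s \<le> t"
    and "X \<in> measurable (augmented_filtration M W s) N"
  shows "X \<in> measurable (augmented_filtration M W t) N"
proof (rule measurableI)
  have sub: "sets (augmented_filtration M W s) \<subseteq> sets (augmented_filtration M W t)"
    unfolding sets_augmented[OF W]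
    by (rule sigma_sets_mono') (use \<open>s \<le> t\<close> in fastforce)
  show "X x \<in> space N" if "x \<in> space (augmented_filtration M W t)" for x
    using measurable_space[OF assms(3)] that by (simp add: space_augmented)
  show "X -` A \<inter> space (augmented_filtration M W t) \<in> sets (augmented_filtration M W t)"
    if "A \<in> sets N" for A
    using measurable_sets[OF assms(3) that] sub by (auto simp: space_augmented)
qed

lemma (in prob_space) measurable_augmented:
  fixes W :: "real \<Rightarrow> 'a \<Rightarrow> real"
  assumes W: "\<forall>t\<ge>0. W t \<in> borel_measurable M" and "0 \<le> s" "s \<le> t"
  shows "W s \<in> borel_measurable (augmented_filtration M W t)"
proof (rule measurableI)
  show "W s -` A \<inter> space (augmented_filtration M W t) \<in> sets (augmented_filtration M W t)"
    if "A \<in> sets borel" for A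
    unfolding sets_augmented[OF W] space_augmented
    by (rule sigma_sets.Basic) (use assms that in blast)
qed simp

text \<open>
  After adding the times 0 and s, sort the observation times: each observed value is W 0 plus a sum of increments
  over the resulting partition of [0, s], and W 0 = 0 almost surely.  Independence of disjoint increments
  then separates these values from the increment over [s, t].
\<close>

lemma (in prob_space) brownian_path_indep_increment:
  fixes W :: "real \<Rightarrow> 'a \<Rightarrow> real"
  assumes W: "standard_brownian_motion M W" and S: "finite S" "S \<subseteq> {0..s}" and st: "0 \<le> s" "s < t"
    and B: "\<And>r. r \<in> S \<Longrightarrow> B r \<in> sets borel" and C: "C \<in> sets borel"
  shows "prob {\<omega> \<in> space M. (\<forall>r\<in>S. W r \<omega> \<in> B r) \<and> W t \<omega> - W s \<omega> \<in> C}
    = prob {\<omega> \<in> space M. \<forall>r\<in>S. W r \<omega> \<in> B r} * prob {\<omega> \<in> space M. W t \<omega> - W s \<omega> \<in> C}"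
proof -
  have Wm[measurable]: "W r \<in> borel_measurable M" if "0 \<le> r" for r
    using W that by (auto simp: standard_brownian_motion_def)
  have W0: "AE \<omega> in M. W 0 \<omega> = 0" using W by (auto simp: standard_brownian_motion_def)
  define xs where "xs = sorted_list_of_set (insert 0 (insert s S))"
  define n where "n = length xs"
  have fin: "finite (insert 0 (insert s S))" using S by simp
  have set_xs: "set xs = insert 0 (insert s S)" unfolding xs_def using fin by (rule set_sorted_list_of_set)
  have sorted: "sorted xs" by (simp add: xs_def)
  have n0: "0 < n" using set_xs unfolding n_def by (metis length_pos_if_in_set insertI1)
  define \<tau> where "\<tau> i = (if i < n then xs ! i else t)" for i
  have rng: "xs ! i \<in> {0..s}" if "i < n" for i
    using nth_mem[of i xs] that set_xs S st unfolding n_def by auto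
  have mono: "mono \<tau>"
  proof (rule monoI)
    fix i j :: nat assume "i \<le> j"
    then show "\<tau> i \<le> \<tau> j"
      using sorted_nth_mono[OF sorted, of i j] rng[of i] st by (auto simp: \<tau>_def n_def)
  qed
  have idx: "\<exists>i<n. \<tau> i = r" if "r \<in> insert 0 (insert s S)" for r
    using that set_xs unfolding n_def \<tau>_def by (metis in_set_conv_nth)
  have t0: "\<tau> 0 = 0"
  proof -
    obtain i where "i < n" "\<tau> i = 0" using idx[of 0] by auto
    then have "\<tau> 0 \<le> 0" using monoD[OF mono, of 0 i] by simp
    moreover have "0 \<le> \<tau> 0" using rng[OF n0] n0 by (simp add: \<tau>_def)
    ultimately show ?thesis by simp
  qed
  have tn: "\<tau> (n - 1) = s"
  proof -
    obtain i where i: "i < n" "\<tau> i = s" using idx[of s] by auto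
    then have "s \<le> \<tau> (n - 1)" using monoD[OF mono, of i "n - 1"] by simp
    moreover have "\<tau> (n - 1) \<le> s" using rng[of "n - 1"] n0 by (simp add: \<tau>_def)
    ultimately show ?thesis by simp
  qed
  have tn': "\<tau> (Suc (n - 1)) = t" using n0 by (simp add: \<tau>_def)
  have tpos: "0 \<le> \<tau> i" for i using monoD[OF mono, of 0 i] t0 by simp
  define X where "X i \<omega> = W (\<tau> (Suc i)) \<omega> - W (\<tau> i) \<omega>" for i \<omega>
  have ind: "indep_vars (\<lambda>_. borel) X {..<n}"
  proof -
    have "indep_vars (\<lambda>_. borel) (\<lambda>i \<omega>. W (\<tau> (Suc i)) \<omega> - W (\<tau> i) \<omega>) {..<n}"
      using W mono t0 unfolding standard_brownian_motion_def by auto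
    then show ?thesis by (simp add: X_def[abs_def])
  qed
  \<comment> \<open>increment number n - 1 is the one over [s, t]; the earlier ones determine the path at the times in S\<close>
  define K where "K = {..<n - 1}"
  have ind2: "indep_var (PiM K (\<lambda>_. borel)) (\<lambda>\<omega>. restrict (\<lambda>i. X i \<omega>) K)
      (PiM {n - 1} (\<lambda>_. borel)) (\<lambda>\<omega>. restrict (\<lambda>i. X i \<omega>) {n - 1})"
    using n0 by (intro indep_var_restrict[OF ind]) (auto simp: K_def)
  define pos where "pos r = (SOME i. i < n \<and> \<tau> i = r)" for r
  have pos: "pos r < n \<and> \<tau> (pos r) = r" if "r \<in> S" for r
    unfolding pos_def by (rule someI_ex) (use idx[of r] that in auto)
  define g :: "(nat \<Rightarrow> real) \<Rightarrow> real" where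
    "g x = of_bool (\<forall>r\<in>S. (\<Sum>i<pos r. x i) \<in> B r)" for x
  have g_meas: "g \<in> borel_measurable (PiM K (\<lambda>_. borel))"
  proof -
    have [measurable]: "(\<lambda>x :: nat \<Rightarrow> real. \<Sum>i<pos r. x i) \<in> borel_measurable (PiM K (\<lambda>_. borel))" if "r \<in> S" for r
    proof (rule borel_measurable_sum)
      fix i assume "i \<in> {..<pos r}"
      then have "i \<in> K" using pos[OF that] by (auto simp: K_def)
      then show "(\<lambda>x :: nat \<Rightarrow> real. x i) \<in> borel_measurable (PiM K (\<lambda>_. borel))"
        by (rule measurable_component_singleton)
    qed
    have "Measurable.pred (PiM K (\<lambda>_. borel)) (\<lambda>x. (\<Sum>i<pos r. x i) \<in> B r)" if "r \<in> S" for r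
      using B[OF that] that by measurable
    then have [measurable]: "Measurable.pred (PiM K (\<lambda>_. borel)) (\<lambda>x. \<forall>r\<in>S. (\<Sum>i<pos r. x i) \<in> B r)"
      by (intro pred_intros_finite S)
    show ?thesis unfolding g_def of_bool_def by measurable
  qed
  define h :: "(nat \<Rightarrow> real) \<Rightarrow> real" where "h x = x (n - 1)" for x
  have h_meas: "h \<in> borel_measurable (PiM {n - 1} (\<lambda>_. borel))"
    unfolding h_def by (rule measurable_component_singleton) simp
  have ind3: "indep_var borel (\<lambda>\<omega>. g (restrict (\<lambda>i. X i \<omega>) K)) borel (\<lambda>\<omega>. h (restrict (\<lambda>i. X i \<omega>) {n - 1}))"
    using indep_var_compose[OF ind2 g_meas h_meas] by (simp add: comp_def)
  have h_eq: "h (restrict (\<lambda>i. X i \<omega>) {n - 1}) = W t \<omega> - W s \<omega>" for \<omega>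
    using tn tn' by (simp add: h_def X_def)
  have g_eq: "g (restrict (\<lambda>i. X i \<omega>) K) = of_bool (\<forall>r\<in>S. W r \<omega> - W 0 \<omega> \<in> B r)" for \<omega>
  proof -
    have "(\<Sum>i<pos r. restrict (\<lambda>i. X i \<omega>) K i) = W r \<omega> - W 0 \<omega>" if "r \<in> S" for r
    proof -
      have "(\<Sum>i<pos r. restrict (\<lambda>i. X i \<omega>) K i) = (\<Sum>i<pos r. X i \<omega>)"
        using pos[OF that] by (intro sum.cong) (auto simp: K_def)
      also have "\<dots> = W (\<tau> (pos r)) \<omega> - W (\<tau> 0) \<omega>"
        unfolding X_def by (rule sum_lessThan_telescope)
      finally show ?thesis using pos[OF that] t0 by simp
    qed
    then show ?thesis by (simp add: g_def)
  qed
  have P: "Measurable.pred M (\<lambda>\<omega>. \<forall>r\<in>S. W r \<omega> \<in> B r)"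
  proof (intro pred_intros_finite S)
    fix r assume r: "r \<in> S"
    then have "W r \<in> borel_measurable M" using S by (intro Wm) auto
    then show "Measurable.pred M (\<lambda>\<omega>. W r \<omega> \<in> B r)" using B[OF r] by measurable
  qed
  have P': "Measurable.pred M (\<lambda>\<omega>. \<forall>r\<in>S. W r \<omega> - W 0 \<omega> \<in> B r)"
  proof (intro pred_intros_finite S)
    fix r assume r: "r \<in> S"
    then have "W r \<in> borel_measurable M" using S by (intro Wm) auto
    then show "Measurable.pred M (\<lambda>\<omega>. W r \<omega> - W 0 \<omega> \<in> B r)" using B[OF r] Wm[of 0] by measurable
  qed
  have Q: "Measurable.pred M (\<lambda>\<omega>. W t \<omega> - W s \<omega> \<in> C)"
  proof -
    have [measurable]: "W t \<in> borel_measurable M" "W s \<in> borel_measurable M"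
      using st by (auto intro!: Wm)
    show ?thesis using C by measurable
  qed
  have key: "prob {\<omega> \<in> space M. (\<forall>r\<in>S. W r \<omega> - W 0 \<omega> \<in> B r) \<and> W t \<omega> - W s \<omega> \<in> C}
    = prob {\<omega> \<in> space M. \<forall>r\<in>S. W r \<omega> - W 0 \<omega> \<in> B r} * prob {\<omega> \<in> space M. W t \<omega> - W s \<omega> \<in> C}"
    using indep_varD[OF ind3, of "{1}" C] C unfolding g_eq h_eq
    by (simp add: vimage_def Int_def conj_ac cong: conj_cong)
  have e1: "prob {\<omega> \<in> space M. \<forall>r\<in>S. W r \<omega> \<in> B r} = prob {\<omega> \<in> space M. \<forall>r\<in>S. W r \<omega> - W 0 \<omega> \<in> B r}"
    by (rule finite_measure_eq_AE) (use W0 P P' in \<open>auto elim!: eventually_mono\<close>)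
  have e2: "prob {\<omega> \<in> space M. (\<forall>r\<in>S. W r \<omega> \<in> B r) \<and> W t \<omega> - W s \<omega> \<in> C}
     = prob {\<omega> \<in> space M. (\<forall>r\<in>S. W r \<omega> - W 0 \<omega> \<in> B r) \<and> W t \<omega> - W s \<omega> \<in> C}"
    by (rule finite_measure_eq_AE) (use W0 P P' Q in \<open>auto elim!: eventually_mono\<close>)
  show ?thesis using key by (simp add: e1 e2)
qed

text \<open>
  The events that agree almost surely with a finite-dimensional event of the path up to time s form a \<pi>-system
  which generates a \<sigma>-algebra containing the augmented one: null sets are almost surely equal to the empty event.
\<close>

lemma (in prob_space) brownian_increment_indep_augmented:
  fixes W :: "real \<Rightarrow> 'a \<Rightarrow> real" and X :: "'a \<Rightarrow> real"
  assumes W: "standard_brownian_motion M W" and st: "0 \<le> s" "s < t"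
    and X: "X \<in> borel_measurable (augmented_filtration M W s)"
  shows "indep_var borel X borel (\<lambda>\<omega>. W t \<omega> - W s \<omega>)"
proof -
  have Wm: "\<forall>r\<ge>0. W r \<in> borel_measurable M"
    using W by (auto simp: standard_brownian_motion_def)
  have "0 \<le> t" using st by simp
  then have [measurable]: "W t \<in> borel_measurable M" "W s \<in> borel_measurable M"
    using Wm st by auto
  let ?Z = "\<lambda>\<omega>. W t \<omega> - W s \<omega>"
  have Z: "?Z \<in> borel_measurable M" by measurable
  have XM: "X \<in> borel_measurable M" by (rule augmented_filtration_le[OF Wm X])
  \<comment> \<open>events of the path up to time s, up to null sets\<close>
  define P where "P = {A \<in> events. \<exists>S B. finite S \<and> S \<subseteq> {0..s} \<and> (\<forall>r\<in>S. B r \<in> sets borel)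
       \<and> (AE \<omega> in M. \<omega> \<in> A \<longleftrightarrow> (\<forall>r\<in>S. W r \<omega> \<in> B r))}"
  define Q where "Q = {?Z -` C \<inter> space M | C. C \<in> sets borel}"
  have PI: "Int_stable P"
  proof (rule Int_stableI)
    fix a b assume "a \<in> P" "b \<in> P"
    then obtain S B S' B' where
      1: "a \<in> events" "finite S" "S \<subseteq> {0..s}" "\<forall>r\<in>S. B r \<in> sets borel"
         "AE \<omega> in M. \<omega> \<in> a \<longleftrightarrow> (\<forall>r\<in>S. W r \<omega> \<in> B r)" and
      2: "b \<in> events" "finite S'" "S' \<subseteq> {0..s}" "\<forall>r\<in>S'. B' r \<in> sets borel"
         "AE \<omega> in M. \<omega> \<in> b \<longleftrightarrow> (\<forall>r\<in>S'. W r \<omega> \<in> B' r)"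
      unfolding P_def by blast
    define B'' where "B'' r = (if r \<in> S then B r else UNIV) \<inter> (if r \<in> S' then B' r else UNIV)" for r
    have "AE \<omega> in M. \<omega> \<in> a \<inter> b \<longleftrightarrow> (\<forall>r\<in>S \<union> S'. W r \<omega> \<in> B'' r)"
      using 1(5) 2(5) by eventually_elim (auto simp: B''_def)
    then show "a \<inter> b \<in> P"
      unfolding P_def mem_Collect_eq using 1 2
      by (intro conjI exI[of _ "S \<union> S'"] exI[of _ B'']) (auto simp: B''_def)
  qed
  have QI: "Int_stable Q"
  proof (rule Int_stableI)
    fix a b assume "a \<in> Q" "b \<in> Q"
    then obtain C C' where "C \<in> sets borel" "C' \<in> sets borel"
      "a = ?Z -` C \<inter> space M" "b = ?Z -` C' \<inter> space M" unfolding Q_def by auto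
    then show "a \<inter> b \<in> Q" unfolding Q_def by (auto intro!: exI[of _ "C \<inter> C'"])
  qed
  have "indep_set P Q"
    unfolding indep_sets2_eq
  proof (intro conjI ballI)
    show "P \<subseteq> events" by (auto simp: P_def)
    show "Q \<subseteq> events" using Z by (auto simp: Q_def intro: measurable_sets)
    fix a b assume "a \<in> P" "b \<in> Q"
    then obtain S B C where
      1: "a \<in> events" "finite S" "S \<subseteq> {0..s}" "\<forall>r\<in>S. B r \<in> sets borel"
         "AE \<omega> in M. \<omega> \<in> a \<longleftrightarrow> (\<forall>r\<in>S. W r \<omega> \<in> B r)" and
      2: "C \<in> sets borel" "b = ?Z -` C \<inter> space M"
      unfolding P_def Q_def by blast
    have beq: "b = {\<omega> \<in> space M. ?Z \<omega> \<in> C}" using 2 by auto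
    have be: "b \<in> events" using Z 2 by (auto intro: measurable_sets)
    have P: "{\<omega> \<in> space M. \<forall>r\<in>S. W r \<omega> \<in> B r} \<in> events"
    proof (intro predE pred_intros_finite 1)
      fix r assume r: "r \<in> S"
      then have "W r \<in> borel_measurable M" using 1 Wm by auto
      then show "Measurable.pred M (\<lambda>\<omega>. W r \<omega> \<in> B r)" using 1(4) r by measurable
    qed
    have "prob a = prob {\<omega> \<in> space M. \<forall>r\<in>S. W r \<omega> \<in> B r}"
      by (rule finite_measure_eq_AE) (use 1 P in \<open>auto elim!: eventually_mono\<close>)
    moreover have "prob (a \<inter> b) = prob {\<omega> \<in> space M. (\<forall>r\<in>S. W r \<omega> \<in> B r) \<and> ?Z \<omega> \<in> C}"
    proof (rule finite_measure_eq_AE)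
      have "{\<omega> \<in> space M. (\<forall>r\<in>S. W r \<omega> \<in> B r) \<and> ?Z \<omega> \<in> C} = {\<omega> \<in> space M. \<forall>r\<in>S. W r \<omega> \<in> B r} \<inter> b"
        using beq by auto
      then show "{\<omega> \<in> space M. (\<forall>r\<in>S. W r \<omega> \<in> B r) \<and> ?Z \<omega> \<in> C} \<in> events" using P be by auto
      show "a \<inter> b \<in> events" using 1 be by auto
      show "AE \<omega> in M. \<omega> \<in> a \<inter> b \<longleftrightarrow> \<omega> \<in> {\<omega> \<in> space M. (\<forall>r\<in>S. W r \<omega> \<in> B r) \<and> ?Z \<omega> \<in> C}"
        using 1(5) AE_space by eventually_elim (auto simp: beq)
    qed
    ultimately show "prob (a \<inter> b) = prob a * prob b"
      using brownian_path_indep_increment[OF W 1(2,3) st, of B C] 1(4) 2(1) beq by simp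
  qed
  then have ind: "indep_set (sigma_sets (space M) P) (sigma_sets (space M) Q)"
    by (rule indep_set_sigma_sets[OF _ PI QI])
  have "sets (augmented_filtration M W s) \<subseteq> sigma_sets (space M) P"
    unfolding sets_augmented[OF Wm]
  proof (rule sigma_sets_mono, rule subsetI)
    fix A assume "A \<in> {W r -` B \<inter> space M | r B. 0 \<le> r \<and> r \<le> s \<and> B \<in> sets borel} \<union> null_sets M"
    then have "A \<in> P"
    proof
      assume "A \<in> {W r -` B \<inter> space M | r B. 0 \<le> r \<and> r \<le> s \<and> B \<in> sets borel}"
      then obtain r B where A: "A = W r -` B \<inter> space M" "0 \<le> r" "r \<le> s" "B \<in> sets borel" by auto
      have "A \<in> events" using A Wm by (auto intro: measurable_sets)
      moreover have "AE \<omega> in M. \<omega> \<in> A \<longleftrightarrow> (\<forall>q\<in>{r}. W q \<omega> \<in> B)" using A by auto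
      ultimately show "A \<in> P" unfolding P_def mem_Collect_eq using A
        by (intro conjI exI[of _ "{r}"] exI[of _ "\<lambda>_. B"]) auto
    next
      assume A: "A \<in> null_sets M"
      have "AE \<omega> in M. \<omega> \<in> A \<longleftrightarrow> (\<forall>q\<in>{0}. W q \<omega> \<in> {})" using AE_not_in[OF A] by auto
      then show "A \<in> P" unfolding P_def mem_Collect_eq using A st
        by (intro conjI exI[of _ "{0}"] exI[of _ "\<lambda>_. {}"]) auto
    qed
    then show "A \<in> sigma_sets (space M) P" by (rule sigma_sets.Basic)
  qed
  then have "{X -` A \<inter> space M | A. A \<in> sets borel} \<subseteq> sigma_sets (space M) P"
    using measurable_sets[OF X] by (auto simp: space_augmented)
  then have sub: "sigma_sets (space M) {X -` A \<inter> space M | A. A \<in> sets borel} \<subseteq> sigma_sets (space M) P"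
    by (rule sigma_sets_mono)
  show ?thesis
    unfolding indep_var_eq
    using XM Z ind sub unfolding indep_sets2_eq Q_def by blast
qed

lemma (in prob_space) brownian_increment_moments:
  fixes W :: "real \<Rightarrow> 'a \<Rightarrow> real"
  assumes W: "standard_brownian_motion M W" and st: "0 \<le> s" "s < t"
  shows "integrable M (\<lambda>\<omega>. (W t \<omega> - W s \<omega>) ^ k)"
    and "expectation (\<lambda>\<omega>. W t \<omega> - W s \<omega>) = 0"
    and "expectation (\<lambda>\<omega>. (W t \<omega> - W s \<omega>) ^ 2) = t - s"
    and "expectation (\<lambda>\<omega>. (W t \<omega> - W s \<omega>) ^ 4) = 3 * (t - s)\<^sup>2"
proof -
  have D: "distributed M lborel (\<lambda>\<omega>. W t \<omega> - W s \<omega>)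
          (\<lambda>x. ennreal (normal_density 0 (sqrt (t - s)) x))"
    using W st by (auto simp: standard_brownian_motion_def)
  have sg: "0 < sqrt (t - s)" using st by simp
  have E: "expectation (\<lambda>\<omega>. (W t \<omega> - W s \<omega>) ^ k) = (\<integral>x. normal_density 0 (sqrt (t - s)) x * x ^ k \<partial>lborel)" for k
    using distributed_integral[OF D, of "\<lambda>x. x ^ k"] by simp
  show "integrable M (\<lambda>\<omega>. (W t \<omega> - W s \<omega>) ^ k)"
    using distributed_integrable[OF D, of "\<lambda>x. x ^ k"] integrable_normal_moment[OF sg, of 0 k] by simp
  show "expectation (\<lambda>\<omega>. W t \<omega> - W s \<omega>) = 0"
    using E[of 1] integral_normal_moment_odd[OF sg, of 0 0] by simp
  show "expectation (\<lambda>\<omega>. (W t \<omega> - W s \<omega>) ^ 2) = t - s"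
    using E[of 2] integral_normal_moment_even[OF sg, of 0 1] st by simp
  show "expectation (\<lambda>\<omega>. (W t \<omega> - W s \<omega>) ^ 4) = 3 * (t - s)\<^sup>2"
    using E[of 4] integral_normal_moment_even[OF sg, of 0 2] st
    by (simp add: fact_numeral field_simps)
qed

lemma (in prob_space) brownian_innovations_function:
  fixes W :: "real \<Rightarrow> 'a \<Rightarrow> real" and \<phi> :: "real \<Rightarrow> real"
  assumes W: "standard_brownian_motion M W" and d: "0 < \<Delta>"
    and \<phi>[measurable]: "\<phi> \<in> borel_measurable borel" and v: "0 < v"
    and moments: "\<And>i. let X = (\<lambda>\<omega>. \<phi> (W (real (Suc i) * \<Delta>) \<omega> - W (real i * \<Delta>) \<omega>)) in
      integrable M X \<and> integrable M (\<lambda>\<omega>. (X \<omega>)\<^sup>2) \<and> expectation X = 0 \<and> expectation (\<lambda>\<omega>. (X \<omega>)\<^sup>2) = v"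
  shows "predictable_innovations M (\<lambda>i. augmented_filtration M W (real i * \<Delta>))
    (\<lambda>i \<omega>. \<phi> (W (real (Suc i) * \<Delta>) \<omega> - W (real i * \<Delta>) \<omega>)) v"
proof unfold_locales
  have Wm: "\<forall>r\<ge>0. W r \<in> borel_measurable M"
    using W by (auto simp: standard_brownian_motion_def)
  have st: "0 \<le> real i * \<Delta>" "real i * \<Delta> < real (Suc i) * \<Delta>" for i
    using d by (auto simp: field_simps)
  let ?\<xi> = "\<lambda>i \<omega>. W (real (Suc i) * \<Delta>) \<omega> - W (real i * \<Delta>) \<omega>"
  fix i j
  have "?\<xi> i \<in> borel_measurable (augmented_filtration M W (real (Suc i) * \<Delta>))"
    using measurable_augmented[OF Wm st(1)[of "Suc i"] order_refl]
      measurable_augmented[OF Wm st(1)[of i] less_imp_le[OF st(2)]]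
    by (rule borel_measurable_diff)
  then show "(\<lambda>\<omega>. \<phi> (?\<xi> i \<omega>)) \<in> borel_measurable (augmented_filtration M W (real (Suc i) * \<Delta>))"
    by measurable
  fix X :: "'a \<Rightarrow> real" assume X: "X \<in> borel_measurable (augmented_filtration M W (real i * \<Delta>))"
  show "X \<in> borel_measurable M" by (rule augmented_filtration_le[OF Wm X])
  show "indep_var borel X borel (\<lambda>\<omega>. \<phi> (?\<xi> i \<omega>))"
    using indep_var_compose[OF brownian_increment_indep_augmented[OF W st X], of "\<lambda>x. x" borel \<phi> borel]
    by (simp add: comp_def)
  show "X \<in> borel_measurable (augmented_filtration M W (real j * \<Delta>))" if "i \<le> j"
    by (rule augmented_filtration_mono[OF Wm _ X]) (use that d in simp)
qed (use moments v in \<open>simp_all only: Let_def\<close>)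

text \<open>
  Both families are needed: the increments for the martingale part of f(Y), and their compensated squares for the
  quadratic variation.
\<close>

lemma (in prob_space) brownian_innovations:
  fixes W :: "real \<Rightarrow> 'a \<Rightarrow> real"
  assumes W: "standard_brownian_motion M W" and d: "0 < \<Delta>"
  shows "predictable_innovations M (\<lambda>i. augmented_filtration M W (real i * \<Delta>))
    (\<lambda>i \<omega>. W (real (Suc i) * \<Delta>) \<omega> - W (real i * \<Delta>) \<omega>) \<Delta>"
  and "predictable_innovations M (\<lambda>i. augmented_filtration M W (real i * \<Delta>))
    (\<lambda>i \<omega>. (W (real (Suc i) * \<Delta>) \<omega> - W (real i * \<Delta>) \<omega>)\<^sup>2 - \<Delta>) (2 * \<Delta>\<^sup>2)"
proof -
  have st: "0 \<le> real i * \<Delta>" "real i * \<Delta> < real (Suc i) * \<Delta>" for i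
    using d by (auto simp: field_simps)
  have diff: "real (Suc i) * \<Delta> - real i * \<Delta> = \<Delta>" for i by (simp add: field_simps)
  note moments = brownian_increment_moments[OF W st, unfolded diff]
  show "predictable_innovations M (\<lambda>i. augmented_filtration M W (real i * \<Delta>))
    (\<lambda>i \<omega>. W (real (Suc i) * \<Delta>) \<omega> - W (real i * \<Delta>) \<omega>) \<Delta>"
    by (rule brownian_innovations_function[OF W d, of "\<lambda>x. x"])
       (use d moments(1)[of _ 1] moments(1)[of _ 2] moments(2,3) in \<open>simp_all del: of_nat_Suc\<close>)
  have c: "(x\<^sup>2 - \<Delta>)\<^sup>2 = x ^ 4 - 2 * \<Delta> * x\<^sup>2 + \<Delta>\<^sup>2" for x
    by (simp add: power2_eq_square power4_eq_xxxx algebra_simps)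
  show "predictable_innovations M (\<lambda>i. augmented_filtration M W (real i * \<Delta>))
    (\<lambda>i \<omega>. (W (real (Suc i) * \<Delta>) \<omega> - W (real i * \<Delta>) \<omega>)\<^sup>2 - \<Delta>) (2 * \<Delta>\<^sup>2)"
    by (rule brownian_innovations_function[OF W d, of "\<lambda>x. x\<^sup>2 - \<Delta>"])
       (use d moments(1)[of _ 2] moments(1)[of _ 4] moments(3,4) in
         \<open>simp_all add: c prob_space power2_eq_square[of \<Delta>] del: of_nat_Suc\<close>)
qed

section \<open>Solvability of the implicit equation\<close>

text \<open>
  Holds for non-integrable integrands as well, since their integral is 0 by convention; hence no
  measurability has to be verified for the nested integrals in Feller's function.
\<close>

lemma interval_lebesgue_integral_bound:
  fixes g :: "real \<Rightarrow> real"
  assumes C: "\<And>u. u \<in> {min a b..max a b} \<Longrightarrow> \<bar>g u\<bar> \<le> C"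
  shows "\<bar>LBINT u=ereal a..ereal b. g u\<bar> \<le> C * \<bar>b - a\<bar>"
proof -
  have C0: "0 \<le> C" using C[of a] by (metis abs_ge_zero atLeastAtMost_iff max.cobounded1 min.cobounded1 order_trans)
  have *: "\<bar>LINT u:{p<..<q}|lborel. g u\<bar> \<le> C * (q - p)" if "p \<le> q" "{p<..<q} \<subseteq> {min a b..max a b}" for p q
  proof -
    have "\<bar>LINT u:{p<..<q}|lborel. g u\<bar> \<le> (LINT u|lborel. \<bar>indicator {p<..<q} u *\<^sub>R g u\<bar>)"
      unfolding set_lebesgue_integral_def by (rule integral_abs_bound)
    also have "\<dots> \<le> (LINT u|lborel. indicator {p<..<q} u * C)"
    proof (rule integral_mono_AE')
      show "AE u in lborel. \<bar>indicator {p<..<q} u *\<^sub>R g u\<bar> \<le> indicator {p<..<q} u * C"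
        using C that(2) by (intro AE_I2) (auto simp: indicator_def)
      show "AE u in lborel. 0 \<le> indicator {p<..<q} u * C" using C0 by simp
    qed (use that in \<open>simp add: emeasure_lborel_Ioo\<close>)
    also have "\<dots> = C * (q - p)" using that by simp
    finally show ?thesis .
  qed
  show ?thesis
  proof (cases "a \<le> b")
    case True
    then have "{a<..<b} \<subseteq> {min a b..max a b}" by auto
    then show ?thesis using *[of a b] True by (simp add: interval_lebesgue_integral_def)
  next
    case False
    then have "{b<..<a} \<subseteq> {min a b..max a b}" by auto
    then show ?thesis using *[of b a] False by (auto simp: interval_lebesgue_integral_def)
  qed
qed

text \<open>
  If f were bounded above near r, the one-sided Lipschitz condition would bound it below as well; all integrals
  in Feller's function then extend over bounded intervals and have bounded integrands, so it could not
  tend to infinity.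
\<close>

lemma drift_unbounded_at_left_end:
  fixes f :: "real \<Rightarrow> real" and r d \<kappa> \<gamma> B :: real
  assumes d: "r < d"
    and one_sided: "\<And>z z'. r < z \<Longrightarrow> r < z' \<Longrightarrow> z \<le> z' \<Longrightarrow> f z' - f z \<le> \<kappa> * (z' - z)"
    and feller: "filterlim (feller_v f \<gamma> d \<circ> real_of_ereal) at_top (at_right (ereal r))"
  shows "\<exists>z. r < z \<and> z \<le> d \<and> B < f z"
proof (rule ccontr)
  assume "\<not> ?thesis"
  then have up: "f z \<le> B" if "r < z" "z \<le> d" for z using that by force
  define C where "C = \<bar>B\<bar> + \<bar>f d\<bar> + \<bar>\<kappa>\<bar> * (d - r)"
  have C: "\<bar>f z\<bar> \<le> C" if z: "r < z" "z \<le> d" for z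
  proof -
    have "f d - f z \<le> \<kappa> * (d - z)" using one_sided[of z d] z d by auto
    also have "\<dots> \<le> \<bar>\<kappa>\<bar> * (d - r)" by (rule mult_mono) (use z in auto)
    finally have "f d - f z \<le> \<bar>\<kappa>\<bar> * (d - r)" .
    moreover have "0 \<le> \<bar>\<kappa>\<bar> * (d - r)" using d by simp
    ultimately show ?thesis using up[OF z] unfolding C_def by linarith
  qed
  have C0: "0 \<le> C" using d by (simp add: C_def)
  define E where "E = exp (2 / \<gamma>\<^sup>2 * (C * (d - r)))"
  have E0: "0 \<le> E" by (simp add: E_def)
  have v: "feller_v f \<gamma> d x \<le> E * (d - r) * (d - r)" if x: "r < x" "x \<le> d" for x
  proof -
    have 1: "\<bar>exp (- (2 / \<gamma>\<^sup>2) * (LBINT \<xi>=ereal z..ereal \<zeta>. f \<xi>))\<bar> \<le> E"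
      if "r < z" "z \<le> d" "r < \<zeta>" "\<zeta> \<le> d" for z \<zeta>
    proof -
      have "\<bar>LBINT \<xi>=ereal z..ereal \<zeta>. f \<xi>\<bar> \<le> C * \<bar>\<zeta> - z\<bar>"
        by (rule interval_lebesgue_integral_bound) (use C that in auto)
      also have "\<dots> \<le> C * (d - r)" using that C0 by (intro mult_left_mono) auto
      finally have "- (LBINT \<xi>=ereal z..ereal \<zeta>. f \<xi>) \<le> C * (d - r)" by linarith
      then have "2 / \<gamma>\<^sup>2 * - (LBINT \<xi>=ereal z..ereal \<zeta>. f \<xi>) \<le> 2 / \<gamma>\<^sup>2 * (C * (d - r))"
        by (intro mult_left_mono) auto
      then show ?thesis by (simp add: E_def)
    qed
    have 2: "\<bar>LBINT z=ereal d..ereal \<zeta>. exp (- (2 / \<gamma>\<^sup>2) * (LBINT \<xi>=ereal z..ereal \<zeta>. f \<xi>))\<bar> \<le> E * (d - r)"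
      if "r < \<zeta>" "\<zeta> \<le> d" for \<zeta>
    proof -
      have "\<bar>LBINT z=ereal d..ereal \<zeta>. exp (- (2 / \<gamma>\<^sup>2) * (LBINT \<xi>=ereal z..ereal \<zeta>. f \<xi>))\<bar> \<le> E * \<bar>\<zeta> - d\<bar>"
        by (rule interval_lebesgue_integral_bound) (rule 1, use that in auto)
      also have "\<dots> \<le> E * (d - r)" using that E0 by (intro mult_left_mono) auto
      finally show ?thesis .
    qed
    have "\<bar>feller_v f \<gamma> d x\<bar> \<le> (E * (d - r)) * \<bar>x - d\<bar>"
      unfolding feller_v_def
      by (rule interval_lebesgue_integral_bound) (rule 2, use x in auto)
    also have "\<dots> \<le> (E * (d - r)) * (d - r)" using x E0 d by (intro mult_left_mono) auto
    finally show ?thesis by linarith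
  qed
  have "eventually (\<lambda>x. E * (d - r) * (d - r) < (feller_v f \<gamma> d \<circ> real_of_ereal) x) (at_right (ereal r))"
    using feller by (auto simp: filterlim_at_top_dense)
  then obtain b where b: "ereal r < b"
    "\<And>x. ereal r < x \<Longrightarrow> x < b \<Longrightarrow> E * (d - r) * (d - r) < feller_v f \<gamma> d (real_of_ereal x)"
    using eventually_at_right[of "ereal r" "ereal d"] d by auto
  obtain x where x: "ereal r < x" "x < min b (ereal d)"
    using dense[of "ereal r" "min b (ereal d)"] b d by auto
  then obtain x' where "x = ereal x'" by (cases x) auto
  then show False using b(2)[of x] v[of x'] x by auto
qed

text \<open>
  Feller's condition is replaced by the consequence that the scheme depends on, the solvability of the implicit equation.
\<close>

locale one_sided_Lipschitz_drift =
  fixes I :: "real set" and f :: "real \<Rightarrow> real" and \<kappa> :: real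
  assumes interval: "is_interval I"
    and drift_continuous: "continuous_on I f"
    and one_sided: "\<And>z z'. z \<in> I \<Longrightarrow> z' \<in> I \<Longrightarrow> z \<le> z' \<Longrightarrow> f z' - f z \<le> \<kappa> * (z' - z)"
    and solvable: "\<And>h x. 0 < h \<Longrightarrow> \<kappa> * h < 1 \<Longrightarrow> \<exists>z\<in>I. z = x + f z * h"
begin

definition kappa_plus :: real where "kappa_plus = max \<kappa> 0"

text \<open>
  The difference quotient of f is at most \<kappa>, so z - \<tau> f(z) has slope at least 1 - \<kappa>+ h.  This is the multiplier of the
  error recursion.
\<close>

lemma slope:
  assumes z: "z \<in> I" "z' \<in> I" and \<tau>: "0 \<le> \<tau>" "\<tau> \<le> h"
  shows "\<exists>a \<ge> 1 - kappa_plus * h. z - z' - \<tau> * (f z - f z') = a * (z - z')"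
proof (cases "z = z'")
  case False
  define b where "b = (f z - f z') / (z - z')"
  have b: "f z - f z' = b * (z - z')" using False by (simp add: b_def)
  have "b \<le> \<kappa>"
  proof (cases "z < z'")
    case True
    then have "f z' - f z \<le> \<kappa> * (z' - z)" using one_sided z by simp
    then have "(f z' - f z) / (z' - z) \<le> \<kappa>" using True by (simp add: field_simps)
    also have "(f z' - f z) / (z' - z) = b" unfolding b_def by (metis minus_diff_eq minus_divide_divide)
    finally show ?thesis .
  next
    case False
    then have "f z - f z' \<le> \<kappa> * (z - z')" using one_sided z by simp
    then show ?thesis using False \<open>z \<noteq> z'\<close> by (simp add: b_def field_simps)
  qed
  then have "b * \<tau> \<le> kappa_plus * \<tau>" using \<tau> by (intro mult_right_mono) (auto simp: kappa_plus_def)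
  also have "\<dots> \<le> kappa_plus * h" using \<tau> by (intro mult_left_mono) (auto simp: kappa_plus_def)
  finally have "1 - kappa_plus * h \<le> 1 - b * \<tau>" by simp
  moreover have "z - z' - \<tau> * (f z - f z') = (1 - b * \<tau>) * (z - z')"
    unfolding b by (simp add: algebra_simps)
  ultimately show ?thesis by blast
qed auto

lemma kappa_plus_less: "0 \<le> h \<Longrightarrow> \<kappa> * h < 1 \<Longrightarrow> kappa_plus * h < 1"
  by (auto simp: kappa_plus_def max_def)

lemma solution_unique:
  assumes h: "0 \<le> h" "\<kappa> * h < 1" and z: "z \<in> I" "z = x + f z * h" "z' \<in> I" "z' = x + f z' * h"
  shows "z = z'"
proof -
  obtain a where a: "1 - kappa_plus * h \<le> a" "z - z' - h * (f z - f z') = a * (z - z')"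
    using slope[OF z(1,3) h(1) order_refl] by auto
  have "z - z' - h * (f z - f z') = 0" using z(2,4) by (simp add: algebra_simps)
  then show ?thesis using a kappa_plus_less[OF h] by auto
qed

lemma implicit_step_eqI:
  assumes "s \<le> t" "\<kappa> * (t - s) < 1" "z \<in> I" "z = x + f z * (t - s) + \<gamma> * (w t - w s)"
  shows "implicit_step I f \<gamma> w s t x = z"
  unfolding implicit_step_def
proof (rule the_equality)
  fix z' assume "z' \<in> I \<and> z' = x + f z' * (t - s) + \<gamma> * (w t - w s)"
  then show "z' = z"
    using solution_unique[of "t - s" z' "x + \<gamma> * (w t - w s)" z] assms by (simp add: algebra_simps)
qed (use assms in simp)

lemma implicit_step_solves:
  assumes "s \<le> t" "\<kappa> * (t - s) < 1" "x \<in> I"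
  shows "implicit_step I f \<gamma> w s t x \<in> I"
    and "implicit_step I f \<gamma> w s t x
      = x + f (implicit_step I f \<gamma> w s t x) * (t - s) + \<gamma> * (w t - w s)"
proof -
  have "\<exists>z\<in>I. z = x + f z * (t - s) + \<gamma> * (w t - w s)"
  proof (cases "s = t")
    case False
    then show ?thesis
      using solvable[of "t - s" "x + \<gamma> * (w t - w s)"] assms by (auto simp: algebra_simps)
  qed (use assms in auto)
  then obtain z where z: "z \<in> I" "z = x + f z * (t - s) + \<gamma> * (w t - w s)" by auto
  then have "implicit_step I f \<gamma> w s t x = z"
    using assms by (intro implicit_step_eqI)
  then show "implicit_step I f \<gamma> w s t x \<in> I"
    and "implicit_step I f \<gamma> w s t x
      = x + f (implicit_step I f \<gamma> w s t x) * (t - s) + \<gamma> * (w t - w s)"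
    using z by auto
qed

lemma implicit_step_at_start: "x \<in> I \<Longrightarrow> implicit_step I f \<gamma> w s s x = x"
  by (rule implicit_step_eqI) auto

text \<open>
  Subtracting the equations at times t and r and applying the slope bound at time t leaves
  f at the fixed time r only; the difference of the two solutions is thus controlled by |t - r| and |w t - w r|.
\<close>

lemma continuous_implicit_step:
  assumes w: "continuous_on {s..s'} w" and h: "\<kappa> * (s' - s) < 1" and x: "x \<in> I"
  shows "continuous_on {s..s'} (\<lambda>t. implicit_step I f \<gamma> w s t x)"
proof (cases "s \<le> s'")
  case True
  let ?z = "\<lambda>t. implicit_step I f \<gamma> w s t x"
  define q where "q = 1 - kappa_plus * (s' - s)"
  have q: "0 < q" using kappa_plus_less[of "s' - s"] h True by (simp add: q_def)
  have small: "\<kappa> * (t - s) < 1" if "t \<in> {s..s'}" for t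
  proof (cases "0 \<le> \<kappa>")
    case True
    then have "\<kappa> * (t - s) \<le> \<kappa> * (s' - s)" using that by (intro mult_left_mono) auto
    then show ?thesis using h by simp
  next
    case False
    then have "\<kappa> * (t - s) \<le> 0" using that by (intro mult_nonpos_nonneg) auto
    then show ?thesis by simp
  qed
  show ?thesis
    unfolding continuous_on_def
  proof
    fix r assume r: "r \<in> {s..s'}"
    have bound: "\<bar>?z t - ?z r\<bar> \<le> (\<bar>f (?z r)\<bar> * \<bar>t - r\<bar> + \<bar>\<gamma>\<bar> * \<bar>w t - w r\<bar>) / q" if t: "t \<in> {s..s'}" for t
    proof -
      have zt: "?z t \<in> I" "?z t = x + f (?z t) * (t - s) + \<gamma> * (w t - w s)"
        using t by (intro implicit_step_solves x small; simp)+
      have zr: "?z r \<in> I" "?z r = x + f (?z r) * (r - s) + \<gamma> * (w r - w s)"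
        using r by (intro implicit_step_solves x small; simp)+
      obtain a where a: "q \<le> a" "?z t - ?z r - (t - s) * (f (?z t) - f (?z r)) = a * (?z t - ?z r)"
        using slope[OF zt(1) zr(1), of "t - s" "s' - s"] t by (auto simp: q_def)
      have "a * (?z t - ?z r) = f (?z r) * (t - r) + \<gamma> * (w t - w r)"
        using zt(2) zr(2) a(2) by (simp add: algebra_simps)
      then have "\<bar>a\<bar> * \<bar>?z t - ?z r\<bar> \<le> \<bar>f (?z r)\<bar> * \<bar>t - r\<bar> + \<bar>\<gamma>\<bar> * \<bar>w t - w r\<bar>"
        by (metis abs_mult abs_triangle_ineq)
      moreover have "q * \<bar>?z t - ?z r\<bar> \<le> \<bar>a\<bar> * \<bar>?z t - ?z r\<bar>" using a by (intro mult_right_mono) auto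
      ultimately show ?thesis using q by (simp add: field_simps)
    qed
    have wr: "(w \<longlongrightarrow> w r) (at r within {s..s'})" using w r by (auto simp: continuous_on_def)
    have "((\<lambda>t. (\<bar>f (?z r)\<bar> * \<bar>t - r\<bar> + \<bar>\<gamma>\<bar> * \<bar>w t - w r\<bar>) / q) \<longlongrightarrow>
        (\<bar>f (?z r)\<bar> * \<bar>r - r\<bar> + \<bar>\<gamma>\<bar> * \<bar>w r - w r\<bar>) / q) (at r within {s..s'})"
      by (intro tendsto_intros wr) (use q in auto)
    then have "((\<lambda>t. (\<bar>f (?z r)\<bar> * \<bar>t - r\<bar> + \<bar>\<gamma>\<bar> * \<bar>w t - w r\<bar>) / q) \<longlongrightarrow> 0) (at r within {s..s'})"
      by simp
    then have "((\<lambda>t. ?z t - ?z r) \<longlongrightarrow> 0) (at r within {s..s'})"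
      by (rule Lim_null_comparison[rotated])
         (use bound in \<open>auto simp: eventually_at_filter intro!: always_eventually\<close>)
    then show "(?z \<longlongrightarrow> ?z r) (at r within {s..s'})" by (simp add: LIM_zero_iff)
  qed
qed simp

text \<open>
  The solution of z = x + f(z) h is a nondecreasing function of x, hence Borel measurable.
\<close>

lemma measurable_implicit_step:
  assumes [measurable]: "X \<in> borel_measurable M" "W s \<in> borel_measurable M" "W t \<in> borel_measurable M"
    and st: "s < t" "\<kappa> * (t - s) < 1"
  shows "(\<lambda>\<omega>. implicit_step I f \<gamma> (\<lambda>r. W r \<omega>) s t (X \<omega>)) \<in> borel_measurable M"
proof -
  define h where "h = t - s"
  have h: "0 < h" "\<kappa> * h < 1" using st by (auto simp: h_def)
  define \<Phi> where "\<Phi> x = (THE z. z \<in> I \<and> z = x + f z * h)" for x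
  have \<Phi>: "\<Phi> x \<in> I \<and> \<Phi> x = x + f (\<Phi> x) * h" for x
    unfolding \<Phi>_def
  proof (rule theI')
    show "\<exists>!z. z \<in> I \<and> z = x + f z * h"
      using solvable[OF h, of x] solution_unique[OF less_imp_le[OF h(1)] h(2), of _ x] by blast
  qed
  have "mono \<Phi>"
  proof (rule monoI)
    fix x x' :: real assume "x \<le> x'"
    obtain a where a: "1 - kappa_plus * h \<le> a" "\<Phi> x' - \<Phi> x - h * (f (\<Phi> x') - f (\<Phi> x)) = a * (\<Phi> x' - \<Phi> x)"
      using slope[of "\<Phi> x'" "\<Phi> x" h h] \<Phi> h by auto
    have "\<Phi> x' - \<Phi> x - h * (f (\<Phi> x') - f (\<Phi> x)) = x' - x"
      using \<Phi>[of x] \<Phi>[of x'] by (simp add: algebra_simps)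
    then have "0 \<le> a * (\<Phi> x' - \<Phi> x)" using a \<open>x \<le> x'\<close> by simp
    then show "\<Phi> x \<le> \<Phi> x'" using a kappa_plus_less[of h] h by (simp add: zero_le_mult_iff)
  qed
  then have [measurable]: "\<Phi> \<in> borel_measurable borel" by (rule borel_measurable_mono)
  have "(\<lambda>\<omega>. implicit_step I f \<gamma> (\<lambda>r. W r \<omega>) s t (X \<omega>)) = (\<lambda>\<omega>. \<Phi> (X \<omega> + \<gamma> * (W t \<omega> - W s \<omega>)))"
    by (simp add: implicit_step_def \<Phi>_def h_def algebra_simps)
  then show ?thesis by simp
qed

end

text \<open>
  The function G(z) = z - h f(z) grows at least linearly with rate 1 - \<kappa> h, so it takes arbitrarily large values, and
  arbitrarily small ones if the interval is unbounded below.  At a finite left end point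
  small values come from f being unbounded above there.
\<close>

lemma one_sided_Lipschitz_drift_from_Feller:
  fixes c :: ereal and d \<kappa> \<gamma> :: real
  assumes c: "c < \<infinity>" and I: "I = einterval c \<infinity>" and d: "d \<in> I"
    and cont: "continuous_on I f"
    and one_sided: "\<And>z z'. z \<in> I \<Longrightarrow> z' \<in> I \<Longrightarrow> z \<le> z' \<Longrightarrow> f z' - f z \<le> \<kappa> * (z' - z)"
    and feller: "filterlim (feller_v f \<gamma> d \<circ> real_of_ereal) at_top (at_right c)"
  shows "one_sided_Lipschitz_drift I f \<kappa>"
proof
  have up: "z' \<in> I" if "z \<in> I" "z \<le> z'" for z z'
    using that unfolding I by (auto simp: einterval_iff) (metis ereal_less_eq(3) less_le_trans)
  show "is_interval I" unfolding is_interval_1 using up by blast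
  fix h x :: real assume h: "0 < h" "\<kappa> * h < 1"
  define G where "G z = z - f z * h" for z
  have G: "(1 - \<kappa> * h) * (z' - z) \<le> G z' - G z" if "z \<in> I" "z' \<in> I" "z \<le> z'" for z z'
    using mult_left_mono[OF one_sided[OF that], of h] h by (simp add: G_def algebra_simps)
  have q: "0 < 1 - \<kappa> * h" using h by simp
  \<comment> \<open>moving from d by D changes G by at least the distance from G d to the target x\<close>
  define D where "D = \<bar>x - G d\<bar> / (1 - \<kappa> * h)"
  have D: "0 \<le> D" "(1 - \<kappa> * h) * D = \<bar>x - G d\<bar>" using q by (auto simp: D_def)
  have z2: "d + D \<in> I" "x \<le> G (d + D)"
    using up[OF d, of "d + D"] G[OF d, of "d + D"] D by auto
  have "\<exists>z1\<in>I. G z1 \<le> x"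
  proof (cases c)
    case (real r)
    have I': "I = {r<..}" using I real by (auto simp: einterval_iff)
    obtain z where z: "r < z" "z \<le> d" "(d - x) / h < f z"
      using drift_unbounded_at_left_end[of r d f \<kappa> \<gamma> "(d - x) / h"] d one_sided feller real I' by auto
    then have "d - x < f z * h" using h by (simp add: field_simps)
    then show ?thesis using z I' by (intro bexI[of _ z]) (auto simp: G_def)
  next
    case MInf
    then have "d - D \<in> I" using I by (auto simp: einterval_iff)
    then show ?thesis using G[of "d - D" d] d D by (intro bexI[of _ "d - D"]) auto
  qed (use c in auto)
  then obtain z1 where z1: "z1 \<in> I" "G z1 \<le> x" by auto
  have le: "z1 \<le> d + D"
  proof (rule ccontr)
    assume "\<not> z1 \<le> d + D"
    then have "0 < (1 - \<kappa> * h) * (z1 - (d + D))" using q by simp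
    then show False using G[of "d + D" z1] z1 z2 \<open>\<not> z1 \<le> d + D\<close> by auto
  qed
  have "continuous_on {z1..d + D} G"
    unfolding G_def using up z1(1)
    by (intro continuous_intros continuous_on_subset[OF cont]) auto
  then obtain z where "z1 \<le> z" "G z = x" using IVT'[of G z1 x "d + D"] z1 z2 le by auto
  then show "\<exists>z\<in>I. z = x + f z * h" using up[OF z1(1), of z] by (intro bexI[of _ z]) (auto simp: G_def)
qed (use cont one_sided in auto)

section \<open>Propagation of the local defects\<close>

lemma grid_time_0: "grid_time T n 0 = 0"
  by (simp add: grid_time_def)

lemma grid_time_Suc: "grid_time T n (Suc k) = grid_time T n k + T / real n"
  by (simp add: grid_time_def add_divide_distrib distrib_right)

lemma grid_time_nonneg: "0 < T \<Longrightarrow> 0 \<le> grid_time T n k"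
  by (simp add: grid_time_def)

lemma grid_time_le:
  assumes "0 < T" "k \<le> n"
  shows "grid_time T n k \<le> T"
proof (cases "n = 0")
  case False
  have "real k * T \<le> real n * T" using assms by (intro mult_right_mono) auto
  then show ?thesis using False by (simp add: grid_time_def field_simps)
qed (use assms in \<open>simp add: grid_time_def\<close>)

lemma grid_blocks_cover:
  assumes T: "0 < T" and n: "1 \<le> n"
  shows "(\<Union>k<n. {grid_time T n k..grid_time T n (Suc k)}) = {0..T}"
proof -
  have "(\<Union>k<m. {grid_time T n k..grid_time T n (Suc k)}) = {0..grid_time T n m}" if "0 < m" for m
    using that
  proof (induction m)
    case (Suc m)
    show ?case
    proof (cases "m = 0")
      case False
      have "grid_time T n m \<le> grid_time T n (Suc m)" "0 \<le> grid_time T n m"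
        using T grid_time_nonneg[OF T] by (auto simp: grid_time_Suc)
      then show ?thesis using Suc False by (auto simp: lessThan_Suc)
    qed (simp add: grid_time_0 lessThan_Suc)
  qed simp
  from this[of n] show ?thesis using n by (simp add: grid_time_def)
qed

definition local_defect :: "(real \<Rightarrow> real) \<Rightarrow> (real \<Rightarrow> real) \<Rightarrow> real \<Rightarrow> real \<Rightarrow> real" where
  "local_defect f Y s t = (t - s) * f (Y t) - integral {s..t} (\<lambda>u. f (Y u))"

text \<open>
  The index j of the grid interval is an argument because a grid point belongs to two intervals; both values agree
  there by accumulated_defect_Suc.
\<close>

definition accumulated_defect ::
  "(real \<Rightarrow> real) \<Rightarrow> (real \<Rightarrow> real) \<Rightarrow> real \<Rightarrow> nat \<Rightarrow> nat \<Rightarrow> real \<Rightarrow> real" where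
  "accumulated_defect f Y T n j t =
     (\<Sum>i<j. local_defect f Y (grid_time T n i) (grid_time T n (Suc i))) + local_defect f Y (grid_time T n j) t"

lemma accumulated_defect_Suc:
  "accumulated_defect f Y T n (Suc j) (grid_time T n (Suc j)) = accumulated_defect f Y T n j (grid_time T n (Suc j))"
  by (simp add: accumulated_defect_def local_defect_def)

text \<open>
  The quantity e - (P + \<rho>) satisfies a (e - (P + \<rho>)) = (e0 - P) + (1 - a) (P + \<rho>).  For a \<ge> 1 its right-hand side divided by a is a
  convex combination of quantities bounded by m, however large a is; for a < 1 the loss is at most the factor 1 / q.
\<close>

lemma damped_recursion_step:
  fixes a q e e0 P \<rho> m R :: real
  assumes q: "0 < q" "q \<le> 1" "q \<le> a" and rec: "a * e = e0 + \<rho>"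
    and m: "\<bar>e0 - P\<bar> \<le> m" "R \<le> m" and R: "\<bar>P + \<rho>\<bar> \<le> R"
  shows "\<bar>e - (P + \<rho>)\<bar> \<le> (m + R) / q - R"
proof -
  have a0: "0 < a" using q by simp
  have "a * (e - (P + \<rho>)) = (e0 - P) + (1 - a) * (P + \<rho>)" using rec by (simp add: algebra_simps)
  then have "a * \<bar>e - (P + \<rho>)\<bar> \<le> \<bar>e0 - P\<bar> + \<bar>1 - a\<bar> * \<bar>P + \<rho>\<bar>"
    using a0 by (metis abs_mult abs_of_pos abs_triangle_ineq)
  also have "\<dots> \<le> m + \<bar>1 - a\<bar> * R" using m R by (intro add_mono mult_left_mono) auto
  finally have le: "a * \<bar>e - (P + \<rho>)\<bar> \<le> m + \<bar>1 - a\<bar> * R" .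
  have R0: "0 \<le> R" using R by linarith
  show ?thesis
  proof (cases "1 \<le> a")
    case True
    then have "(a - 1) * R \<le> (a - 1) * m" using m by (intro mult_left_mono) auto
    moreover have "\<bar>1 - a\<bar> = a - 1" using True by simp
    ultimately have "a * \<bar>e - (P + \<rho>)\<bar> \<le> m + (a - 1) * m" using le by simp
    also have "m + (a - 1) * m = a * m" by (simp add: algebra_simps)
    finally have "\<bar>e - (P + \<rho>)\<bar> \<le> m" using mult_le_cancel_left_pos[OF a0] by blast
    also have "m \<le> (m + R) / q - R"
    proof -
      have "(m + R) * q \<le> (m + R) * 1" using q m R0 by (intro mult_left_mono) auto
      then show ?thesis using q by (simp add: field_simps)
    qed
    finally show ?thesis .
  next
    case False
    then have "a * (\<bar>e - (P + \<rho>)\<bar> + R) \<le> m + R" using le by (simp add: algebra_simps)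
    then have "\<bar>e - (P + \<rho>)\<bar> + R \<le> (m + R) / a" using a0 by (simp add: field_simps)
    also have "\<dots> \<le> (m + R) / q" using q m R0 by (intro divide_left_mono) auto
    finally show ?thesis by simp
  qed
qed

lemma inverse_power_le_exp:
  fixes x :: real
  assumes "0 \<le> x" "x \<le> 1 / 2"
  shows "1 / (1 - x) ^ n \<le> exp (2 * x * n)"
proof -
  have "2 * x\<^sup>2 \<le> x" using assms mult_left_mono[of "2 * x" 1 x] by (simp add: power2_eq_square mult_ac)
  then have "- (2 * x) \<le> ln (1 - x)" using ln_one_minus_pos_lower_bound[OF assms] by linarith
  then have "exp (- (2 * x)) \<le> 1 - x" using assms by (simp add: ln_ge_iff)
  then have "exp (- (2 * x)) ^ n \<le> (1 - x) ^ n" by (intro power_mono) auto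
  then have "1 / (1 - x) ^ n \<le> 1 / exp (- (2 * x)) ^ n" using assms by (intro divide_left_mono) auto
  also have "\<dots> = exp (2 * x * n)"
    by (simp add: exp_minus exp_of_nat_mult[symmetric] power_inverse mult.commute field_simps)
  finally show ?thesis .
qed

context one_sided_Lipschitz_drift
begin

lemma step_small:
  assumes "0 < T" "1 \<le> n" "real n > 2 * \<kappa> * T" and t: "t \<in> {grid_time T n k..grid_time T n (Suc k)}"
  shows "kappa_plus * (T / real n) \<le> 1 / 2" "\<kappa> * (t - grid_time T n k) < 1"
proof -
  show 1: "kappa_plus * (T / real n) \<le> 1 / 2" using assms by (auto simp: kappa_plus_def max_def field_simps)
  have "\<kappa> * (t - grid_time T n k) \<le> kappa_plus * (t - grid_time T n k)"
    using t by (intro mult_right_mono) (auto simp: kappa_plus_def)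
  also have "\<dots> \<le> kappa_plus * (T / real n)"
    using t by (intro mult_left_mono) (auto simp: kappa_plus_def grid_time_Suc)
  finally show "\<kappa> * (t - grid_time T n k) < 1" using 1 by linarith
qed

lemma implicit_euler_grid_in_I:
  assumes "0 < T" "1 \<le> n" "real n > 2 * \<kappa> * T" "y \<in> I"
  shows "implicit_euler_grid I f \<gamma> y T n w k \<in> I"
proof (induction k)
  case (Suc k)
  have "grid_time T n (Suc k) \<in> {grid_time T n k..grid_time T n (Suc k)}"
    using assms by (simp add: grid_time_Suc)
  then show ?case
    using implicit_step_solves(1) Suc step_small(2)[OF assms(1-3)] by simp
qed (use assms in simp)

lemma implicit_euler_on_block:
  assumes "0 < T" "1 \<le> n" "real n > 2 * \<kappa> * T" "y \<in> I"
    and t: "t \<in> {grid_time T n k..grid_time T n (Suc k)}"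
  shows "implicit_euler I f \<gamma> y T n w t
    = implicit_step I f \<gamma> w (grid_time T n k) t (implicit_euler_grid I f \<gamma> y T n w k)"
proof (cases "t = grid_time T n k")
  case True
  then show ?thesis
    using implicit_euler_grid_time[OF assms(1,2)] implicit_step_at_start[OF implicit_euler_grid_in_I[OF assms(1-4)]]
    by simp
qed (use t in \<open>auto intro!: implicit_euler_between assms\<close>)

lemma continuous_implicit_euler:
  assumes "0 < T" "1 \<le> n" "real n > 2 * \<kappa> * T" "y \<in> I" and w: "continuous_on {0..T} w"
  shows "continuous_on {0..T} (implicit_euler I f \<gamma> y T n w)"
proof -
  let ?B = "\<lambda>k. {grid_time T n k..grid_time T n (Suc k)}"
  have "continuous_on (\<Union>k\<in>{..<n}. ?B k) (implicit_euler I f \<gamma> y T n w)"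
  proof (rule continuous_on_closed_Union)
    fix k assume k: "k \<in> {..<n}"
    have "continuous_on (?B k) (\<lambda>t. implicit_step I f \<gamma> w (grid_time T n k) t (implicit_euler_grid I f \<gamma> y T n w k))"
    proof (rule continuous_implicit_step)
      show "continuous_on (?B k) w"
        by (rule continuous_on_subset[OF w]) (use grid_blocks_cover[OF assms(1,2)] k in blast)
      have "grid_time T n (Suc k) \<in> ?B k" using assms by (simp add: grid_time_Suc)
      then show "\<kappa> * (grid_time T n (Suc k) - grid_time T n k) < 1" by (rule step_small(2)[OF assms(1-3)])
    qed (rule implicit_euler_grid_in_I[OF assms(1-4)])
    moreover have "continuous_on (?B k) (implicit_euler I f \<gamma> y T n w) \<longleftrightarrow>
      continuous_on (?B k) (\<lambda>t. implicit_step I f \<gamma> w (grid_time T n k) t (implicit_euler_grid I f \<gamma> y T n w k))"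
      by (intro continuous_on_cong refl implicit_euler_on_block[OF assms(1-4)])
    ultimately show "continuous_on (?B k) (implicit_euler I f \<gamma> y T n w)" by blast
  qed auto
  then show ?thesis using grid_blocks_cover[OF assms(1,2)] by simp
qed

lemma measurable_implicit_euler:
  assumes "0 < T" "1 \<le> n" "real n > 2 * \<kappa> * T" "y \<in> I"
    and W: "\<And>t. 0 \<le> t \<Longrightarrow> W t \<in> borel_measurable M" and t: "t \<in> {0..T}"
  shows "(\<lambda>\<omega>. implicit_euler I f \<gamma> y T n (\<lambda>s. W s \<omega>) t) \<in> borel_measurable M"
proof -
  have step: "(\<lambda>\<omega>. implicit_step I f \<gamma> (\<lambda>s. W s \<omega>) (grid_time T n k) r (X \<omega>)) \<in> borel_measurable M"
    if "X \<in> borel_measurable M" "grid_time T n k < r" "r \<le> grid_time T n (Suc k)" for X k r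
    using that grid_time_nonneg[OF assms(1), of n k] assms
    by (intro measurable_implicit_step W step_small(2)[OF assms(1-3)]) auto
  have grid: "(\<lambda>\<omega>. implicit_euler_grid I f \<gamma> y T n (\<lambda>s. W s \<omega>) k) \<in> borel_measurable M" for k
  proof (induction k)
    case (Suc k)
    then show ?case using step[OF Suc] assms by (simp add: grid_time_Suc)
  qed simp
  obtain k where k: "t \<in> {grid_time T n k..grid_time T n (Suc k)}"
    using grid_blocks_cover[OF assms(1,2)] t by blast
  show ?thesis
  proof (cases "t = grid_time T n k")
    case True
    then show ?thesis using grid implicit_euler_grid_time[OF assms(1,2)] by simp
  next
    case False
    then show ?thesis
      unfolding implicit_euler_on_block[OF assms(1-4) k] using step[OF grid, of k t k] k by auto
  qed
qed

text \<open>
  With R the largest accumulated defect, the error minus the accumulated defect is at most 2 R / q^k - R at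
  the k-th grid point.  This is the solution of the recursion that comes from damped_recursion_step with m_0 = R.
\<close>

lemma scheme_error_le_accumulated_defect:
  assumes T: "0 < T" and n: "1 \<le> n" "real n > 2 * \<kappa> * T" and y: "y \<in> I"
    and Y: "continuous_on {0..T} Y" "\<And>t. t \<in> {0..T} \<Longrightarrow> Y t \<in> I"
    and eq: "\<And>t. t \<in> {0..T} \<Longrightarrow> Y t = y + integral {0..t} (\<lambda>u. f (Y u)) + \<gamma> * (w t - w 0)"
    and R: "\<And>j t. j < n \<Longrightarrow> t \<in> {grid_time T n j..grid_time T n (Suc j)} \<Longrightarrow> \<bar>accumulated_defect f Y T n j t\<bar> \<le> R"
    and t: "t \<in> {0..T}"
  shows "\<bar>implicit_euler I f \<gamma> y T n w t - Y t\<bar> \<le> 2 * exp (2 * kappa_plus * T) * R"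
proof -
  define q where "q = 1 - kappa_plus * (T / real n)"
  have kp0: "0 \<le> kappa_plus" by (simp add: kappa_plus_def)
  have kph: "0 \<le> kappa_plus * (T / real n)" "kappa_plus * (T / real n) \<le> 1 / 2"
    using kp0 T step_small(1)[OF T n, of 0 0] by (auto simp: grid_time_Suc grid_time_0)
  have q: "0 < q" "q \<le> 1" using kph unfolding q_def by linarith+
  have R0: "0 \<le> R" using R[of 0 0] n T by (auto simp: grid_time_0 grid_time_Suc intro: order_trans[OF abs_ge_zero])
  let ?G = "implicit_euler_grid I f \<gamma> y T n w"
  let ?P = "\<lambda>j. accumulated_defect f Y T n j (grid_time T n j)"
  let ?m = "\<lambda>k. 2 * R / q ^ k - R"
  have cf: "continuous_on {0..T} (\<lambda>u. f (Y u))"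
    by (rule continuous_compose_path[OF drift_continuous Y])
  have mR: "R \<le> ?m k" for k
  proof -
    have "q ^ k \<le> 1" "0 < q ^ k" using q by (auto intro: power_le_one)
    then have "2 * R * q ^ k \<le> 2 * R * 1" using R0 by (intro mult_left_mono) auto
    then have "2 * R \<le> 2 * R / q ^ k" using \<open>0 < q ^ k\<close> by (simp add: field_simps)
    then show ?thesis by simp
  qed
  have step: "\<bar>(implicit_euler I f \<gamma> y T n w t - Y t) - accumulated_defect f Y T n k t\<bar> \<le> ?m (Suc k)"
    if k: "k < n" and t: "t \<in> {grid_time T n k..grid_time T n (Suc k)}"
      and IH: "\<bar>(?G k - Y (grid_time T n k)) - ?P k\<bar> \<le> ?m k" for k t
  proof -
    define s where "s = grid_time T n k"
    define z where "z = implicit_step I f \<gamma> w s t (?G k)"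
    have st: "s \<le> t" "t - s \<le> T / real n" using t by (auto simp: s_def grid_time_Suc)
    have s0: "0 \<le> s" using T by (simp add: s_def grid_time_nonneg)
    have tT: "t \<le> T" using t grid_time_le[OF T, of "Suc k" n] k by auto
    have G: "?G k \<in> I" by (rule implicit_euler_grid_in_I[OF T n y])
    have z: "z \<in> I" "z = ?G k + f z * (t - s) + \<gamma> * (w t - w s)"
      unfolding z_def using implicit_step_solves[OF _ _ G] st step_small(2)[OF T n t] by (auto simp: s_def)
    have Yt: "Y t \<in> I" using Y(2) s0 st tT by auto
    obtain a where a: "q \<le> a" "z - Y t - (t - s) * (f z - f (Y t)) = a * (z - Y t)"
      using slope[OF z(1) Yt, of "t - s" "T / real n"] st by (auto simp: q_def)
    have "integral {0..t} (\<lambda>u. f (Y u)) = integral {0..s} (\<lambda>u. f (Y u)) + integral {s..t} (\<lambda>u. f (Y u))"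
      by (rule integral_split_continuous) (use s0 st tT continuous_on_subset[OF cf] in auto)
    then have "Y t = Y s + integral {s..t} (\<lambda>u. f (Y u)) + \<gamma> * (w t - w s)"
      using eq[of s] eq[of t] s0 tT st by (simp add: algebra_simps)
    then have rec: "a * (z - Y t) = (?G k - Y s) + local_defect f Y s t"
      using a(2) z(2) by (simp add: local_defect_def algebra_simps)
    have acc: "accumulated_defect f Y T n k t = ?P k + local_defect f Y s t"
      by (simp add: accumulated_defect_def local_defect_def s_def)
    have h1: "\<bar>(?G k - Y s) - ?P k\<bar> \<le> ?m k" using IH by (simp only: s_def)
    have h2: "\<bar>?P k + local_defect f Y s t\<bar> \<le> R" using R[OF k t] by (simp only: acc)
    have "\<bar>(z - Y t) - (?P k + local_defect f Y s t)\<bar> \<le> (?m k + R) / q - R"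
      by (rule damped_recursion_step[OF q a(1) rec h1 mR h2])
    also have "\<dots> = ?m (Suc k)" using q by (simp add: field_simps)
    finally show ?thesis
      unfolding acc implicit_euler_on_block[OF T n y t] z_def s_def .
  qed
  have grid: "\<bar>(?G k - Y (grid_time T n k)) - ?P k\<bar> \<le> ?m k" if "k \<le> n" for k
    using that
  proof (induction k)
    case 0
    have "Y 0 = y" using eq[of 0] T by simp
    then show ?case using R0 by (simp add: grid_time_0 accumulated_defect_def local_defect_def)
  next
    case (Suc k)
    have "grid_time T n (Suc k) \<in> {grid_time T n k..grid_time T n (Suc k)}" using T by (simp add: grid_time_Suc)
    from step[OF _ this] Suc show ?case
      using implicit_euler_grid_time[OF T n(1), of I f \<gamma> y w "Suc k"] by (simp add: accumulated_defect_Suc)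
  qed
  obtain k where k: "k < n" "t \<in> {grid_time T n k..grid_time T n (Suc k)}"
    using grid_blocks_cover[OF T n(1)] t by blast
  have "\<bar>implicit_euler I f \<gamma> y T n w t - Y t\<bar> \<le> ?m (Suc k) + R"
    using step[OF k grid] R[OF k] k(1) by linarith
  also have "\<dots> = 2 * R * (1 / q ^ Suc k)" by simp
  also have "\<dots> \<le> 2 * R * exp (2 * (kappa_plus * (T / real n)) * real (Suc k))"
    unfolding q_def using R0 by (intro mult_left_mono inverse_power_le_exp kph) auto
  also have "\<dots> \<le> 2 * R * exp (2 * (kappa_plus * (T / real n)) * real n)"
  proof -
    have "2 * (kappa_plus * (T / real n)) * real (Suc k) \<le> 2 * (kappa_plus * (T / real n)) * real n"
      by (rule mult_left_mono) (use kph(1) k(1) in linarith)+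
    then show ?thesis using R0 by (intro mult_left_mono) auto
  qed
  also have "2 * (kappa_plus * (T / real n)) * real n = 2 * kappa_plus * T" using n by simp
  finally show ?thesis by (simp add: mult_ac)
qed

end

section \<open>A pathwise Ito expansion\<close>

lemma second_order_Taylor_along_path:
  fixes f f1 f2 Y :: "real \<Rightarrow> real"
  assumes st: "s \<le> t" and Y: "continuous_on {s..t} Y" "\<And>u. u \<in> {s..t} \<Longrightarrow> Y u \<in> I"
    and I: "is_interval I"
    and f1: "\<And>x. x \<in> I \<Longrightarrow> (f has_real_derivative f1 x) (at x)"
    and f2: "\<And>x. x \<in> I \<Longrightarrow> (f1 has_real_derivative f2 x) (at x)"
  shows "\<exists>u\<in>{s..t}. f (Y t) - f (Y s) = f1 (Y s) * (Y t - Y s) + f2 (Y u) / 2 * (Y t - Y s)\<^sup>2"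
proof (cases "Y t = Y s")
  case True
  then show ?thesis using st by (intro bexI[of _ s]) auto
next
  case False
  define diff where "diff m = (if m = 0 then f else if m = 1 then f1 else f2)" for m :: nat
  define a where "a = min (Y s) (Y t)"
  define b where "b = max (Y s) (Y t)"
  have mem: "x \<in> I" if "a \<le> x" "x \<le> b" for x
    using mem_is_interval_1_I[OF I, of a b x] Y(2)[of s] Y(2)[of t] st that by (auto simp: a_def b_def min_def max_def split: if_splits)
  have "\<exists>x. (if Y t < Y s then Y t < x \<and> x < Y s else Y s < x \<and> x < Y t) \<and>
     f (Y t) = (\<Sum>m<2. diff m (Y s) / fact m * (Y t - Y s) ^ m) + diff 2 x / fact 2 * (Y t - Y s) ^ 2"
  proof (rule Taylor[of 2 diff f a b])
    show "\<forall>m x. m < 2 \<and> a \<le> x \<and> x \<le> b \<longrightarrow> (diff m has_real_derivative diff (Suc m) x) (at x)"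
      using f1 f2 mem by (auto simp: diff_def less_2_cases_iff)
  qed (use False in \<open>auto simp: diff_def a_def b_def\<close>)
  then obtain x where x': "if Y t < Y s then Y t < x \<and> x < Y s else Y s < x \<and> x < Y t"
    and eq': "f (Y t) = (\<Sum>m<2. diff m (Y s) / fact m * (Y t - Y s) ^ m) + diff 2 x / fact 2 * (Y t - Y s) ^ 2"
    by blast
  have x: "a \<le> x" "x \<le> b" using x' by (auto simp: a_def b_def split: if_splits)
  have eq: "f (Y t) = f (Y s) + f1 (Y s) * (Y t - Y s) + f2 x / 2 * (Y t - Y s)\<^sup>2"
    using eq' by (simp add: diff_def lessThan_nat_numeral lessThan_Suc)
  have "connected (Y ` {s..t})" by (rule connected_continuous_image[OF Y(1)]) simp
  then have "is_interval (Y ` {s..t})" by (simp add: is_interval_connected_1)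
  from mem_is_interval_1_I[OF this, of a b x] have "x \<in> Y ` {s..t}"
    using x st by (auto simp: a_def b_def min_def max_def)
  then show ?thesis using eq by auto
qed

text \<open>
  One path of the solution and of the Brownian motion; all arguments in this locale are deterministic.
\<close>

locale SDE_path =
  fixes I :: "real set" and f f1 f2 :: "real \<Rightarrow> real" and \<gamma> T y :: real and Y W :: "real \<Rightarrow> real"
  assumes T_pos: "0 < T" and \<gamma>_nonneg: "0 \<le> \<gamma>" and interval: "is_interval I"
    and deriv1: "\<And>x. x \<in> I \<Longrightarrow> (f has_real_derivative f1 x) (at x)"
    and deriv2: "\<And>x. x \<in> I \<Longrightarrow> (f1 has_real_derivative f2 x) (at x)"
    and continuous_deriv2: "continuous_on I f2"
    and Y_continuous: "continuous_on {0..T} Y" and Y_in_I: "\<And>u. u \<in> {0..T} \<Longrightarrow> Y u \<in> I"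
    and W_continuous: "continuous_on {0..T} W"
    and equation: "\<And>t. t \<in> {0..T} \<Longrightarrow> Y t = y + integral {0..t} (\<lambda>u. f (Y u)) + \<gamma> * (W t - W 0)"
begin

definition generator :: "real \<Rightarrow> real" where
  "generator u = f1 (Y u) * f (Y u) + \<gamma>\<^sup>2 / 2 * f2 (Y u)"

definition remainder :: "real \<Rightarrow> real \<Rightarrow> real" where
  "remainder s t = f (Y t) - f (Y s) - integral {s..t} generator - \<gamma> * f1 (Y s) * (W t - W s)
     - \<gamma>\<^sup>2 / 2 * f2 (Y s) * ((W t - W s)\<^sup>2 - (t - s))"

lemma continuous_along_path:
  "continuous_on {0..T} (\<lambda>u. f (Y u))" "continuous_on {0..T} (\<lambda>u. f1 (Y u))"
  "continuous_on {0..T} (\<lambda>u. f2 (Y u))" "continuous_on {0..T} generator"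
proof -
  have along: "continuous_on {0..T} (\<lambda>u. \<phi> (Y u))" if "continuous_on I \<phi>" for \<phi> :: "real \<Rightarrow> real"
    using that Y_continuous Y_in_I by (rule continuous_compose_path)
  show c: "continuous_on {0..T} (\<lambda>u. f (Y u))" "continuous_on {0..T} (\<lambda>u. f1 (Y u))"
    "continuous_on {0..T} (\<lambda>u. f2 (Y u))"
    by (intro along continuous_deriv2 continuous_at_imp_continuous_on ballI DERIV_isCont[OF deriv1]
        DERIV_isCont[OF deriv2]; assumption)+
  show "continuous_on {0..T} generator"
    unfolding generator_def[abs_def] by (intro continuous_intros c)
qed

text \<open>
  All error terms carry the factor \<eta>, a bound for the oscillation over the step, next to a quantity whose sum over the
  steps stays bounded: the length of the step or the square of the increment of W.
\<close>

lemma Ito_step: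
  assumes st: "0 \<le> s" "s \<le> t" "t \<le> T"
    and F: "\<And>u. u \<in> {s..t} \<Longrightarrow> \<bar>f (Y u)\<bar> \<le> F" "\<And>u. u \<in> {s..t} \<Longrightarrow> \<bar>f2 (Y u)\<bar> \<le> F"
    and \<eta>: "\<And>u. u \<in> {s..t} \<Longrightarrow> \<bar>f1 (Y u) - f1 (Y s)\<bar> \<le> \<eta>"
      "\<And>u. u \<in> {s..t} \<Longrightarrow> \<bar>f2 (Y u) - f2 (Y s)\<bar> \<le> \<eta>" "\<bar>Y t - Y s\<bar> \<le> \<eta>" "\<bar>W t - W s\<bar> \<le> \<eta>"
  shows "\<bar>remainder s t\<bar> \<le> \<eta> * (F * (t - s) + F\<^sup>2 * (t - s)\<^sup>2 + \<gamma>\<^sup>2 * (W t - W s)\<^sup>2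
    + F\<^sup>2 * (1 + \<gamma>) / 2 * (t - s) + \<gamma>\<^sup>2 / 2 * (t - s))"
proof -
  let ?d = "t - s"
  define w where "w = W t - W s"
  define b where "b = integral {s..t} (\<lambda>u. f (Y u))"
  have d: "0 \<le> ?d" using st by simp
  have F0: "0 \<le> F" using F(1)[of s] st by (metis abs_ge_zero atLeastAtMost_iff order_refl order_trans)
  have e0: "0 \<le> \<eta>" using \<eta>(3) by linarith
  have sub: "{s..t} \<subseteq> {0..T}" using st by auto
  note c = continuous_along_path[THEN continuous_on_subset, OF sub]
  have "integral {0..t} (\<lambda>u. f (Y u)) = integral {0..s} (\<lambda>u. f (Y u)) + b"
    unfolding b_def
    by (rule integral_split_continuous) (use st continuous_on_subset[OF continuous_along_path(1)] in auto)
  then have dY: "Y t - Y s = b + \<gamma> * w"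
    using equation[of s] equation[of t] st by (simp add: w_def algebra_simps)
  have bnd: "\<bar>integral {s..t} g\<bar> \<le> C * ?d"
    if "continuous_on {s..t} g" "\<And>u. u \<in> {s..t} \<Longrightarrow> \<bar>g u\<bar> \<le> C" for g :: "real \<Rightarrow> real" and C
    using integral_bound[OF st(2) that(1)] that(2) by auto
  have b: "\<bar>b\<bar> \<le> F * ?d" unfolding b_def by (rule bnd[OF c(1) F(1)])
  have Ys: "continuous_on {s..t} Y" by (rule continuous_on_subset[OF Y_continuous sub])
  have YI: "Y u \<in> I" if "u \<in> {s..t}" for u using Y_in_I sub that by auto
  obtain u where u: "u \<in> {s..t}"
    and tay: "f (Y t) - f (Y s) = f1 (Y s) * (Y t - Y s) + f2 (Y u) / 2 * (Y t - Y s)\<^sup>2"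
    using second_order_Taylor_along_path[OF st(2) Ys YI interval deriv1 deriv2] by blast
  define J1 where "J1 = integral {s..t} (\<lambda>u. (f1 (Y u) - f1 (Y s)) * f (Y u))"
  define J2 where "J2 = integral {s..t} (\<lambda>u. f2 (Y u) - f2 (Y s))"
  have "((\<lambda>u. (f1 (Y u) - f1 (Y s)) * f (Y u)) has_integral J1) {s..t}"
    unfolding J1_def by (intro integrable_integral integrable_continuous_interval continuous_intros c)
  moreover have "((\<lambda>u. f2 (Y u) - f2 (Y s)) has_integral J2) {s..t}"
    unfolding J2_def by (intro integrable_integral integrable_continuous_interval continuous_intros c)
  moreover have "((\<lambda>u. f (Y u)) has_integral b) {s..t}"
    unfolding b_def by (intro integrable_integral integrable_continuous_interval c)
  moreover have "((\<lambda>u. f2 (Y s)) has_integral (f2 (Y s) * ?d)) {s..t}"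
    using has_integral_const_real[of "f2 (Y s)" s t] st by (simp add: mult.commute)
  ultimately have "((\<lambda>u. (f1 (Y u) - f1 (Y s)) * f (Y u) + f1 (Y s) * f (Y u)
      + \<gamma>\<^sup>2 / 2 * ((f2 (Y u) - f2 (Y s)) + f2 (Y s))) has_integral
      (J1 + f1 (Y s) * b + \<gamma>\<^sup>2 / 2 * (J2 + f2 (Y s) * ?d))) {s..t}"
    by (intro has_integral_add has_integral_mult_right)
  moreover have "(\<lambda>u. (f1 (Y u) - f1 (Y s)) * f (Y u) + f1 (Y s) * f (Y u)
      + \<gamma>\<^sup>2 / 2 * ((f2 (Y u) - f2 (Y s)) + f2 (Y s))) = generator"
    by (simp add: generator_def fun_eq_iff algebra_simps)
  ultimately have int: "integral {s..t} generator = J1 + f1 (Y s) * b + \<gamma>\<^sup>2 / 2 * (J2 + f2 (Y s) * ?d)"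
    by (simp add: integral_unique)
  have J1: "\<bar>J1\<bar> \<le> \<eta> * F * ?d"
    unfolding J1_def
  proof (rule bnd)
    show "\<bar>(f1 (Y u) - f1 (Y s)) * f (Y u)\<bar> \<le> \<eta> * F" if "u \<in> {s..t}" for u
      unfolding abs_mult using \<eta>(1)[OF that] F(1)[OF that] e0 by (intro mult_mono) auto
  qed (intro continuous_intros c)
  have J2: "\<bar>J2\<bar> \<le> \<eta> * ?d"
    unfolding J2_def by (rule bnd) (use \<eta>(2) in \<open>auto intro!: continuous_intros c\<close>)
  have id: "remainder s t
     = - J1 + (f2 (Y u) - f2 (Y s)) / 2 * (Y t - Y s)\<^sup>2
       + f2 (Y s) / 2 * (b * ((Y t - Y s) + \<gamma> * w)) - \<gamma>\<^sup>2 / 2 * J2"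
    unfolding remainder_def tay int dY by (simp add: w_def[symmetric] power2_eq_square field_simps)
  have t2: "\<bar>(f2 (Y u) - f2 (Y s)) / 2 * (Y t - Y s)\<^sup>2\<bar> \<le> \<eta> * (F\<^sup>2 * ?d\<^sup>2 + \<gamma>\<^sup>2 * w\<^sup>2)"
  proof -
    have "(Y t - Y s)\<^sup>2 \<le> 2 * (b\<^sup>2 + (\<gamma> * w)\<^sup>2)"
      unfolding dY using sum_squares_bound[of b "\<gamma> * w"] by (simp add: power2_sum)
    moreover have "b\<^sup>2 \<le> (F * ?d)\<^sup>2" using b power_mono[OF b, of 2] by simp
    ultimately have "(Y t - Y s)\<^sup>2 / 2 \<le> F\<^sup>2 * ?d\<^sup>2 + \<gamma>\<^sup>2 * w\<^sup>2" by (simp add: power_mult_distrib)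
    then have "\<bar>f2 (Y u) - f2 (Y s)\<bar> * ((Y t - Y s)\<^sup>2 / 2) \<le> \<eta> * (F\<^sup>2 * ?d\<^sup>2 + \<gamma>\<^sup>2 * w\<^sup>2)"
      using \<eta>(2)[OF u] e0 by (intro mult_mono) auto
    then show ?thesis by (simp add: abs_mult)
  qed
  have t3: "\<bar>f2 (Y s) / 2 * (b * ((Y t - Y s) + \<gamma> * w))\<bar> \<le> \<eta> * (F\<^sup>2 * (1 + \<gamma>) / 2 * ?d)"
  proof -
    have "\<bar>(Y t - Y s) + \<gamma> * w\<bar> \<le> \<eta> + \<gamma> * \<eta>"
      using \<eta>(3,4)[folded w_def] \<gamma>_nonneg mult_left_mono[OF \<eta>(4)[folded w_def] \<gamma>_nonneg] by (auto simp: abs_mult intro!: abs_triangle_ineq[THEN order_trans])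
    then have hb: "\<bar>b\<bar> * \<bar>(Y t - Y s) + \<gamma> * w\<bar> \<le> (F * ?d) * (\<eta> + \<gamma> * \<eta>)"
      using b e0 F0 d \<gamma>_nonneg by (intro mult_mono) auto
    have "\<bar>f2 (Y s)\<bar> * (\<bar>b\<bar> * \<bar>(Y t - Y s) + \<gamma> * w\<bar>) \<le> F * ((F * ?d) * (\<eta> + \<gamma> * \<eta>))"
      by (rule mult_mono) (use F(2)[of s] st F0 hb in auto)
    moreover have "\<bar>f2 (Y s) / 2 * (b * X)\<bar> = \<bar>f2 (Y s)\<bar> * (\<bar>b\<bar> * \<bar>X\<bar>) / 2" for X
      by (simp add: abs_mult)
    moreover have "F * ((F * ?d) * (\<eta> + \<gamma> * \<eta>)) / 2 = \<eta> * (F\<^sup>2 * (1 + \<gamma>) / 2 * ?d)"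
      by (simp add: power2_eq_square algebra_simps)
    ultimately show ?thesis by (metis divide_right_mono zero_le_numeral)
  qed
  have t4: "\<bar>\<gamma>\<^sup>2 / 2 * J2\<bar> \<le> \<eta> * (\<gamma>\<^sup>2 / 2 * ?d)"
    using mult_left_mono[OF J2, of "\<gamma>\<^sup>2 / 2"] by (simp add: abs_mult mult_ac)
  have "\<bar>- J1 + (f2 (Y u) - f2 (Y s)) / 2 * (Y t - Y s)\<^sup>2
       + f2 (Y s) / 2 * (b * ((Y t - Y s) + \<gamma> * w)) - \<gamma>\<^sup>2 / 2 * J2\<bar>
    \<le> \<eta> * F * ?d + \<eta> * (F\<^sup>2 * ?d\<^sup>2 + \<gamma>\<^sup>2 * w\<^sup>2) + \<eta> * (F\<^sup>2 * (1 + \<gamma>) / 2 * ?d) + \<eta> * (\<gamma>\<^sup>2 / 2 * ?d)"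
    using J1 t2 t3 t4 by linarith
  then show ?thesis unfolding id by (simp add: w_def algebra_simps)
qed

text \<open>
  Follmer's argument for Ito's formula without probability: beyond continuity, the driving path enters through
  a bound B for the sum of its squared increments.
\<close>

lemma Ito_remainder_vanishes:
  assumes e: "0 < e" and B: "0 \<le> B"
  shows "\<exists>\<delta>>0. \<forall>N \<Delta>. 0 < \<Delta> \<longrightarrow> \<Delta> < \<delta> \<longrightarrow> real N * \<Delta> = T \<longrightarrow>
    (\<Sum>i<N. (W (real (Suc i) * \<Delta>) - W (real i * \<Delta>))\<^sup>2) \<le> B \<longrightarrow>
    (\<Sum>i<N. \<bar>remainder (real i * \<Delta>) (real (Suc i) * \<Delta>)\<bar>) \<le> e"
proof -
  note c = continuous_along_path
  obtain F1 F2 where F1: "0 < F1" "\<forall>u\<in>{0..T}. \<bar>f (Y u)\<bar> \<le> F1"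
    and F2: "0 < F2" "\<forall>u\<in>{0..T}. \<bar>f2 (Y u)\<bar> \<le> F2"
    using continuous_Icc_bounded[OF c(1)] continuous_Icc_bounded[OF c(3)] by blast
  define F where "F = max F1 F2"
  define G where "G = F * T + F\<^sup>2 * T\<^sup>2 + \<gamma>\<^sup>2 * B + F\<^sup>2 * (1 + \<gamma>) / 2 * T + \<gamma>\<^sup>2 / 2 * T"
  have F0: "0 \<le> F" using F1 by (simp add: F_def)
  have G0: "0 \<le> G" using F0 T_pos B \<gamma>_nonneg by (simp add: G_def)
  \<comment> \<open>G bounds the sum over all steps of the factors that accompany the oscillation in the one-step estimate\<close>
  define \<eta> where "\<eta> = e / (G + 1)"
  have \<eta>0: "0 < \<eta>" using e G0 by (simp add: \<eta>_def)
  note mod = continuous_Icc_modulus[OF _ \<eta>0]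
  obtain d1 where d1: "d1 > 0" "\<forall>u\<in>{0..T}. \<forall>s\<in>{0..T}. \<bar>u - s\<bar> < d1 \<longrightarrow> \<bar>f1 (Y u) - f1 (Y s)\<bar> < \<eta>"
    using mod[OF c(2)] by blast
  obtain d2 where d2: "d2 > 0" "\<forall>u\<in>{0..T}. \<forall>s\<in>{0..T}. \<bar>u - s\<bar> < d2 \<longrightarrow> \<bar>f2 (Y u) - f2 (Y s)\<bar> < \<eta>"
    using mod[OF c(3)] by blast
  obtain d3 where d3: "d3 > 0" "\<forall>u\<in>{0..T}. \<forall>s\<in>{0..T}. \<bar>u - s\<bar> < d3 \<longrightarrow> \<bar>Y u - Y s\<bar> < \<eta>"
    using mod[OF Y_continuous] by blast
  obtain d4 where d4: "d4 > 0" "\<forall>u\<in>{0..T}. \<forall>s\<in>{0..T}. \<bar>u - s\<bar> < d4 \<longrightarrow> \<bar>W u - W s\<bar> < \<eta>"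
    using mod[OF W_continuous] by blast
  show ?thesis
  proof (intro exI[of _ "min (min d1 d2) (min d3 d4)"] conjI allI impI)
    show "0 < min (min d1 d2) (min d3 d4)" using d1 d2 d3 d4 by simp
    fix N :: nat and \<Delta> :: real
    assume \<Delta>: "0 < \<Delta>" "\<Delta> < min (min d1 d2) (min d3 d4)" and N: "real N * \<Delta> = T"
      and QV: "(\<Sum>i<N. (W (real (Suc i) * \<Delta>) - W (real i * \<Delta>))\<^sup>2) \<le> B"
    let ?q = "\<lambda>i. (W (real (Suc i) * \<Delta>) - W (real i * \<Delta>))\<^sup>2"
    have step: "\<bar>remainder (real i * \<Delta>) (real (Suc i) * \<Delta>)\<bar>
      \<le> \<eta> * (F * \<Delta> + F\<^sup>2 * \<Delta>\<^sup>2 + \<gamma>\<^sup>2 * ?q i + F\<^sup>2 * (1 + \<gamma>) / 2 * \<Delta> + \<gamma>\<^sup>2 / 2 * \<Delta>)" if i: "i < N" for i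
    proof -
      define s where "s = real i * \<Delta>"
      define t where "t = real (Suc i) * \<Delta>"
      have ts: "t - s = \<Delta>" by (simp add: s_def t_def algebra_simps)
      have s0: "0 \<le> s" using \<Delta> by (simp add: s_def)
      have "t \<le> real N * \<Delta>" unfolding t_def using i \<Delta> by (intro mult_right_mono) auto
      then have tT: "t \<le> T" using N by simp
      have st: "s \<le> t" using ts \<Delta> by simp
      have near: "u \<in> {0..T}" "\<bar>u - s\<bar> < min (min d1 d2) (min d3 d4)" if "u \<in> {s..t}" for u
        using that s0 tT \<Delta> ts by auto
      have s: "s \<in> {0..T}" using s0 st tT by auto
      have "\<bar>remainder s t\<bar> \<le> \<eta> * (F * (t - s) + F\<^sup>2 * (t - s)\<^sup>2 + \<gamma>\<^sup>2 * (W t - W s)\<^sup>2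
          + F\<^sup>2 * (1 + \<gamma>) / 2 * (t - s) + \<gamma>\<^sup>2 / 2 * (t - s))"
      proof (rule Ito_step[OF s0 st tT])
        show "\<bar>Y t - Y s\<bar> \<le> \<eta>" "\<bar>W t - W s\<bar> \<le> \<eta>"
          using d3(2)[THEN bspec, THEN bspec, of t s] d4(2)[THEN bspec, THEN bspec, of t s] near[of t] s st
          by auto
        fix u assume u: "u \<in> {s..t}"
        show "\<bar>f (Y u)\<bar> \<le> F" "\<bar>f2 (Y u)\<bar> \<le> F"
          using F1(2)[THEN bspec, of u] F2(2)[THEN bspec, of u] near[OF u] by (auto simp: F_def)
        show "\<bar>f1 (Y u) - f1 (Y s)\<bar> \<le> \<eta>" "\<bar>f2 (Y u) - f2 (Y s)\<bar> \<le> \<eta>"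
          using d1(2)[THEN bspec, THEN bspec, of u s] d2(2)[THEN bspec, THEN bspec, of u s] near[OF u] s
          by auto
      qed
      then show ?thesis unfolding ts unfolding s_def t_def .
    qed
    have "(\<Sum>i<N. \<bar>remainder (real i * \<Delta>) (real (Suc i) * \<Delta>)\<bar>)
      \<le> (\<Sum>i<N. \<eta> * (F * \<Delta> + F\<^sup>2 * \<Delta>\<^sup>2 + \<gamma>\<^sup>2 * ?q i + F\<^sup>2 * (1 + \<gamma>) / 2 * \<Delta> + \<gamma>\<^sup>2 / 2 * \<Delta>))"
      by (rule sum_mono) (use step in auto)
    also have "\<dots> = \<eta> * (F * (real N * \<Delta>) + F\<^sup>2 * (real N * \<Delta>) * \<Delta> + \<gamma>\<^sup>2 * (\<Sum>i<N. ?q i)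
        + F\<^sup>2 * (1 + \<gamma>) / 2 * (real N * \<Delta>) + \<gamma>\<^sup>2 / 2 * (real N * \<Delta>))"
    proof -
      have "(\<Sum>i<N. \<eta> * (a + b + \<gamma>\<^sup>2 * q i + c + g)) = \<eta> * (N * a + N * b + \<gamma>\<^sup>2 * (\<Sum>i<N. q i) + N * c + N * g)"
        for q :: "nat \<Rightarrow> real" and a b c g :: real
        by (simp add: sum_distrib_left[symmetric] sum.distrib) (simp add: distrib_left)
      then show ?thesis by (simp only:) (simp add: power2_eq_square mult_ac)
    qed
    also have "\<dots> \<le> \<eta> * G"
    proof -
      have "N \<noteq> 0" using N T_pos by (intro notI) simp
      then have "1 * \<Delta> \<le> real N * \<Delta>" using \<Delta> by (intro mult_right_mono) auto
      then have "\<Delta> \<le> T" using N by simp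
      then have "F\<^sup>2 * T * \<Delta> \<le> F\<^sup>2 * T\<^sup>2"
        unfolding power2_eq_square[of T] mult.assoc using T_pos by (intro mult_left_mono) auto
      moreover have "\<gamma>\<^sup>2 * (\<Sum>i<N. ?q i) \<le> \<gamma>\<^sup>2 * B" by (rule mult_left_mono[OF QV]) simp
      ultimately show ?thesis unfolding N G_def using \<eta>0 by (intro mult_left_mono) auto
    qed
    also have "\<dots> \<le> e" using e G0 by (simp add: \<eta>_def field_simps)
    finally show "(\<Sum>i<N. \<bar>remainder (real i * \<Delta>) (real (Suc i) * \<Delta>)\<bar>) \<le> e" .
  qed
qed

end

section \<open>Accumulated defects on refined grids\<close>

definition fine_step :: "real \<Rightarrow> nat \<Rightarrow> nat \<Rightarrow> real" where
  "fine_step T n m = T / (real n * 2 ^ m)"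

text \<open>
  At the i-th point of the refined grid this is the fraction of the current coarse interval that has elapsed, so
  T / n times the weight is the distance to the last coarse grid point.
\<close>

definition block_weight :: "nat \<Rightarrow> nat \<Rightarrow> real" where
  "block_weight m i = real (i mod 2 ^ m) / 2 ^ m"

lemma block_weight_bounds: "0 \<le> block_weight m i" "block_weight m i \<le> 1"
proof -
  have "i mod 2 ^ m \<le> 2 ^ m" by (simp add: less_imp_le)
  then have "real (i mod 2 ^ m) \<le> real (2 ^ m)" by (simp only: of_nat_le_iff)
  then show "block_weight m i \<le> 1" by (simp add: block_weight_def)
qed (simp add: block_weight_def)

lemma fine_step_pos: "0 < T \<Longrightarrow> 1 \<le> n \<Longrightarrow> 0 < fine_step T n m"
  by (simp add: fine_step_def)

lemma fine_step_total: "1 \<le> n \<Longrightarrow> real (n * 2 ^ m) * fine_step T n m = T"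
  by (simp add: fine_step_def)

lemma fine_step_tendsto_0: "fine_step T n \<longlonglongrightarrow> 0"
proof -
  have "(\<lambda>m. T / real n * (1 / 2) ^ m) \<longlonglongrightarrow> T / real n * 0"
    by (intro tendsto_mult_left LIMSEQ_power_zero) simp
  then show ?thesis by (simp add: fine_step_def[abs_def] power_divide)
qed

text \<open>
  Summation by parts: over one fine step starting at s the accumulated defect changes by (s - t_j) (g(s') - g(s)) plus the
  error of the right-endpoint rule over the step, which is at most \<eta> times its length.
\<close>

lemma weighted_increments_near_accumulated_defect:
  fixes f Y :: "real \<Rightarrow> real"
  defines "g \<equiv> \<lambda>u. f (Y u)"
  assumes T: "0 < T" and n: "1 \<le> n" and g: "continuous_on {0..T} g"
    and \<eta>: "\<And>u v. u \<in> {0..T} \<Longrightarrow> v \<in> {0..T} \<Longrightarrow> \<bar>u - v\<bar> \<le> fine_step T n m \<Longrightarrow> \<bar>g u - g v\<bar> \<le> \<eta>"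
    and j: "j < n" and r: "r \<le> 2 ^ m"
  shows "\<bar>(\<Sum>i<j * 2 ^ m + r. T / real n * block_weight m i *
            (g (real (Suc i) * fine_step T n m) - g (real i * fine_step T n m)))
          - accumulated_defect f Y T n j (grid_time T n j + real r * fine_step T n m)\<bar>
    \<le> real (j * 2 ^ m + r) * fine_step T n m * \<eta>"
proof -
  let ?\<Delta> = "fine_step T n m"
  let ?L = "\<lambda>k. \<Sum>i<k. T / real n * block_weight m i * (g (real (Suc i) * ?\<Delta>) - g (real i * ?\<Delta>))"
  have \<Delta>: "0 < ?\<Delta>" by (rule fine_step_pos[OF T n])
  have block: "2 ^ m * ?\<Delta> = T / real n" using n by (simp add: fine_step_def)
  have grid: "grid_time T n j = real (j * 2 ^ m) * ?\<Delta>" for j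
    using n by (simp add: fine_step_def grid_time_def)
  have inner: "\<bar>?L (j * 2 ^ m + r) - accumulated_defect f Y T n j (grid_time T n j + real r * ?\<Delta>)\<bar>
      \<le> real (j * 2 ^ m + r) * ?\<Delta> * \<eta>"
    if j: "j < n" and r: "r \<le> 2 ^ m"
      and base: "\<bar>?L (j * 2 ^ m) - accumulated_defect f Y T n j (grid_time T n j)\<bar> \<le> real (j * 2 ^ m) * ?\<Delta> * \<eta>"
    for j r
    using r
  proof (induction r)
    case 0
    then show ?case using base by simp
  next
    case (Suc r)
    define t0 where "t0 = grid_time T n j"
    define i where "i = j * 2 ^ m + r"
    define s where "s = real i * ?\<Delta>"
    define s' where "s' = real (Suc i) * ?\<Delta>"
    have s: "s = t0 + real r * ?\<Delta>" "s' = t0 + real (Suc r) * ?\<Delta>" "s' = s + ?\<Delta>"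
      by (simp_all add: s_def s'_def t0_def grid i_def algebra_simps)
    have t0: "0 \<le> t0" "t0 \<le> s" "s \<le> s'" using grid_time_nonneg[OF T, of n j] \<Delta> by (simp_all add: t0_def s)
    have "Suc i \<le> n * 2 ^ m"
    proof -
      have "Suc i \<le> Suc j * 2 ^ m" using Suc.prems by (simp add: i_def)
      also have "\<dots> \<le> n * 2 ^ m" using j by (intro mult_right_mono) auto
      finally show ?thesis .
    qed
    then have "s' \<le> real (n * 2 ^ m) * ?\<Delta>" unfolding s'_def using \<Delta> by (intro mult_right_mono) (simp_all only: of_nat_le_iff less_imp_le)
    then have s'T: "s' \<le> T" using fine_step_total[OF n] by simp
    have "i mod 2 ^ m = r" using Suc.prems by (simp add: i_def)
    then have wt: "T / real n * block_weight m i = s - t0"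
      by (simp add: block_weight_def s(1) fine_step_def)
    have int: "integral {t0..s'} g = integral {t0..s} g + integral {s..s'} g"
      by (rule integral_split_continuous) (use t0 s'T continuous_on_subset[OF g] in auto)
    have "\<bar>(s' - s) * g s' - integral {s..s'} g\<bar> \<le> (s' - s) * \<eta>"
    proof (rule rectangle_rule_error[OF t0(3)])
      show "continuous_on {s..s'} g" by (rule continuous_on_subset[OF g]) (use t0 s'T in auto)
      show "\<bar>g s' - g u\<bar> \<le> \<eta>" if "u \<in> {s..s'}" for u
        using that \<eta>[of s' u] t0 s'T s(3) by auto
    qed
    then have small: "\<bar>g s' * ?\<Delta> - integral {s..s'} g\<bar> \<le> ?\<Delta> * \<eta>"
      using s(3) by (simp add: mult.commute)
    have acc: "accumulated_defect f Y T n j s' - accumulated_defect f Y T n j s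
        = (s - t0) * (g s' - g s) + (g s' * ?\<Delta> - integral {s..s'} g)"
    proof -
      have "accumulated_defect f Y T n j s' - accumulated_defect f Y T n j s
        = ((s' - t0) * g s' - integral {t0..s'} g) - ((s - t0) * g s - integral {t0..s} g)"
        by (simp add: accumulated_defect_def local_defect_def t0_def g_def)
      also have "\<dots> = (s' - t0) * g s' - (s - t0) * g s - integral {s..s'} g" using int by simp
      also have "s' - t0 = (s - t0) + ?\<Delta>" using s(3) by simp
      finally show ?thesis by (simp add: algebra_simps)
    qed
    have L: "?L (Suc i) = ?L i + (s - t0) * (g s' - g s)"
      by (simp only: sum.lessThan_Suc wt s_def[symmetric] s'_def[symmetric])
    have IH: "\<bar>?L i - accumulated_defect f Y T n j s\<bar> \<le> real i * ?\<Delta> * \<eta>"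
      using Suc by (simp add: i_def s(1) t0_def)
    have "\<bar>?L (Suc i) - accumulated_defect f Y T n j s'\<bar> \<le> real i * ?\<Delta> * \<eta> + ?\<Delta> * \<eta>"
      using IH small acc L by linarith
    also have "\<dots> = real (Suc i) * ?\<Delta> * \<eta>" by (simp add: algebra_simps)
    finally show ?case by (simp only: i_def s(2) t0_def add_Suc_right)
  qed
  have base: "\<bar>?L (j * 2 ^ m) - accumulated_defect f Y T n j (grid_time T n j)\<bar> \<le> real (j * 2 ^ m) * ?\<Delta> * \<eta>"
    if "j < n" for j
    using that
  proof (induction j)
    case 0
    then show ?case by (simp add: accumulated_defect_def local_defect_def grid_time_0)
  next
    case (Suc j)
    have "grid_time T n j + real (2 ^ m) * ?\<Delta> = grid_time T n (Suc j)"
      using block by (simp add: grid_time_Suc)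
    then show ?case
      using inner[of j "2 ^ m"] Suc accumulated_defect_Suc[of f Y T n j] by (simp add: add.commute)
  qed
  show ?thesis by (rule inner[OF j r base[OF j]])
qed

context SDE_path
begin

text \<open>
  The weights are at most 1 and multiply T / n.  It is enough that the martingale transforms are bounded
  by x along infinitely many refinements, because every other term converges; this
  is what later allows the maximum of the transforms to be replaced by its lower limit.
\<close>

lemma accumulated_defect_bound:
  assumes n: "1 \<le> n"
  defines "s \<equiv> \<lambda>m i. real i * fine_step T n m"
  defines "\<xi> \<equiv> \<lambda>m i. W (s m (Suc i)) - W (s m i)"
  assumes QV: "eventually (\<lambda>m. (\<Sum>i<n * 2 ^ m. (\<xi> m i)\<^sup>2) \<le> B) sequentially"
    and Q: "\<And>\<epsilon>. 0 < \<epsilon> \<Longrightarrow> eventually (\<lambda>m. \<forall>k\<le>n * 2 ^ m.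
        \<bar>\<Sum>i<k. block_weight m i * f2 (Y (s m i)) * ((\<xi> m i)\<^sup>2 - fine_step T n m)\<bar> \<le> \<epsilon>) sequentially"
    and S: "frequently (\<lambda>m. \<forall>k\<le>n * 2 ^ m. \<bar>\<Sum>i<k. block_weight m i * f1 (Y (s m i)) * \<xi> m i\<bar> \<le> x) sequentially"
    and j: "j < n" and t: "t \<in> {grid_time T n j..grid_time T n (Suc j)}"
  shows "\<bar>accumulated_defect f Y T n j t\<bar>
    \<le> T / real n * (integral {0..T} (\<lambda>u. \<bar>generator u\<bar>) + \<gamma> * x)"
proof -
  note T = T_pos
  define h where "h = T / real n"
  have h: "0 < h" using T n by (simp add: h_def)
  define g where "g = (\<lambda>u. f (Y u))"
  define D where "D = integral {0..T} (\<lambda>u. \<bar>generator u\<bar>)"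
  let ?\<Delta> = "fine_step T n"
  have cf: "continuous_on {0..T} g" unfolding g_def by (rule continuous_along_path(1))
  note cl = continuous_along_path(4)
  let ?B = "{grid_time T n j..grid_time T n (Suc j)}"
  have sub: "?B \<subseteq> {0..T}" using grid_blocks_cover[OF T n] j by blast
  have cB: "continuous_on ?B g" by (rule continuous_on_subset[OF cf sub])
  then have cB': "continuous_on ?B (\<lambda>u. f (Y u))" by (simp only: g_def)
  have cacc: "continuous_on ?B (accumulated_defect f Y T n j)"
    unfolding accumulated_defect_def local_defect_def
    by (intro continuous_intros indefinite_integral_continuous_1 integrable_continuous_interval cB')
  have main: "\<bar>accumulated_defect f Y T n j t\<bar> \<le> h * (D + \<gamma> * x) + e * (1 + T + h * (\<gamma>\<^sup>2 / 2 + 1))"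
    if e: "0 < e" for e
  proof -
    \<comment> \<open>d1 controls the defect between t and the fine grid point before it, d2 the summation by parts, d3 the Ito remainder\<close>
    obtain d1 where d1: "d1 > 0" "\<And>t'. t' \<in> ?B \<Longrightarrow> dist t' t < d1 \<Longrightarrow>
        dist (accumulated_defect f Y T n j t') (accumulated_defect f Y T n j t) < e"
      using cacc e t unfolding continuous_on_iff by blast
    obtain d2 where d2: "d2 > 0" "\<forall>u\<in>{0..T}. \<forall>v\<in>{0..T}. \<bar>u - v\<bar> < d2 \<longrightarrow> \<bar>g u - g v\<bar> < e"
      using continuous_Icc_modulus[OF cf e] by blast
    obtain d3 where d3: "d3 > 0" "\<forall>N \<Delta>. 0 < \<Delta> \<longrightarrow> \<Delta> < d3 \<longrightarrow> real N * \<Delta> = T \<longrightarrow>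
      (\<Sum>i<N. (W (real (Suc i) * \<Delta>) - W (real i * \<Delta>))\<^sup>2) \<le> max B 0 \<longrightarrow>
      (\<Sum>i<N. \<bar>remainder (real i * \<Delta>) (real (Suc i) * \<Delta>)\<bar>) \<le> e"
      using Ito_remainder_vanishes[OF e, of "max B 0"] by auto
    have "eventually (\<lambda>m. ?\<Delta> m < min d1 (min d2 d3)) sequentially"
      using fine_step_tendsto_0[of T n] d1(1) d2(1) d3(1) by (intro order_tendstoD) auto
    with QV Q[OF e]
    have ev: "eventually (\<lambda>m. ?\<Delta> m < min d1 (min d2 d3) \<and> (\<Sum>i<n * 2 ^ m. (\<xi> m i)\<^sup>2) \<le> B \<and>
       (\<forall>k\<le>n * 2 ^ m. \<bar>\<Sum>i<k. block_weight m i * f2 (Y (s m i)) * ((\<xi> m i)\<^sup>2 - ?\<Delta> m)\<bar> \<le> e)) sequentially"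
      by eventually_elim auto
    obtain m where m: "?\<Delta> m < min d1 (min d2 d3)" "(\<Sum>i<n * 2 ^ m. (\<xi> m i)\<^sup>2) \<le> B"
       "\<And>k. k \<le> n * 2 ^ m \<Longrightarrow> \<bar>\<Sum>i<k. block_weight m i * f2 (Y (s m i)) * ((\<xi> m i)\<^sup>2 - ?\<Delta> m)\<bar> \<le> e"
       "\<And>k. k \<le> n * 2 ^ m \<Longrightarrow> \<bar>\<Sum>i<k. block_weight m i * f1 (Y (s m i)) * \<xi> m i\<bar> \<le> x"
      using frequently_ex[OF frequently_eventually_frequently[OF S ev]] by auto
    define N where "N = n * 2 ^ m"
    define \<Delta> where "\<Delta> = ?\<Delta> m"
    have \<Delta>: "0 < \<Delta>" "real N * \<Delta> = T" unfolding \<Delta>_def N_def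
      using fine_step_pos[OF T n] fine_step_total[OF n] by auto
    define J where "J i = integral {s m i..s m (Suc i)} generator" for i
    define rem where "rem i = remainder (s m i) (s m (Suc i))" for i
    have rem: "(\<Sum>i<N. \<bar>rem i\<bar>) \<le> e"
      unfolding rem_def s_def \<Delta>_def[symmetric]
      using d3(2)[rule_format, of \<Delta> N] \<Delta> m(1,2) by (simp add: s_def \<xi>_def N_def \<Delta>_def)
    have lengths: "s m (Suc i) - s m i = \<Delta>" for i by (simp add: s_def \<Delta>_def algebra_simps)
    have smono: "s m i \<le> s m k" if "i \<le> k" for i k
      using that \<Delta>(1) by (simp add: s_def \<Delta>_def mult_right_mono)
    have sT: "s m i \<in> {0..T}" if "i \<le> N" for i
      using smono[of 0 i] smono[OF that] \<Delta>(2) by (simp add: s_def \<Delta>_def)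
    have intJ: "(\<Sum>i<k. integral {s m i..s m (Suc i)} (\<lambda>u. \<bar>generator u\<bar>)) = integral {0..s m k} (\<lambda>u. \<bar>generator u\<bar>)" if "k \<le> N" for k
      using that
    proof (induction k)
      case (Suc k)
      have "integral {0..s m (Suc k)} (\<lambda>u. \<bar>generator u\<bar>)
          = integral {0..s m k} (\<lambda>u. \<bar>generator u\<bar>) + integral {s m k..s m (Suc k)} (\<lambda>u. \<bar>generator u\<bar>)"
        by (rule integral_split_continuous)
           (use sT[of k] sT[of "Suc k"] smono[of k "Suc k"] Suc.prems in
             \<open>auto intro!: continuous_intros continuous_on_subset[OF cl]\<close>)
      then show ?case using Suc by simp
    qed (simp add: s_def)
    have Jbound: "\<bar>J i\<bar> \<le> integral {s m i..s m (Suc i)} (\<lambda>u. \<bar>generator u\<bar>)" if "i < N" for i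
    proof -
      have c: "continuous_on {s m i..s m (Suc i)} generator"
        by (rule continuous_on_subset[OF cl]) (use sT[of i] sT[of "Suc i"] that in auto)
      show ?thesis unfolding J_def
        using integral_norm_bound_integral[of generator "{s m i..s m (Suc i)}" "\<lambda>u. \<bar>generator u\<bar>"] c
        by (auto intro!: integrable_continuous_interval continuous_intros)
    qed
    have L: "\<bar>\<Sum>i<k. h * block_weight m i * (g (s m (Suc i)) - g (s m i))\<bar>
        \<le> h * (D + \<gamma> * x + \<gamma>\<^sup>2 / 2 * e + e)" if k: "k \<le> N" for k
    proof -
      let ?w = "block_weight m"
      have split: "(\<Sum>i<k. h * ?w i * (g (s m (Suc i)) - g (s m i)))
        = h * ((\<Sum>i<k. ?w i * J i) + \<gamma> * (\<Sum>i<k. ?w i * f1 (Y (s m i)) * \<xi> m i)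
          + \<gamma>\<^sup>2 / 2 * (\<Sum>i<k. ?w i * f2 (Y (s m i)) * ((\<xi> m i)\<^sup>2 - \<Delta>)) + (\<Sum>i<k. ?w i * rem i))"
      proof -
        have "h * ?w i * (g (s m (Suc i)) - g (s m i)) = h * (?w i * J i + \<gamma> * (?w i * f1 (Y (s m i)) * \<xi> m i)
          + \<gamma>\<^sup>2 / 2 * (?w i * f2 (Y (s m i)) * ((\<xi> m i)\<^sup>2 - \<Delta>)) + ?w i * rem i)" for i
          unfolding rem_def remainder_def lengths J_def g_def \<xi>_def by (simp add: field_simps)
        then show ?thesis by (simp only: sum.distrib sum_distrib_left[symmetric])
      qed
      have "\<bar>\<Sum>i<k. ?w i * J i\<bar> \<le> (\<Sum>i<k. integral {s m i..s m (Suc i)} (\<lambda>u. \<bar>generator u\<bar>))"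
      proof (rule order_trans[OF sum_abs], rule sum_mono)
        fix i assume "i \<in> {..<k}"
        then have "\<bar>J i\<bar> \<le> integral {s m i..s m (Suc i)} (\<lambda>u. \<bar>generator u\<bar>)" using k by (intro Jbound) auto
        moreover have "?w i * \<bar>J i\<bar> \<le> 1 * \<bar>J i\<bar>" using block_weight_bounds by (intro mult_right_mono) auto
        ultimately show "\<bar>?w i * J i\<bar> \<le> integral {s m i..s m (Suc i)} (\<lambda>u. \<bar>generator u\<bar>)"
          using block_weight_bounds(1)[of m i] by (simp add: abs_mult)
      qed
      also have "\<dots> = integral {0..s m k} (\<lambda>u. \<bar>generator u\<bar>)" by (rule intJ[OF k])
      also have "\<dots> \<le> D"
        unfolding D_def
        by (rule integral_subset_le)
           (use sT[OF k] in \<open>auto intro!: integrable_continuous_interval continuous_intros continuous_on_subset[OF cl]\<close>)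
      finally have 1: "\<bar>\<Sum>i<k. ?w i * J i\<bar> \<le> D" .
      have 2: "\<bar>\<gamma> * (\<Sum>i<k. ?w i * f1 (Y (s m i)) * \<xi> m i)\<bar> \<le> \<gamma> * x"
        using m(4)[of k] k \<gamma>_nonneg by (simp add: abs_mult mult_left_mono N_def)
      have 3: "\<bar>\<gamma>\<^sup>2 / 2 * (\<Sum>i<k. ?w i * f2 (Y (s m i)) * ((\<xi> m i)\<^sup>2 - \<Delta>))\<bar> \<le> \<gamma>\<^sup>2 / 2 * e"
        unfolding abs_mult using m(3)[of k] k by (simp add: mult_left_mono N_def \<Delta>_def)
      have "\<bar>\<Sum>i<k. ?w i * rem i\<bar> \<le> (\<Sum>i<k. \<bar>rem i\<bar>)"
      proof (rule order_trans[OF sum_abs], rule sum_mono)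
        fix i
        have "?w i * \<bar>rem i\<bar> \<le> 1 * \<bar>rem i\<bar>" using block_weight_bounds by (intro mult_right_mono) auto
        then show "\<bar>?w i * rem i\<bar> \<le> \<bar>rem i\<bar>"
          using block_weight_bounds(1)[of m i] by (simp add: abs_mult)
      qed
      also have "\<dots> \<le> (\<Sum>i<N. \<bar>rem i\<bar>)" by (rule sum_mono2) (use k in auto)
      finally have 4: "\<bar>\<Sum>i<k. ?w i * rem i\<bar> \<le> e" using rem by linarith
      show ?thesis
        unfolding split abs_mult[of h] using 1 2 3 4 h by (simp add: mult_left_mono)
    qed
    \<comment> \<open>the last fine grid point in the block that is not after t\<close>
    define r where "r = nat \<lfloor>(t - grid_time T n j) / \<Delta>\<rfloor>"
    have q0: "0 \<le> (t - grid_time T n j) / \<Delta>" using t \<Delta> by simp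
    then have r1: "real r \<le> (t - grid_time T n j) / \<Delta>" "(t - grid_time T n j) / \<Delta> < real r + 1"
      unfolding r_def by linarith+
    have r2: "real r * \<Delta> \<le> t - grid_time T n j" "t - grid_time T n j < real r * \<Delta> + \<Delta>"
      using r1 \<Delta>(1) by (simp_all add: field_simps)
    have "real r * \<Delta> \<le> real (2 ^ m) * \<Delta>"
    proof -
      have "t - grid_time T n j \<le> T / real n" using t by (simp add: grid_time_Suc)
      also have "T / real n = real (2 ^ m) * \<Delta>" using n by (simp add: \<Delta>_def fine_step_def)
      finally show ?thesis using r2 by linarith
    qed
    then have r: "r \<le> 2 ^ m" using \<Delta>(1) by (simp only: mult_le_cancel_right_pos of_nat_le_iff)
    let ?k = "j * 2 ^ m + r"
    have kN: "?k \<le> N"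
    proof -
      have "?k \<le> Suc j * 2 ^ m" using r by simp
      also have "\<dots> \<le> n * 2 ^ m" using j by (intro mult_right_mono) auto
      finally show ?thesis by (simp add: N_def)
    qed
    let ?t = "grid_time T n j + real r * \<Delta>"
    have tB: "?t \<in> ?B" using r2 t \<Delta>(1) by auto
    have "dist ?t t < d1" using r2 m(1) \<Delta>(1) by (simp add: dist_real_def \<Delta>_def)
    from d1(2)[OF tB this]
    have a1: "\<bar>accumulated_defect f Y T n j ?t - accumulated_defect f Y T n j t\<bar> < e" by (simp add: dist_real_def)
    have a2: "\<bar>(\<Sum>i<?k. h * block_weight m i * (g (s m (Suc i)) - g (s m i)))
        - accumulated_defect f Y T n j ?t\<bar> \<le> real ?k * \<Delta> * e"
      unfolding s_def h_def \<Delta>_def g_def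
    proof (rule weighted_increments_near_accumulated_defect[OF T n _ _ j r])
      fix u v assume "u \<in> {0..T}" "v \<in> {0..T}" "\<bar>u - v\<bar> \<le> fine_step T n m"
      then show "\<bar>f (Y u) - f (Y v)\<bar> \<le> e"
        using d2(2)[THEN bspec, THEN bspec, of u v] m(1) by (simp add: g_def)
    qed (use cf in \<open>simp add: g_def\<close>)
    have "real ?k * \<Delta> \<le> real N * \<Delta>" using kN \<Delta>(1) by (intro mult_right_mono) (simp_all only: of_nat_le_iff less_imp_le)
    then have a3: "real ?k * \<Delta> * e \<le> T * e" using \<Delta>(2) e by (intro mult_right_mono) auto
    have "\<bar>accumulated_defect f Y T n j t\<bar> \<le> h * (D + \<gamma> * x + \<gamma>\<^sup>2 / 2 * e + e) + T * e + e"
      using a1 a2 a3 L[OF kN] by linarith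
    then show ?thesis by (simp add: algebra_simps)
  qed
  define K where "K = 1 + T + h * (\<gamma>\<^sup>2 / 2 + 1)"
  have K: "0 < K" using T h by (simp add: K_def add_pos_nonneg)
  have "\<bar>accumulated_defect f Y T n j t\<bar> \<le> h * (D + \<gamma> * x)"
  proof (rule field_le_epsilon)
    fix e :: real assume "0 < e"
    then show "\<bar>accumulated_defect f Y T n j t\<bar> \<le> h * (D + \<gamma> * x) + e"
      using main[of "e / K"] K by (simp add: K_def[symmetric])
  qed
  then show ?thesis by (simp add: h_def D_def)
qed

end

section \<open>Passage to the limit in the refinement\<close>

lemma Riemann_sums_tendsto_integral:
  fixes g :: "real \<Rightarrow> real"
  assumes T: "0 < T" and n: "1 \<le> n" and g: "continuous_on {0..T} g"
  shows "(\<lambda>m. \<Sum>i<n * 2 ^ m. g (real i * fine_step T n m) * fine_step T n m) \<longlonglongrightarrow> integral {0..T} g"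
  unfolding lim_sequentially
proof (intro allI impI)
  fix e :: real assume e: "0 < e"
  define \<eta> where "\<eta> = e / (2 * T)"
  have \<eta>: "0 < \<eta>" using e T by (simp add: \<eta>_def)
  obtain d where d: "d > 0" "\<forall>u\<in>{0..T}. \<forall>v\<in>{0..T}. \<bar>u - v\<bar> < d \<longrightarrow> \<bar>g u - g v\<bar> < \<eta>"
    using continuous_Icc_modulus[OF g \<eta>] by blast
  have "eventually (\<lambda>m. fine_step T n m < d) sequentially"
    using fine_step_tendsto_0[of T n] d(1) by (intro order_tendstoD) auto
  then obtain m0 where m0: "\<And>m. m \<ge> m0 \<Longrightarrow> fine_step T n m < d" by (auto simp: eventually_sequentially)
  show "\<exists>no. \<forall>m\<ge>no. dist (\<Sum>i<n * 2 ^ m. g (real i * fine_step T n m) * fine_step T n m) (integral {0..T} g) < e"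
  proof (intro exI allI impI)
    fix m assume "m \<ge> m0"
    define \<Delta> where "\<Delta> = fine_step T n m"
    have \<Delta>: "0 < \<Delta>" "\<Delta> < d" "real (n * 2 ^ m) * \<Delta> = T"
      using fine_step_pos[OF T n] m0[OF \<open>m \<ge> m0\<close>] fine_step_total[OF n] by (auto simp: \<Delta>_def)
    have "\<bar>(\<Sum>i<k. g (real i * \<Delta>) * \<Delta>) - integral {0..real k * \<Delta>} g\<bar> \<le> real k * \<Delta> * \<eta>" if "k \<le> n * 2 ^ m" for k
      using that
    proof (induction k)
      case (Suc k)
      let ?s = "real k * \<Delta>" and ?t = "real (Suc k) * \<Delta>"
      have st: "0 \<le> ?s" "?s \<le> ?t" "?t - ?s = \<Delta>" using \<Delta> by (auto simp: algebra_simps)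
      have "?t \<le> real (n * 2 ^ m) * \<Delta>" using Suc.prems \<Delta>(1) by (intro mult_right_mono) (simp_all only: of_nat_le_iff less_imp_le)
      then have tT: "?t \<le> T" by (simp only: \<Delta>(3))
      have int: "integral {0..?t} g = integral {0..?s} g + integral {?s..?t} g"
        by (rule integral_split_continuous) (use st tT continuous_on_subset[OF g] in auto)
      have "\<bar>(?t - ?s) * g ?s - integral {?s..?t} g\<bar> \<le> (?t - ?s) * \<eta>"
      proof (rule rectangle_rule_error[OF st(2)])
        show "continuous_on {?s..?t} g" by (rule continuous_on_subset[OF g]) (use st(1) tT in auto)
        fix u assume u: "u \<in> {?s..?t}"
        then have "\<bar>?s - u\<bar> < d" using st(3) \<Delta> by simp
        moreover have "?s \<in> {0..T}" "u \<in> {0..T}"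
          using u st(1,2) tT by (auto simp del: of_nat_Suc)
        ultimately show "\<bar>g ?s - g u\<bar> \<le> \<eta>" using d(2) less_imp_le by blast
      qed
      then have small: "\<bar>g ?s * \<Delta> - integral {?s..?t} g\<bar> \<le> \<Delta> * \<eta>"
        unfolding st(3) by (simp add: mult.commute)
      have "(\<Sum>i<Suc k. g (real i * \<Delta>) * \<Delta>) = (\<Sum>i<k. g (real i * \<Delta>) * \<Delta>) + g ?s * \<Delta>" by simp
      then have "\<bar>(\<Sum>i<Suc k. g (real i * \<Delta>) * \<Delta>) - integral {0..?t} g\<bar> \<le> ?s * \<eta> + \<Delta> * \<eta>"
        using Suc small int by linarith
      also have "\<dots> = ?t * \<eta>" by (simp add: algebra_simps)
      finally show ?case .
    qed simp
    from this[of "n * 2 ^ m"] have "\<bar>(\<Sum>i<n * 2 ^ m. g (real i * \<Delta>) * \<Delta>) - integral {0..T} g\<bar> \<le> T * \<eta>"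
      unfolding \<Delta>(3) by simp
    also have "\<dots> < e" using e T by (simp add: \<eta>_def)
    finally show "dist (\<Sum>i<n * 2 ^ m. g (real i * fine_step T n m) * fine_step T n m) (integral {0..T} g) < e"
      by (simp add: dist_real_def \<Delta>_def)
  qed
qed

text \<open>
  The variance of the sums is of the order of the mesh, which is summable along dyadic refinements, so that the maximal
  inequality and the Borel-Cantelli lemma apply.  The weights are bounded along every path
  but not uniformly, so they are cut off at integer levels C; a given path does not notice the cut-off for large C.
\<close>

lemma (in prob_space) weighted_squared_increments_vanish:
  fixes W :: "real \<Rightarrow> 'a \<Rightarrow> real" and c :: "nat \<Rightarrow> nat \<Rightarrow> 'a \<Rightarrow> real"
  assumes W: "standard_brownian_motion M W" and T: "0 < T" and n: "1 \<le> n"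
    and c: "\<And>m i. c m i \<in> borel_measurable (augmented_filtration M W (real i * fine_step T n m))"
    and bdd: "\<And>\<omega>. \<omega> \<in> space M \<Longrightarrow> \<exists>C. \<forall>m. \<forall>i<n * 2 ^ m. \<bar>c m i \<omega>\<bar> \<le> C"
  shows "AE \<omega> in M. \<forall>\<epsilon>>0. eventually (\<lambda>m. \<forall>k\<le>n * 2 ^ m.
     \<bar>\<Sum>i<k. c m i \<omega> * ((W (real (Suc i) * fine_step T n m) \<omega> - W (real i * fine_step T n m) \<omega>)\<^sup>2
        - fine_step T n m)\<bar> \<le> \<epsilon>) sequentially"
proof -
  let ?\<Delta> = "fine_step T n"
  let ?\<zeta> = "\<lambda>m i \<omega>. (W (real (Suc i) * ?\<Delta> m) \<omega> - W (real i * ?\<Delta> m) \<omega>)\<^sup>2 - ?\<Delta> m"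
  define b where "b C m i \<omega> = (if \<bar>c m i \<omega>\<bar> \<le> real C then c m i \<omega> else 0)" for C m i \<omega>
  have key: "AE \<omega> in M. eventually (\<lambda>m. \<forall>k\<le>n * 2 ^ m.
      \<bar>\<Sum>i<k. b C m i \<omega> * ?\<zeta> m i \<omega>\<bar> \<le> 1 / real (Suc l)) sequentially" for C l
  proof -
    let ?e = "1 / real (Suc l)"
    let ?A = "\<lambda>m. {\<omega> \<in> space M. \<exists>k\<in>{..n * 2 ^ m}. \<bar>\<Sum>i<k. b C m i \<omega> * ?\<zeta> m i \<omega>\<bar> > ?e}"
    have A: "?A m \<in> events \<and> prob (?A m) \<le> ((real C)\<^sup>2 * 2 * T / ?e\<^sup>2) * (T / real n) * (1 / 2) ^ m" for m
    proof -
      interpret Q: predictable_innovations M "\<lambda>i. augmented_filtration M W (real i * ?\<Delta> m)" "?\<zeta> m" "2 * (?\<Delta> m)\<^sup>2"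
        by (rule brownian_innovations(2)[OF W fine_step_pos[OF T n]])
      have bF: "b C m i \<in> borel_measurable (augmented_filtration M W (real i * ?\<Delta> m))" for i
      proof -
        note [measurable] = c[of m i]
        show ?thesis unfolding b_def by measurable
      qed
      have [measurable]: "(\<lambda>\<omega>. \<Sum>i<k. b C m i \<omega> * ?\<zeta> m i \<omega>) \<in> borel_measurable M" for k
        using Q.F_le[OF Q.weighted_sum_adapted[OF bF order_refl]] .
      have "prob (?A m) \<le> (real C)\<^sup>2 * (2 * (?\<Delta> m)\<^sup>2) * real (n * 2 ^ m) / ?e\<^sup>2"
        by (rule Q.maximal_inequality[OF bF]) (auto simp: b_def)
      also have "\<dots> = ((real C)\<^sup>2 * 2 * T / ?e\<^sup>2) * ?\<Delta> m"
        using fine_step_total[OF n, of m T] by (simp add: power2_eq_square mult_ac)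
      also have "\<dots> = ((real C)\<^sup>2 * 2 * T / ?e\<^sup>2) * (T / real n) * (1 / 2) ^ m"
        by (simp add: fine_step_def power_divide)
      finally have "prob (?A m) \<le> ((real C)\<^sup>2 * 2 * T / ?e\<^sup>2) * (T / real n) * (1 / 2) ^ m" .
      moreover have "?A m \<in> events" by measurable
      ultimately show ?thesis by blast
    qed
    have "AE \<omega> in M. eventually (\<lambda>m. \<omega> \<in> space M - ?A m) sequentially"
    proof (rule borel_cantelli_AE1)
      show "summable (\<lambda>m. prob (?A m))"
      proof (rule summable_comparison_test')
        show "summable (\<lambda>m. ((real C)\<^sup>2 * 2 * T / ?e\<^sup>2) * (T / real n) * (1 / 2) ^ m)"
          by (intro summable_mult summable_geometric) simp
        show "norm (prob (?A m)) \<le> ((real C)\<^sup>2 * 2 * T / ?e\<^sup>2) * (T / real n) * (1 / 2) ^ m" for m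
          using A[of m] by (simp only: real_norm_def abs_of_nonneg measure_nonneg)
      qed
    qed (use A in \<open>auto simp: emeasure_eq_measure\<close>)
    then show ?thesis
      by (rule AE_mp) (auto intro!: AE_I2 elim!: eventually_mono simp: not_less)
  qed
  have "AE \<omega> in M. \<forall>C l. eventually (\<lambda>m. \<forall>k\<le>n * 2 ^ m.
      \<bar>\<Sum>i<k. b C m i \<omega> * ?\<zeta> m i \<omega>\<bar> \<le> 1 / real (Suc l)) sequentially"
    unfolding AE_all_countable by (intro allI key)
  then show ?thesis
  proof (rule AE_mp, intro AE_I2 impI allI)
    fix \<omega> and \<epsilon> :: real
    assume \<omega>: "\<omega> \<in> space M" and \<epsilon>: "0 < \<epsilon>"
      and all: "\<forall>C l. eventually (\<lambda>m. \<forall>k\<le>n * 2 ^ m. \<bar>\<Sum>i<k. b C m i \<omega> * ?\<zeta> m i \<omega>\<bar> \<le> 1 / real (Suc l)) sequentially"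
    obtain C0 where C0: "\<And>m i. i < n * 2 ^ m \<Longrightarrow> \<bar>c m i \<omega>\<bar> \<le> C0" using bdd[OF \<omega>] by blast
    obtain C :: nat where C: "C0 \<le> real C" using real_arch_simple by blast
    obtain l where l: "1 / real (Suc l) < \<epsilon>" using nat_approx_posE[OF \<epsilon>] by (metis of_nat_Suc)
    have eq: "b C m i \<omega> = c m i \<omega>" if "i < n * 2 ^ m" for m i
      using C0[OF that] C by (simp add: b_def)
    show "eventually (\<lambda>m. \<forall>k\<le>n * 2 ^ m. \<bar>\<Sum>i<k. c m i \<omega> * ?\<zeta> m i \<omega>\<bar> \<le> \<epsilon>) sequentially"
      using all[rule_format, of C l]
    proof eventually_elim
      case (elim m)
      show ?case
      proof (intro allI impI)
        fix k assume k: "k \<le> n * 2 ^ m"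
        have "(\<Sum>i<k. c m i \<omega> * ?\<zeta> m i \<omega>) = (\<Sum>i<k. b C m i \<omega> * ?\<zeta> m i \<omega>)"
          by (rule sum.cong) (use k eq in auto)
        then show "\<bar>\<Sum>i<k. c m i \<omega> * ?\<zeta> m i \<omega>\<bar> \<le> \<epsilon>" using elim k l by force
      qed
    qed
  qed
qed

lemma (in prob_space) integrable_from_truncations:
  fixes Z :: "'a \<Rightarrow> real"
  assumes [measurable]: "Z \<in> borel_measurable M" and Z: "\<And>\<omega>. \<omega> \<in> space M \<Longrightarrow> 0 \<le> Z \<omega>" and K: "0 \<le> K"
    and trunc: "\<And>L. 0 < L \<Longrightarrow> expectation (\<lambda>\<omega>. min (Z \<omega>) L) \<le> K"
  shows "integrable M Z" "expectation Z \<le> K"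
proof -
  have E: "(\<integral>\<^sup>+\<omega>. ennreal (min (Z \<omega>) (real (Suc k))) \<partial>M) \<le> ennreal K" for k
  proof -
    have "(\<integral>\<^sup>+\<omega>. ennreal (min (Z \<omega>) (real (Suc k))) \<partial>M) = ennreal (expectation (\<lambda>\<omega>. min (Z \<omega>) (real (Suc k))))"
      by (rule nn_integral_eq_integral) (use Z in \<open>auto intro!: integrable_const_bound[where B = "real (Suc k)"]\<close>)
    also have "\<dots> \<le> ennreal K" by (intro ennreal_leI trunc) simp
    finally show ?thesis .
  qed
  have "(\<integral>\<^sup>+\<omega>. ennreal (Z \<omega>) \<partial>M) = (\<integral>\<^sup>+\<omega>. (SUP k. ennreal (min (Z \<omega>) (real (Suc k)))) \<partial>M)"
  proof (rule nn_integral_cong)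
    fix \<omega>
    show "ennreal (Z \<omega>) = (SUP k. ennreal (min (Z \<omega>) (real (Suc k))))"
    proof (rule antisym)
      obtain k where "Z \<omega> \<le> real k" using real_arch_simple by blast
      then have "min (Z \<omega>) (real (Suc k)) = Z \<omega>" by simp
      then show "ennreal (Z \<omega>) \<le> (SUP k. ennreal (min (Z \<omega>) (real (Suc k))))"
        by (metis SUP_upper UNIV_I)
    qed (auto intro!: SUP_least ennreal_leI)
  qed
  also have "\<dots> = (SUP k. \<integral>\<^sup>+\<omega>. ennreal (min (Z \<omega>) (real (Suc k))) \<partial>M)"
    by (rule nn_integral_monotone_convergence_SUP) (auto intro!: incseq_SucI le_funI ennreal_leI)
  also have "\<dots> \<le> ennreal K" by (rule SUP_least) (rule E)
  finally have le: "(\<integral>\<^sup>+\<omega>. ennreal (Z \<omega>) \<partial>M) \<le> ennreal K" .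
  show int: "integrable M Z"
    by (rule integrableI_nonneg) (use Z le in \<open>auto intro: le_less_trans\<close>)
  show "expectation Z \<le> K"
    using le K nn_integral_eq_integral[OF int] Z by (simp add: ennreal_le_iff)
qed

text \<open>
  Z is at most the lower limit of the S m.  Hence the truncated p-th powers of min Z (S m) converge to those of Z, while
  they are dominated by those of S m, to which the inequality applies.
\<close>

lemma (in prob_space) moment_bound_in_the_limit:
  fixes S V D :: "nat \<Rightarrow> 'a \<Rightarrow> real" and Z G :: "'a \<Rightarrow> real"
  assumes p: "0 < p" and C: "0 \<le> C"
    and [measurable]: "\<And>m. S m \<in> borel_measurable M" "\<And>m. V m \<in> borel_measurable M"
      "\<And>m. D m \<in> borel_measurable M" "Z \<in> borel_measurable M"
    and nonneg: "\<And>m \<omega>. \<omega> \<in> space M \<Longrightarrow> 0 \<le> S m \<omega>" "\<And>m \<omega>. \<omega> \<in> space M \<Longrightarrow> 0 \<le> D m \<omega>"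
      "\<And>\<omega>. \<omega> \<in> space M \<Longrightarrow> 0 \<le> Z \<omega>" "\<And>\<omega>. \<omega> \<in> space M \<Longrightarrow> 0 \<le> G \<omega>"
    and G: "integrable M G"
    and ineq: "\<And>m L. 0 < L \<Longrightarrow> expectation (\<lambda>\<omega>. min (S m \<omega> powr p) L)
      \<le> C * (expectation (\<lambda>\<omega>. min (V m \<omega> powr p) L) + expectation (\<lambda>\<omega>. min (D m \<omega> powr p) L))"
    and V: "AE \<omega> in M. (\<lambda>m. V m \<omega> powr p) \<longlonglongrightarrow> G \<omega>" and D: "AE \<omega> in M. (\<lambda>m. D m \<omega>) \<longlonglongrightarrow> 0"
    and Z: "AE \<omega> in M. \<forall>x. x < Z \<omega> \<longrightarrow> eventually (\<lambda>m. x < S m \<omega>) sequentially"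
  shows "integrable M (\<lambda>\<omega>. Z \<omega> powr p)" "expectation (\<lambda>\<omega>. Z \<omega> powr p) \<le> C * expectation G"
proof -
  have [measurable]: "G \<in> borel_measurable M" using G by simp
  have EG: "0 \<le> expectation G" by (rule Bochner_Integration.integral_nonneg) (use nonneg in auto)
  have main: "expectation (\<lambda>\<omega>. min (Z \<omega> powr p) L) \<le> C * expectation G" if L: "0 < L" for L
  proof -
    have bd: "integrable M (\<lambda>\<omega>. min (X \<omega> powr p) L)" if [measurable]: "X \<in> borel_measurable M" for X
      by (rule integrable_const_bound[where B = L]) (use L in auto)
    let ?U = "\<lambda>m \<omega>. min (min (Z \<omega>) (S m \<omega>) powr p) L"
    have 1: "(\<lambda>m. expectation (?U m)) \<longlonglongrightarrow> expectation (\<lambda>\<omega>. min (Z \<omega> powr p) L)"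
    proof (rule integral_dominated_convergence[where w = "\<lambda>_. L"])
      show "AE \<omega> in M. (\<lambda>m. ?U m \<omega>) \<longlonglongrightarrow> min (Z \<omega> powr p) L"
        using Z AE_space
      proof eventually_elim
        case (elim \<omega>)
        have "(\<lambda>m. min (Z \<omega>) (S m \<omega>)) \<longlonglongrightarrow> Z \<omega>"
        proof (rule order_tendstoI)
          fix x assume "x < Z \<omega>"
          then have "eventually (\<lambda>m. x < S m \<omega>) sequentially" using elim by blast
          then show "eventually (\<lambda>m. x < min (Z \<omega>) (S m \<omega>)) sequentially"
            using \<open>x < Z \<omega>\<close> by (auto elim: eventually_mono)
        qed (auto intro!: always_eventually simp: min_less_iff_disj)
        then show ?case
          using p nonneg(1,3) elim by (intro tendsto_intros) (auto intro!: always_eventually)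
      qed
    qed (use L in auto)
    have 2: "(\<lambda>m. expectation (\<lambda>\<omega>. min (V m \<omega> powr p) L)) \<longlonglongrightarrow> expectation (\<lambda>\<omega>. min (G \<omega>) L)"
    proof (rule integral_dominated_convergence[where w = "\<lambda>_. L"])
      show "AE \<omega> in M. (\<lambda>m. min (V m \<omega> powr p) L) \<longlonglongrightarrow> min (G \<omega>) L"
        using V by eventually_elim (intro tendsto_intros)
    qed (use L in auto)
    have 3: "(\<lambda>m. expectation (\<lambda>\<omega>. min (D m \<omega> powr p) L)) \<longlonglongrightarrow> expectation (\<lambda>\<omega>. min (0 powr p) L)"
    proof (rule integral_dominated_convergence[where w = "\<lambda>_. L"])
      show "AE \<omega> in M. (\<lambda>m. min (D m \<omega> powr p) L) \<longlonglongrightarrow> min (0 powr p) L"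
        using D AE_space
        by eventually_elim (use p nonneg(2) in \<open>auto intro!: tendsto_intros always_eventually simp del: powr_0\<close>)
    qed (use L in auto)
    have "expectation (?U m) \<le> C * (expectation (\<lambda>\<omega>. min (V m \<omega> powr p) L) + expectation (\<lambda>\<omega>. min (D m \<omega> powr p) L))" for m
    proof -
      have "expectation (?U m) \<le> expectation (\<lambda>\<omega>. min (S m \<omega> powr p) L)"
      proof (rule integral_mono)
        fix \<omega> assume \<omega>: "\<omega> \<in> space M"
        have "min (Z \<omega>) (S m \<omega>) powr p \<le> S m \<omega> powr p"
          by (rule powr_mono2) (use p nonneg[OF \<omega>] in auto)
        then show "?U m \<omega> \<le> min (S m \<omega> powr p) L" by auto
      qed (auto intro!: bd)
      also note ineq[OF L]
      finally show ?thesis .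
    qed
    then have "expectation (\<lambda>\<omega>. min (Z \<omega> powr p) L) \<le> C * (expectation (\<lambda>\<omega>. min (G \<omega>) L) + expectation (\<lambda>\<omega>. min (0 powr p) L))"
      by (intro LIMSEQ_le[OF 1 tendsto_mult_left[OF tendsto_add[OF 2 3]]]) auto
    also have "expectation (\<lambda>\<omega>. min (0 powr p) L) = 0" using L p by (simp add: min_def)
    also have "expectation (\<lambda>\<omega>. min (G \<omega>) L) \<le> expectation G"
    proof (rule integral_mono)
      show "integrable M (\<lambda>\<omega>. min (G \<omega>) L)"
        by (rule integrable_const_bound[where B = L]) (use L nonneg in auto)
    qed (use G in auto)
    finally show ?thesis using C by (simp add: mult_left_mono)
  qed
  show "integrable M (\<lambda>\<omega>. Z \<omega> powr p)" "expectation (\<lambda>\<omega>. Z \<omega> powr p) \<le> C * expectation G"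
    using integrable_from_truncations[of "\<lambda>\<omega>. Z \<omega> powr p" "C * expectation G"] main C EG by auto
qed

section \<open>The strong error of the scheme\<close>

lemma C2_on_derivatives:
  assumes "C2_on I f"
  shows "\<And>x. x \<in> I \<Longrightarrow> (f has_real_derivative deriv f x) (at x)"
    and "\<And>x. x \<in> I \<Longrightarrow> (deriv f has_real_derivative deriv (deriv f) x) (at x)"
    and "continuous_on I f" "continuous_on I (deriv f)" "continuous_on I (deriv (deriv f))"
proof -
  have C1: "(\<forall>x\<in>I. (g has_real_derivative deriv g x) (at x)) \<and> continuous_on I g \<and> continuous_on I (deriv g)"
    if "g C1_differentiable_on I" for g :: "real \<Rightarrow> real"
  proof -
    have d: "(g has_real_derivative deriv g x) (at x)" if "x \<in> I" for x
      using \<open>g C1_differentiable_on I\<close> that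
      by (auto simp: C1_differentiable_on_eq DERIV_deriv_iff_real_differentiable)
    have "continuous_on I (\<lambda>x. vector_derivative g (at x))"
      using that by (simp add: C1_differentiable_on_eq)
    moreover have "vector_derivative g (at x) = deriv g x" if "x \<in> I" for x
      using d[OF that] by (simp add: has_real_derivative_iff_has_vector_derivative vector_derivative_at)
    ultimately have "continuous_on I (deriv g)" by (simp cong: continuous_on_cong)
    moreover have "continuous_on I g"
      by (intro continuous_at_imp_continuous_on ballI DERIV_isCont[OF d])
    ultimately show ?thesis using d by blast
  qed
  show "\<And>x. x \<in> I \<Longrightarrow> (f has_real_derivative deriv f x) (at x)"
    and "\<And>x. x \<in> I \<Longrightarrow> (deriv f has_real_derivative deriv (deriv f) x) (at x)"
    and "continuous_on I f" "continuous_on I (deriv f)" "continuous_on I (deriv (deriv f))"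
    using assms C1[of f] C1[of "deriv f"] by (auto simp: C2_on_def)
qed

lemma borel_measurable_compose_continuous_on:
  fixes \<phi> :: "real \<Rightarrow> real"
  assumes I: "open I" and \<phi>: "continuous_on I \<phi>" and X: "X \<in> borel_measurable N"
    and XI: "\<And>\<omega>. \<omega> \<in> space N \<Longrightarrow> X \<omega> \<in> I"
  shows "(\<lambda>\<omega>. \<phi> (X \<omega>)) \<in> borel_measurable N"
proof -
  have "(\<lambda>x. indicator I x *\<^sub>R \<phi> x) \<in> borel_measurable borel"
    by (rule borel_measurable_continuous_on_indicator[OF borel_open[OF I] \<phi>])
  from measurable_compose[OF X this] have "(\<lambda>\<omega>. indicator I (X \<omega>) *\<^sub>R \<phi> (X \<omega>)) \<in> borel_measurable N" .
  then show ?thesis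
    by (rule measurable_cong[THEN iffD1, rotated]) (use XI in simp)
qed

lemma LBINT_eq_integral_continuous:
  fixes g :: "real \<Rightarrow> real"
  assumes "0 \<le> t" "continuous_on {0..t} g"
  shows "(LBINT u=ereal 0..ereal t. g u) = integral {0..t} g"
  using assms by (intro interval_integral_eq_integral borel_integrable_atLeastAtMost')

text \<open>
  The random variable Z is the part of the normalised error that the finite variation part G does not explain; by the
  two pathwise bounds it is at most the lower limit of the maximal martingale transforms on the refined grids.
\<close>

lemma (in prob_space) strong_error_moment_bound:
  fixes W Y :: "real \<Rightarrow> 'a \<Rightarrow> real" and f f1 f2 :: "real \<Rightarrow> real"
  assumes drift: "one_sided_Lipschitz_drift I f \<kappa>" and I: "open I"
    and f1: "\<And>x. x \<in> I \<Longrightarrow> (f has_real_derivative f1 x) (at x)"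
    and f2: "\<And>x. x \<in> I \<Longrightarrow> (f1 has_real_derivative f2 x) (at x)"
    and f1c: "continuous_on I f1" and f2c: "continuous_on I f2"
    and \<gamma>: "0 < \<gamma>" and T: "0 < T" and y: "y \<in> I"
    and W: "standard_brownian_motion M W"
    and Yad: "\<And>t. 0 \<le> t \<Longrightarrow> Y t \<in> borel_measurable (augmented_filtration M W t)"
    and Yc: "\<And>\<omega>. \<omega> \<in> space M \<Longrightarrow> continuous_on {0..} (\<lambda>t. Y t \<omega>)"
    and YI: "\<And>t \<omega>. \<omega> \<in> space M \<Longrightarrow> 0 \<le> t \<Longrightarrow> Y t \<omega> \<in> I"
    and Yeq: "AE \<omega> in M. \<forall>t\<in>{0..T}. Y t \<omega> = y + integral {0..t} (\<lambda>u. f (Y u \<omega>)) + \<gamma> * (W t \<omega> - W 0 \<omega>)"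
    and p: "1 \<le> p"
  defines "G \<equiv> \<lambda>\<omega>. integral {0..T} (\<lambda>u. \<bar>f1 (Y u \<omega>) * f (Y u \<omega>) + \<gamma>\<^sup>2 / 2 * f2 (Y u \<omega>)\<bar>)"
    and "H \<equiv> \<lambda>\<omega>. integral {0..T} (\<lambda>u. (f1 (Y u \<omega>))\<^sup>2)"
  assumes intG: "integrable M (\<lambda>\<omega>. G \<omega> powr p)" and intH: "integrable M (\<lambda>\<omega>. H \<omega> powr (p / 2))"
    and n: "1 \<le> n" "real n > 2 * \<kappa> * T"
  defines "err \<equiv> \<lambda>\<omega>. SUP t\<in>{0..T}. \<bar>implicit_euler I f \<gamma> y T n (\<lambda>s. W s \<omega>) t - Y t \<omega>\<bar>"
  shows "integrable M (\<lambda>\<omega>. err \<omega> powr p) \<and>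
    expectation (\<lambda>\<omega>. err \<omega> powr p) \<le> (4 * exp (2 * max \<kappa> 0 * T) * (T / real n)) powr p *
      (expectation (\<lambda>\<omega>. G \<omega> powr p) + \<gamma> powr p * (burkholder_const p * expectation (\<lambda>\<omega>. H \<omega> powr (p / 2))))"
proof -
  interpret one_sided_Lipschitz_drift I f \<kappa> by (rule drift)
  have p0: "0 < p" using p by simp
  have fc: "continuous_on I f" by (rule drift_continuous)
  have Wm: "\<forall>t\<ge>0. W t \<in> borel_measurable M" and Wc: "\<And>\<omega>. \<omega> \<in> space M \<Longrightarrow> continuous_on {0..} (\<lambda>t. W t \<omega>)"
    using W by (auto simp: standard_brownian_motion_def)
  have Ym: "Y t \<in> borel_measurable M" if "0 \<le> t" for t
    by (rule augmented_filtration_le[OF Wm Yad[OF that]])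
  have YcT: "continuous_on {0..T} (\<lambda>t. Y t \<omega>)" and WcT: "continuous_on {0..T} (\<lambda>t. W t \<omega>)"
    if "\<omega> \<in> space M" for \<omega>
    by (rule continuous_on_subset[OF Yc[OF that]], simp) (rule continuous_on_subset[OF Wc[OF that]], simp)
  have f1Yc: "continuous_on {0..T} (\<lambda>t. f1 (Y t \<omega>))" and f2Yc: "continuous_on {0..T} (\<lambda>t. f2 (Y t \<omega>))"
    if "\<omega> \<in> space M" for \<omega>
    using continuous_compose_path[OF f1c YcT[OF that]] continuous_compose_path[OF f2c YcT[OF that]] YI[OF that] by auto
  define C where "C = 2 * exp (2 * kappa_plus * T)"
  define h where "h = T / real n"
  have C: "0 < C" and h: "0 < h" using T n by (simp_all add: C_def h_def)

  let ?\<Delta> = "fine_step T n"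
  define s where "s m i = real i * ?\<Delta> m" for m i
  define \<xi> where "\<xi> m i \<omega> = W (s m (Suc i)) \<omega> - W (s m i) \<omega>" for m i \<omega>
  \<comment> \<open>transform weights A, maximal transform S, bracket V and largest jump D on the m-th refinement\<close>
  define A where "A m i \<omega> = block_weight m i * f1 (Y (s m i) \<omega>)" for m i \<omega>
  define N where "N m = n * 2 ^ m" for m :: nat
  define S where "S m \<omega> = Max ((\<lambda>k. \<bar>\<Sum>i<k. A m i \<omega> * \<xi> m i \<omega>\<bar>) ` {..N m})" for m \<omega>
  define V where "V m \<omega> = sqrt (\<Sum>i<N m. (f1 (Y (s m i) \<omega>))\<^sup>2 * ?\<Delta> m)" for m \<omega>
  define D where "D m \<omega> = Max ((\<lambda>i. \<bar>A m i \<omega> * \<xi> m i \<omega>\<bar>) ` {..<N m})" for m \<omega>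
  have \<Delta>: "0 < ?\<Delta> m" for m by (rule fine_step_pos[OF T n(1)])
  have s0: "0 \<le> s m i" for m i using \<Delta>[of m] by (simp add: s_def)
  have sT: "s m i \<in> {0..T}" if "i \<le> N m" for m i
  proof -
    have "real i * ?\<Delta> m \<le> real (N m) * ?\<Delta> m"
      using that less_imp_le[OF \<Delta>[of m]] by (intro mult_right_mono) (simp_all only: of_nat_le_iff)
    then show ?thesis using s0[of m i] fine_step_total[OF n(1), of m T] by (simp add: s_def N_def)
  qed
  have N0: "0 < N m" for m using n by (simp add: N_def)
  have ad: "(\<lambda>\<omega>. \<phi> (Y (s m i) \<omega>)) \<in> borel_measurable (augmented_filtration M W (s m i))"
    if "continuous_on I \<phi>" for \<phi> :: "real \<Rightarrow> real" and m i
    by (rule borel_measurable_compose_continuous_on[OF I that Yad[OF s0]])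
       (use YI s0 in \<open>simp add: space_augmented\<close>)
  have AF: "A m i \<in> borel_measurable (augmented_filtration M W (s m i))" for m i
    unfolding A_def[abs_def] by (intro borel_measurable_times borel_measurable_const ad f1c)
  have AM[measurable]: "A m i \<in> borel_measurable M" for m i
    by (rule augmented_filtration_le[OF Wm AF])
  have \<xi>M[measurable]: "\<xi> m i \<in> borel_measurable M" for m i
    unfolding \<xi>_def[abs_def] using Wm s0 by (intro borel_measurable_diff) auto
  have f1M[measurable]: "(\<lambda>\<omega>. f1 (Y (s m i) \<omega>)) \<in> borel_measurable M" for m i
    by (rule augmented_filtration_le[OF Wm ad[OF f1c]])
  have SM: "S m \<in> borel_measurable M" for m
    unfolding S_def[abs_def] by (rule borel_measurable_Max) auto
  have DM: "D m \<in> borel_measurable M" for m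
    unfolding D_def[abs_def] by (rule borel_measurable_Max) auto
  have VM: "V m \<in> borel_measurable M" for m
    unfolding V_def[abs_def] by measurable
  have S0: "0 \<le> S m \<omega>" for m \<omega>
    unfolding S_def by (rule Max_ge[THEN order_trans[rotated]]) (auto intro: image_eqI[of _ _ 0])
  have D_ge: "\<bar>A m i \<omega> * \<xi> m i \<omega>\<bar> \<le> D m \<omega>" if "i < N m" for m i \<omega>
    unfolding D_def using that by (intro Max_ge) auto
  have D0: "0 \<le> D m \<omega>" for m \<omega>
    using D_ge[OF N0[of m], of \<omega>] by (rule order_trans[OF abs_ge_zero])

  have burk: "expectation (\<lambda>\<omega>. min (S m \<omega> powr p) L) \<le> burkholder_const p *
      (expectation (\<lambda>\<omega>. min (V m \<omega> powr p) L) + expectation (\<lambda>\<omega>. min (D m \<omega> powr p) L))"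
    if L: "0 < L" for m L
  proof -
    \<comment> \<open>the weights involve f' at the left end point of each step and are therefore predictable\<close>
    interpret B: predictable_innovations M "\<lambda>i. augmented_filtration M W (s m i)" "\<xi> m" "?\<Delta> m"
      unfolding s_def \<xi>_def[abs_def] by (rule brownian_innovations(1)[OF W \<Delta>])
    show ?thesis
      unfolding S_def
    proof (rule B.burkholder_truncated[OF AF p0 L VM DM])
      fix \<omega> assume "\<omega> \<in> space M"
      have "(A m i \<omega>)\<^sup>2 \<le> (f1 (Y (s m i) \<omega>))\<^sup>2" for i
      proof -
        have "(block_weight m i)\<^sup>2 \<le> 1" using block_weight_bounds[of m i] by (simp add: power_le_one)
        then have "(block_weight m i)\<^sup>2 * (f1 (Y (s m i) \<omega>))\<^sup>2 \<le> 1 * (f1 (Y (s m i) \<omega>))\<^sup>2"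
          by (intro mult_right_mono) auto
        then show ?thesis by (simp add: A_def power_mult_distrib)
      qed
      then have "(\<Sum>i<N m. (A m i \<omega>)\<^sup>2 * ?\<Delta> m) \<le> (\<Sum>i<N m. (f1 (Y (s m i) \<omega>))\<^sup>2 * ?\<Delta> m)"
        using \<Delta>[of m] by (intro sum_mono mult_right_mono) auto
      moreover have "0 \<le> (\<Sum>i<N m. (f1 (Y (s m i) \<omega>))\<^sup>2 * ?\<Delta> m)"
        using \<Delta>[of m] by (intro sum_nonneg) auto
      ultimately show "0 \<le> V m \<omega> \<and> (\<Sum>i<N m. (A m i \<omega>)\<^sup>2 * ?\<Delta> m) \<le> (V m \<omega>)\<^sup>2"
        by (simp add: V_def)
    qed (use D_ge D0 in auto)
  qed

  have Vlim: "(\<lambda>m. V m \<omega> powr p) \<longlonglongrightarrow> H \<omega> powr (p / 2)" if \<omega>: "\<omega> \<in> space M" for \<omega>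
  proof -
    have "(\<lambda>m. \<Sum>i<N m. (f1 (Y (s m i) \<omega>))\<^sup>2 * ?\<Delta> m) \<longlonglongrightarrow> H \<omega>"
      unfolding H_def N_def s_def
      by (rule Riemann_sums_tendsto_integral[OF T n(1)]) (intro continuous_intros f1Yc \<omega>)
    then have "(\<lambda>m. (\<Sum>i<N m. (f1 (Y (s m i) \<omega>))\<^sup>2 * ?\<Delta> m) powr (p / 2)) \<longlonglongrightarrow> H \<omega> powr (p / 2)"
      using p0 less_imp_le[OF \<Delta>] by (intro tendsto_powr' tendsto_const) (auto intro!: always_eventually sum_nonneg)
    moreover have "V m \<omega> powr p = (\<Sum>i<N m. (f1 (Y (s m i) \<omega>))\<^sup>2 * ?\<Delta> m) powr (p / 2)" for m
    proof -
      have "0 \<le> (\<Sum>i<N m. (f1 (Y (s m i) \<omega>))\<^sup>2 * ?\<Delta> m)"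
        using less_imp_le[OF \<Delta>] by (intro sum_nonneg) auto
      then show ?thesis by (simp add: V_def powr_half_sqrt[symmetric] powr_powr)
    qed
    ultimately show ?thesis by simp
  qed

  have Dlim: "(\<lambda>m. D m \<omega>) \<longlonglongrightarrow> 0" if \<omega>: "\<omega> \<in> space M" for \<omega>
  proof (rule order_tendstoI)
    fix a :: real assume "a < 0"
    then show "eventually (\<lambda>m. a < D m \<omega>) sequentially"
      using D0 by (auto intro!: always_eventually intro: less_le_trans)
  next
    fix a :: real assume a: "0 < a"
    obtain F where F: "0 < F" "\<forall>t\<in>{0..T}. \<bar>f1 (Y t \<omega>)\<bar> \<le> F"
      using continuous_Icc_bounded[OF f1Yc[OF \<omega>]] by blast
    have "0 < a / F" using a F by simp
    then obtain d where d: "d > 0" "\<forall>u\<in>{0..T}. \<forall>v\<in>{0..T}. \<bar>u - v\<bar> < d \<longrightarrow> \<bar>W u \<omega> - W v \<omega>\<bar> < a / F"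
      using continuous_Icc_modulus[OF WcT[OF \<omega>]] by blast
    have "eventually (\<lambda>m. ?\<Delta> m < d) sequentially"
      using fine_step_tendsto_0[of T n] d(1) by (intro order_tendstoD) auto
    then show "eventually (\<lambda>m. D m \<omega> < a) sequentially"
    proof eventually_elim
      case (elim m)
      have "\<bar>A m i \<omega> * \<xi> m i \<omega>\<bar> < a" if i: "i < N m" for i
      proof -
        have "\<bar>s m (Suc i) - s m i\<bar> < d"
          using elim \<Delta>[of m] by (simp add: s_def algebra_simps)
        then have x: "\<bar>\<xi> m i \<omega>\<bar> < a / F"
          using d(2)[THEN bspec, THEN bspec, of "s m (Suc i)" "s m i"] sT[of i m] sT[of "Suc i" m] i by (simp add: \<xi>_def)
        have "block_weight m i * \<bar>f1 (Y (s m i) \<omega>)\<bar> \<le> 1 * F"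
          using block_weight_bounds F sT[of i m] i by (intro mult_mono) auto
        then have "\<bar>A m i \<omega>\<bar> \<le> F" using block_weight_bounds(1)[of m i] by (simp add: A_def abs_mult)
        then have "\<bar>A m i \<omega>\<bar> * \<bar>\<xi> m i \<omega>\<bar> \<le> F * \<bar>\<xi> m i \<omega>\<bar>" by (intro mult_right_mono) auto
        also have "\<dots> < a" using x F by (simp add: field_simps)
        finally show ?thesis by (simp add: abs_mult)
      qed
      then show ?case unfolding D_def using N0[of m] by (subst Max_less_iff) auto
    qed
  qed

  have errc: "continuous_on {0..T} (\<lambda>t. \<bar>implicit_euler I f \<gamma> y T n (\<lambda>s. W s \<omega>) t - Y t \<omega>\<bar>)"
    if "\<omega> \<in> space M" for \<omega>
    by (intro continuous_intros continuous_implicit_euler[OF T n y] WcT YcT that)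
  have errM[measurable]: "err \<in> borel_measurable M"
    unfolding err_def
  proof (rule borel_measurable_SUP_continuous[OF T _ errc])
    fix t assume t: "t \<in> {0..T}"
    then show "(\<lambda>\<omega>. \<bar>implicit_euler I f \<gamma> y T n (\<lambda>s. W s \<omega>) t - Y t \<omega>\<bar>) \<in> borel_measurable M"
      using Wm by (intro borel_measurable_abs borel_measurable_diff Ym measurable_implicit_euler[OF T n y _ t]) auto
  qed
  have G0: "0 \<le> G \<omega>" if "\<omega> \<in> space M" for \<omega>
    unfolding G_def
    by (rule Henstock_Kurzweil_Integration.integral_nonneg)
       (use f1Yc[OF that] f2Yc[OF that] continuous_compose_path[OF fc YcT[OF that]] YI[OF that] in
         \<open>auto intro!: integrable_continuous_interval continuous_intros\<close>)
  have GM[measurable]: "G \<in> borel_measurable M"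
  proof -
    have "(\<lambda>\<omega>. (G \<omega> powr p) powr (1 / p)) \<in> borel_measurable M" using intG by measurable
    then show ?thesis
      by (rule measurable_cong[THEN iffD1, rotated]) (use G0 p0 in \<open>simp add: powr_powr\<close>)
  qed

  \<comment> \<open>by the pathwise error bound, err is at most C h (G + \<gamma> x) whenever the transforms are at most x infinitely often\<close>
  define Z where "Z \<omega> = max 0 ((err \<omega> / (C * h) - G \<omega>) / \<gamma>)" for \<omega>
  have ZM: "Z \<in> borel_measurable M" unfolding Z_def[abs_def] by measurable
  have lim: "AE \<omega> in M. \<forall>x. x < Z \<omega> \<longrightarrow> eventually (\<lambda>m. x < S m \<omega>) sequentially"
  proof -
    have "AE \<omega> in M. \<forall>\<epsilon>>0. eventually (\<lambda>m. \<forall>k\<le>n * 2 ^ m.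
        \<bar>\<Sum>i<k. block_weight m i * f2 (Y (s m i) \<omega>) * ((\<xi> m i \<omega>)\<^sup>2 - ?\<Delta> m)\<bar> \<le> \<epsilon>) sequentially"
      unfolding s_def \<xi>_def
    proof (rule weighted_squared_increments_vanish[OF W T n(1)])
      fix m i
      show "(\<lambda>\<omega>. block_weight m i * f2 (Y (real i * ?\<Delta> m) \<omega>)) \<in> borel_measurable (augmented_filtration M W (real i * ?\<Delta> m))"
        using ad[OF f2c, of m i] unfolding s_def by (intro borel_measurable_times borel_measurable_const)
    next
      fix \<omega> assume \<omega>: "\<omega> \<in> space M"
      obtain F where F: "0 < F" "\<forall>t\<in>{0..T}. \<bar>f2 (Y t \<omega>)\<bar> \<le> F"
        using continuous_Icc_bounded[OF f2Yc[OF \<omega>]] by blast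
      have "\<bar>block_weight m i * f2 (Y (s m i) \<omega>)\<bar> \<le> F" if "i < n * 2 ^ m" for m i
      proof -
        have "block_weight m i * \<bar>f2 (Y (s m i) \<omega>)\<bar> \<le> 1 * F"
          using block_weight_bounds F sT[of i m] that by (intro mult_mono) (auto simp: N_def)
        then show ?thesis using block_weight_bounds(1)[of m i] by (simp add: abs_mult)
      qed
      then show "\<exists>C. \<forall>m. \<forall>i<n * 2 ^ m. \<bar>block_weight m i * f2 (Y (real i * ?\<Delta> m) \<omega>)\<bar> \<le> C"
        unfolding s_def by blast
    qed
    \<comment> \<open>unit weights: the sums of squared increments converge to T and are thus bounded\<close>
    moreover have "AE \<omega> in M. \<forall>\<epsilon>>0. eventually (\<lambda>m. \<forall>k\<le>n * 2 ^ m.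
        \<bar>\<Sum>i<k. 1 * ((\<xi> m i \<omega>)\<^sup>2 - ?\<Delta> m)\<bar> \<le> \<epsilon>) sequentially"
      unfolding s_def \<xi>_def
      by (rule weighted_squared_increments_vanish[OF W T n(1)]) auto
    ultimately show ?thesis
      using Yeq AE_space
    proof eventually_elim
      case (elim \<omega>)
      note \<omega> = elim(4)
      have QV: "eventually (\<lambda>m. (\<Sum>i<n * 2 ^ m. (\<xi> m i \<omega>)\<^sup>2) \<le> T + 1) sequentially"
        using elim(2)[rule_format, of 1, OF zero_less_one]
      proof eventually_elim
        case (elim m)
        from elim[rule_format, OF order_refl]
        have "(\<Sum>i<n * 2 ^ m. (\<xi> m i \<omega>)\<^sup>2) - real (n * 2 ^ m) * ?\<Delta> m \<le> 1"
          by (simp add: sum_subtractf)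
        then show ?case unfolding fine_step_total[OF n(1)] by simp
      qed
      show ?case
      proof (intro allI impI)
        fix x assume x: "x < Z \<omega>"
        show "eventually (\<lambda>m. x < S m \<omega>) sequentially"
        proof (rule ccontr)
          assume "\<not> eventually (\<lambda>m. x < S m \<omega>) sequentially"
          then have fr: "frequently (\<lambda>m. S m \<omega> \<le> x) sequentially"
            by (simp add: frequently_def not_le)
          have x0: "0 \<le> x" using frequently_ex[OF fr] S0 by (auto intro: order_trans)
          have fr': "frequently (\<lambda>m. \<forall>k\<le>n * 2 ^ m.
              \<bar>\<Sum>i<k. block_weight m i * f1 (Y (s m i) \<omega>) * \<xi> m i \<omega>\<bar> \<le> x) sequentially"
            using fr
          proof (rule frequently_elim1)
            fix m assume m: "S m \<omega> \<le> x"
            show "\<forall>k\<le>n * 2 ^ m. \<bar>\<Sum>i<k. block_weight m i * f1 (Y (s m i) \<omega>) * \<xi> m i \<omega>\<bar> \<le> x"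
            proof (intro allI impI)
              fix k assume "k \<le> n * 2 ^ m"
              then have "\<bar>\<Sum>i<k. A m i \<omega> * \<xi> m i \<omega>\<bar> \<le> S m \<omega>"
                unfolding S_def N_def by (intro Max_ge) auto
              then show "\<bar>\<Sum>i<k. block_weight m i * f1 (Y (s m i) \<omega>) * \<xi> m i \<omega>\<bar> \<le> x"
                using m by (simp add: A_def)
            qed
          qed
          have eq: "\<And>t. t \<in> {0..T} \<Longrightarrow> Y t \<omega> = y + integral {0..t} (\<lambda>u. f (Y u \<omega>)) + \<gamma> * (W t \<omega> - W 0 \<omega>)"
            using elim(3) by blast
          interpret path: SDE_path I f f1 f2 \<gamma> T y "\<lambda>t. Y t \<omega>" "\<lambda>t. W t \<omega>"
            by (rule SDE_path.intro[OF T less_imp_le[OF \<gamma>] interval f1 f2 f2c YcT[OF \<omega>] _ WcT[OF \<omega>] eq])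
               (use YI[OF \<omega>] in auto)
          have acc: "\<bar>accumulated_defect f (\<lambda>t. Y t \<omega>) T n j t\<bar> \<le> h * (G \<omega> + \<gamma> * x)"
            if "j < n" "t \<in> {grid_time T n j..grid_time T n (Suc j)}" for j t
            unfolding h_def G_def path.generator_def[symmetric]
            by (rule path.accumulated_defect_bound[OF n(1) _ _ _ that, of "T + 1"])
               (use QV elim(1) fr' in \<open>auto simp: s_def \<xi>_def\<close>)
          have "err \<omega> \<le> C * (h * (G \<omega> + \<gamma> * x))"
            unfolding err_def C_def
          proof (rule cSUP_least)
            fix t assume t: "t \<in> {0..T}"
            show "\<bar>implicit_euler I f \<gamma> y T n (\<lambda>s. W s \<omega>) t - Y t \<omega>\<bar> \<le> 2 * exp (2 * kappa_plus * T) * (h * (G \<omega> + \<gamma> * x))"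
              by (rule scheme_error_le_accumulated_defect[OF T n y YcT[OF \<omega>] YI[OF \<omega>] eq acc t]) auto
          qed (use T in auto)
          then have "err \<omega> / (C * h) \<le> G \<omega> + \<gamma> * x" using C h by (simp add: field_simps)
          then have "(err \<omega> / (C * h) - G \<omega>) / \<gamma> \<le> x" using \<gamma> by (simp add: field_simps)
          then show False using x x0 by (simp add: Z_def)
        qed
      qed
    qed
  qed

  have Zp: "integrable M (\<lambda>\<omega>. Z \<omega> powr p)"
    "expectation (\<lambda>\<omega>. Z \<omega> powr p) \<le> burkholder_const p * expectation (\<lambda>\<omega>. H \<omega> powr (p / 2))"
    using moment_bound_in_the_limit[OF p0 less_imp_le[OF burkholder_const_pos] SM VM DM ZM S0 D0 _ _ intH burk _ _ lim]
      Vlim Dlim by (auto simp: Z_def)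

  have pw: "err \<omega> powr p \<le> (2 * C * h) powr p * (G \<omega> powr p + \<gamma> powr p * Z \<omega> powr p)" if \<omega>: "\<omega> \<in> space M" for \<omega>
  proof -
    have Z0: "0 \<le> Z \<omega>" by (simp add: Z_def)
    have e0: "0 \<le> err \<omega>"
    proof -
      have "0 \<le> \<bar>implicit_euler I f \<gamma> y T n (\<lambda>s. W s \<omega>) 0 - Y 0 \<omega>\<bar>" by simp
      also have "\<dots> \<le> err \<omega>"
        unfolding err_def
        by (rule cSUP_upper[OF _ SUP_continuous_eq_SUP_rational(2)[OF errc[OF \<omega>] T]]) (use T in auto)
      finally show ?thesis .
    qed
    have "(err \<omega> / (C * h) - G \<omega>) / \<gamma> \<le> Z \<omega>" by (simp add: Z_def)
    then have "err \<omega> \<le> C * h * (G \<omega> + \<gamma> * Z \<omega>)" using C h \<gamma> by (simp add: field_simps)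
    also have "G \<omega> + \<gamma> * Z \<omega> \<le> 2 * max (G \<omega>) (\<gamma> * Z \<omega>)" by simp
    finally have "err \<omega> \<le> 2 * C * h * max (G \<omega>) (\<gamma> * Z \<omega>)" using C h by (simp add: mult_ac)
    then have "err \<omega> powr p \<le> (2 * C * h * max (G \<omega>) (\<gamma> * Z \<omega>)) powr p"
      using e0 p0 by (intro powr_mono2) auto
    also have "\<dots> = (2 * C * h) powr p * max (G \<omega>) (\<gamma> * Z \<omega>) powr p"
      using C h G0[OF \<omega>] by (subst powr_mult) (auto simp: le_max_iff_disj)
    also have "max (G \<omega>) (\<gamma> * Z \<omega>) powr p \<le> G \<omega> powr p + (\<gamma> * Z \<omega>) powr p" by (simp add: max_def)
    also have "(\<gamma> * Z \<omega>) powr p = \<gamma> powr p * Z \<omega> powr p" using \<gamma> Z0 by (simp add: powr_mult)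
    finally show ?thesis by (simp add: mult_left_mono)
  qed
  have intR: "integrable M (\<lambda>\<omega>. (2 * C * h) powr p * (G \<omega> powr p + \<gamma> powr p * Z \<omega> powr p))"
    using intG Zp(1) by (intro integrable_mult_right Bochner_Integration.integrable_add)
  have int: "integrable M (\<lambda>\<omega>. err \<omega> powr p)"
    by (rule Bochner_Integration.integrable_bound[OF intR]) (use pw in \<open>auto intro!: AE_I2\<close>)
  have "expectation (\<lambda>\<omega>. err \<omega> powr p) \<le> expectation (\<lambda>\<omega>. (2 * C * h) powr p * (G \<omega> powr p + \<gamma> powr p * Z \<omega> powr p))"
    by (rule integral_mono[OF int intR pw])
  also have "\<dots> = (2 * C * h) powr p * (expectation (\<lambda>\<omega>. G \<omega> powr p) + \<gamma> powr p * expectation (\<lambda>\<omega>. Z \<omega> powr p))"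
    using intG Zp(1) by simp
  also have "\<dots> \<le> (2 * C * h) powr p * (expectation (\<lambda>\<omega>. G \<omega> powr p)
      + \<gamma> powr p * (burkholder_const p * expectation (\<lambda>\<omega>. H \<omega> powr (p / 2))))"
    using Zp(2) by (intro mult_left_mono add_left_mono) auto
  finally show ?thesis using int by (simp add: C_def h_def kappa_plus_def)
qed

theorem proposition3:
  fixes M :: "'a measure" and W Y :: "real \<Rightarrow> 'a \<Rightarrow> real"
    and c :: ereal and I :: "real set" and d y \<gamma> T \<kappa> p :: real and f :: "real \<Rightarrow> real"
  assumes "c < \<infinity>" and I_def: "I = einterval c \<infinity>" and "d \<in> I" and "y \<in> I"
    and "\<gamma> > 0" and "T > 0"
    and "C2_on I f"
    and "\<And>z z'. z \<in> I \<Longrightarrow> z' \<in> I \<Longrightarrow> z \<le> z' \<Longrightarrow> f z' - f z \<le> \<kappa> * (z' - z)"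
    and "filterlim (feller_v f \<gamma> d \<circ> real_of_ereal) at_top (at_right c)"
    and "prob_space M" and "standard_brownian_motion M W"
    and "strong_solution M W I f \<gamma> y Y"
    and "p \<ge> 1"
    and "integrable M (\<lambda>\<omega>. (LBINT u=ereal 0..ereal T.
           \<bar>deriv f (Y u \<omega>) * f (Y u \<omega>) + \<gamma>\<^sup>2 / 2 * deriv (deriv f) (Y u \<omega>)\<bar>) powr p)"
    and "integrable M (\<lambda>\<omega>. (LBINT u=ereal 0..ereal T. (deriv f (Y u \<omega>))\<^sup>2) powr (p / 2))"
  shows "\<exists>K>0. \<forall>n::nat. n \<ge> 1 \<longrightarrow> real n > 2 * \<kappa> * T \<longrightarrow>
    (let err = (\<lambda>\<omega>. SUP t\<in>{0..T}. \<bar>implicit_euler I f \<gamma> y T n (\<lambda>s. W s \<omega>) t - Y t \<omega>\<bar>)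
     in integrable M (\<lambda>\<omega>. err \<omega> powr p) \<and>
        (\<integral>\<omega>. err \<omega> powr p \<partial>M) powr (1 / p) \<le> K * (T / real n))"
proof -
  interpret prob_space M by fact
  note T = \<open>T > 0\<close>
  note C2 = C2_on_derivatives[OF \<open>C2_on I f\<close>]
  have drift: "one_sided_Lipschitz_drift I f \<kappa>"
    by (rule one_sided_Lipschitz_drift_from_Feller[OF assms(1-3) C2(3) assms(8,9)])
  have I: "open I" unfolding I_def by simp
  have Yad: "\<And>t. 0 \<le> t \<Longrightarrow> Y t \<in> borel_measurable (augmented_filtration M W t)"
    and Yc: "\<And>\<omega>. \<omega> \<in> space M \<Longrightarrow> continuous_on {0..} (\<lambda>t. Y t \<omega>)"
    and YI: "\<And>t \<omega>. \<omega> \<in> space M \<Longrightarrow> 0 \<le> t \<Longrightarrow> Y t \<omega> \<in> I"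
    and Yeq: "AE \<omega> in M. \<forall>t\<ge>0. Y t \<omega> = y + (LBINT u=ereal 0..ereal t. f (Y u \<omega>)) + \<gamma> * (W t \<omega> - W 0 \<omega>)"
    using \<open>strong_solution M W I f \<gamma> y Y\<close> by (auto simp: strong_solution_def)
  have comp: "continuous_on {0..t} (\<lambda>u. \<phi> (Y u \<omega>))" if "continuous_on I \<phi>" "\<omega> \<in> space M"
    for \<phi> :: "real \<Rightarrow> real" and t \<omega>
  proof (rule continuous_compose_path[OF that(1)])
    show "continuous_on {0..t} (\<lambda>u. Y u \<omega>)" by (rule continuous_on_subset[OF Yc[OF that(2)]]) auto
  qed (use YI that in auto)
  have Yeq': "AE \<omega> in M. \<forall>t\<in>{0..T}. Y t \<omega> = y + integral {0..t} (\<lambda>u. f (Y u \<omega>)) + \<gamma> * (W t \<omega> - W 0 \<omega>)"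
    using Yeq AE_space
  proof eventually_elim
    case (elim \<omega>)
    then show ?case using LBINT_eq_integral_continuous[OF _ comp[OF C2(3) elim(2)]] by simp
  qed
  define G where "G \<omega> = integral {0..T} (\<lambda>u. \<bar>deriv f (Y u \<omega>) * f (Y u \<omega>) + \<gamma>\<^sup>2 / 2 * deriv (deriv f) (Y u \<omega>)\<bar>)" for \<omega>
  define H where "H \<omega> = integral {0..T} (\<lambda>u. (deriv f (Y u \<omega>))\<^sup>2)" for \<omega>
  have G: "(LBINT u=ereal 0..ereal T. \<bar>deriv f (Y u \<omega>) * f (Y u \<omega>) + \<gamma>\<^sup>2 / 2 * deriv (deriv f) (Y u \<omega>)\<bar>) = G \<omega>"
    if "\<omega> \<in> space M" for \<omega>
    unfolding G_def using T by (intro LBINT_eq_integral_continuous continuous_intros comp C2 that) auto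
  have H: "(LBINT u=ereal 0..ereal T. (deriv f (Y u \<omega>))\<^sup>2) = H \<omega>" if "\<omega> \<in> space M" for \<omega>
    unfolding H_def using T by (intro LBINT_eq_integral_continuous continuous_intros comp C2 that) auto
  have intG: "integrable M (\<lambda>\<omega>. G \<omega> powr p)"
    using assms(14) by (rule Bochner_Integration.integrable_cong[THEN iffD1, rotated 2]) (simp_all only: G)
  have intH: "integrable M (\<lambda>\<omega>. H \<omega> powr (p / 2))"
    using assms(15) by (rule Bochner_Integration.integrable_cong[THEN iffD1, rotated 2]) (simp_all only: H)
  define B where "B = expectation (\<lambda>\<omega>. G \<omega> powr p) + \<gamma> powr p * (burkholder_const p * expectation (\<lambda>\<omega>. H \<omega> powr (p / 2)))"
  define E where "E = 4 * exp (2 * max \<kappa> 0 * T)"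
  have B0: "0 \<le> B"
    unfolding B_def using less_imp_le[OF burkholder_const_pos]
    by (intro add_nonneg_nonneg mult_nonneg_nonneg Bochner_Integration.integral_nonneg) auto
  show ?thesis
  proof (intro exI[of _ "E * B powr (1 / p) + 1"] conjI allI impI)
    show "0 < E * B powr (1 / p) + 1" by (simp add: E_def add_nonneg_pos)
    fix n :: nat assume n: "1 \<le> n" "2 * \<kappa> * T < real n"
    define err where "err \<omega> = (SUP t\<in>{0..T}. \<bar>implicit_euler I f \<gamma> y T n (\<lambda>s. W s \<omega>) t - Y t \<omega>\<bar>)" for \<omega>
    have bound: "integrable M (\<lambda>\<omega>. err \<omega> powr p)" "expectation (\<lambda>\<omega>. err \<omega> powr p) \<le> (E * (T / real n)) powr p * B"
      using strong_error_moment_bound[OF drift I C2(1,2,4,5) \<open>\<gamma> > 0\<close> T \<open>y \<in> I\<close> \<open>standard_brownian_motion M W\<close>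
          Yad Yc YI Yeq' \<open>p \<ge> 1\<close> intG[unfolded G_def] intH[unfolded H_def] n]
      unfolding B_def E_def err_def G_def H_def by auto
    have "expectation (\<lambda>\<omega>. err \<omega> powr p) powr (1 / p) \<le> ((E * (T / real n)) powr p * B) powr (1 / p)"
      using bound(2) \<open>p \<ge> 1\<close> by (intro powr_mono2 Bochner_Integration.integral_nonneg) auto
    also have "\<dots> = E * (T / real n) * B powr (1 / p)"
      using B0 T \<open>p \<ge> 1\<close> by (simp add: powr_mult powr_powr E_def)
    also have "\<dots> \<le> (E * B powr (1 / p) + 1) * (T / real n)"
      using T by (simp add: algebra_simps)
    finally show "let err = (\<lambda>\<omega>. SUP t\<in>{0..T}. \<bar>implicit_euler I f \<gamma> y T n (\<lambda>s. W s \<omega>) t - Y t \<omega>\<bar>)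
     in integrable M (\<lambda>\<omega>. err \<omega> powr p) \<and>
        (\<integral>\<omega>. err \<omega> powr p \<partial>M) powr (1 / p) \<le> (E * B powr (1 / p) + 1) * (T / real n)"
      using bound(1) unfolding Let_def err_def by blast
  qed
qed

end
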